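(* Let $L$ be a finite-dimensional simple Leibniz algebra over a field $F$ of characteristic zero, and let $I$ be the ideal of $L$ spanned by the squares $[x,x]$, $x\in L$. Regard $I$ as a right $L/I$-module via $m*(a+I)=[m,a]$ for $m\in I$, $a\in L$. Put $G=L/I$ and $M=I$. Then $G$ is a simple Lie algebra, $M$ is an irreducible $G$-module (or zero, when $L$ is a Lie algebra), and $L$ is isomorphic, as a Leibniz algebra, to the vector space direct sum $G+M$ equipped with the multiplication $$[x+m,\,y+n]=[x,y]+m*y,\qquad x,y\in G,\ m,n\in M .$$
   Context: All algebras and vector spaces are finite-dimensional over a field of characteristic zero. A (right) Leibniz algebra is a vector space $L$ with a bilinear bracket satisfying $[x,[y,z]]=[[x,y],z]-[[x,z],y]$ for all $x,y,z\in L$. Let $I$ denote the subspace spanned by all squares $[x,x]$, $x\in L$; it is a two-sided ideal, and the smallest ideal for which $L/I$ is a Lie algebra. A Leibniz algebra $L$ is called simple if its only (two-sided) ideals are $\{0\}$, $I$, $L$, and $[L,L]\neq I$. An irreducible module is a nonzero module whose only submodules are zero and itself. *)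

theory Defs
  imports "HOL-Algebra.Algebraic_Closure_Type" "HOL-Algebra.QuotRing"
begin

text \<open>
  Scalars form a type \<open>'f\<close> of class \<open>field\<close>, seen as a \<open>HOL-Algebra\<close> ring through
  \<open>ring_of_type_algebra\<close>; vector spaces and algebras are carrier-based records of type
  \<open>('f, 'v) module\<close>.  The record field \<open>mult\<close> (written \<open>\<otimes>\<close>) holds the bracket \<open>[x, y]\<close>; the record
  field \<open>one\<close> plays no role.  For plain vector spaces \<open>mult\<close> is ignored as well.
\<close>

abbreviation subspace_of :: "'v set \<Rightarrow> ('f::field, 'v) module \<Rightarrow> bool"
  where "subspace_of H V \<equiv> submodule H (ring_of_type_algebra :: 'f ring) V"

definition span_in :: "('f::field, 'v) module \<Rightarrow> 'v set \<Rightarrow> 'v set"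
  where "span_in V S = (\<lambda>H. subspace_of H V) hull S"

definition finite_dimensional :: "('f::field, 'v) module \<Rightarrow> bool"
  where "finite_dimensional V \<longleftrightarrow>
    (\<exists>B. finite B \<and> B \<subseteq> carrier V \<and> span_in V B = carrier V)"

locale bilinear_algebra = module "ring_of_type_algebra :: 'f ring" L
  for L :: "('f::field, 'l) module" (structure) +
  assumes mult_closed: "\<lbrakk>x \<in> carrier L; y \<in> carrier L\<rbrakk> \<Longrightarrow> x \<otimes> y \<in> carrier L"
    and mult_add_left: "\<lbrakk>x \<in> carrier L; y \<in> carrier L; z \<in> carrier L\<rbrakk>
      \<Longrightarrow> (x \<oplus> y) \<otimes> z = (x \<otimes> z) \<oplus> (y \<otimes> z)"
    and mult_add_right: "\<lbrakk>x \<in> carrier L; y \<in> carrier L; z \<in> carrier L\<rbrakk>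
      \<Longrightarrow> x \<otimes> (y \<oplus> z) = (x \<otimes> y) \<oplus> (x \<otimes> z)"
    and mult_smult_left: "\<lbrakk>x \<in> carrier L; y \<in> carrier L\<rbrakk> \<Longrightarrow> (c \<odot> x) \<otimes> y = c \<odot> (x \<otimes> y)"
    and mult_smult_right: "\<lbrakk>x \<in> carrier L; y \<in> carrier L\<rbrakk> \<Longrightarrow> x \<otimes> (c \<odot> y) = c \<odot> (x \<otimes> y)"

locale leibniz_algebra = bilinear_algebra +
  assumes leibniz: "\<lbrakk>x \<in> carrier L; y \<in> carrier L; z \<in> carrier L\<rbrakk>
    \<Longrightarrow> x \<otimes> (y \<otimes> z) = ((x \<otimes> y) \<otimes> z) \<ominus> ((x \<otimes> z) \<otimes> y)"

locale lie_algebra = bilinear_algebra +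
  assumes alternating: "x \<in> carrier L \<Longrightarrow> x \<otimes> x = \<zero>"
    and jacobi: "\<lbrakk>x \<in> carrier L; y \<in> carrier L; z \<in> carrier L\<rbrakk>
      \<Longrightarrow> (x \<otimes> (y \<otimes> z)) \<oplus> (y \<otimes> (z \<otimes> x)) \<oplus> (z \<otimes> (x \<otimes> y)) = \<zero>"

text \<open>The predicate \<open>ideal\<close> of the library is restricted to associative rings.\<close>

definition algebra_ideal :: "('f::field, 'l) module \<Rightarrow> 'l set \<Rightarrow> bool"
  where "algebra_ideal L J \<longleftrightarrow> subspace_of J L \<and>
    (\<forall>x\<in>carrier L. \<forall>j\<in>J. x \<otimes>\<^bsub>L\<^esub> j \<in> J \<and> j \<otimes>\<^bsub>L\<^esub> x \<in> J)"

definition derived_algebra :: "('f::field, 'l) module \<Rightarrow> 'l set"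
  where "derived_algebra L = span_in L {x \<otimes>\<^bsub>L\<^esub> y | x y. x \<in> carrier L \<and> y \<in> carrier L}"

definition squares_ideal :: "('f::field, 'l) module \<Rightarrow> 'l set"
  where "squares_ideal L = span_in L {x \<otimes>\<^bsub>L\<^esub> x | x. x \<in> carrier L}"

definition simple_leibniz_algebra :: "('f::field, 'l) module \<Rightarrow> bool"
  where "simple_leibniz_algebra L \<longleftrightarrow> leibniz_algebra L \<and>
    (\<forall>J. algebra_ideal L J \<longrightarrow> J = {\<zero>\<^bsub>L\<^esub>} \<or> J = squares_ideal L \<or> J = carrier L) \<and>
    derived_algebra L \<noteq> squares_ideal L"

definition simple_lie_algebra :: "('f::field, 'l) module \<Rightarrow> bool"
  where "simple_lie_algebra L \<longleftrightarrow> lie_algebra L \<and>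
    (\<forall>J. algebra_ideal L J \<longrightarrow> J = {\<zero>\<^bsub>L\<^esub>} \<or> J = carrier L) \<and>
    derived_algebra L \<noteq> {\<zero>\<^bsub>L\<^esub>}"

text \<open>The library's \<open>L Quot J\<close>, together with the induced scalar multiplication.\<close>

definition quotient_algebra :: "('f::field, 'l) module \<Rightarrow> 'l set \<Rightarrow> ('f, 'l set) module"
  where "quotient_algebra L J =
    ring.extend (L Quot J) (module.fields (\<lambda>c A. \<Union>a\<in>A. J +>\<^bsub>L\<^esub> (c \<odot>\<^bsub>L\<^esub> a)))"

text \<open>Right modules \<open>m * x\<close> over a Lie algebra; \<open>act m x\<close> is \<open>m * x\<close>.\<close>

locale right_lie_module = G?: lie_algebra G + M?: module "ring_of_type_algebra :: 'f ring" M
  for G :: "('f::field, 'g) module" and M :: "('f, 'm) module"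
    and act :: "'m \<Rightarrow> 'g \<Rightarrow> 'm" +
  assumes act_closed: "\<lbrakk>m \<in> carrier M; x \<in> carrier G\<rbrakk> \<Longrightarrow> act m x \<in> carrier M"
    and act_add_left: "\<lbrakk>m \<in> carrier M; n \<in> carrier M; x \<in> carrier G\<rbrakk>
      \<Longrightarrow> act (m \<oplus>\<^bsub>M\<^esub> n) x = act m x \<oplus>\<^bsub>M\<^esub> act n x"
    and act_add_right: "\<lbrakk>m \<in> carrier M; x \<in> carrier G; y \<in> carrier G\<rbrakk>
      \<Longrightarrow> act m (x \<oplus>\<^bsub>G\<^esub> y) = act m x \<oplus>\<^bsub>M\<^esub> act m y"
    and act_smult_left: "\<lbrakk>m \<in> carrier M; x \<in> carrier G\<rbrakk>
      \<Longrightarrow> act (c \<odot>\<^bsub>M\<^esub> m) x = c \<odot>\<^bsub>M\<^esub> act m x"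
    and act_smult_right: "\<lbrakk>m \<in> carrier M; x \<in> carrier G\<rbrakk>
      \<Longrightarrow> act m (c \<odot>\<^bsub>G\<^esub> x) = c \<odot>\<^bsub>M\<^esub> act m x"
    and act_bracket: "\<lbrakk>m \<in> carrier M; x \<in> carrier G; y \<in> carrier G\<rbrakk>
      \<Longrightarrow> act m (x \<otimes>\<^bsub>G\<^esub> y) = act (act m x) y \<ominus>\<^bsub>M\<^esub> act (act m y) x"

definition lie_submodule ::
    "('f::field, 'g) module \<Rightarrow> ('f, 'm) module \<Rightarrow> ('m \<Rightarrow> 'g \<Rightarrow> 'm) \<Rightarrow> 'm set \<Rightarrow> bool"
  where "lie_submodule G M act N \<longleftrightarrow> subspace_of N M \<and>
    (\<forall>n\<in>N. \<forall>x\<in>carrier G. act n x \<in> N)"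

definition irreducible_lie_module ::
    "('f::field, 'g) module \<Rightarrow> ('f, 'm) module \<Rightarrow> ('m \<Rightarrow> 'g \<Rightarrow> 'm) \<Rightarrow> bool"
  where "irreducible_lie_module G M act \<longleftrightarrow> right_lie_module G M act \<and>
    carrier M \<noteq> {\<zero>\<^bsub>M\<^esub>} \<and>
    (\<forall>N. lie_submodule G M act N \<longrightarrow> N = {\<zero>\<^bsub>M\<^esub>} \<or> N = carrier M)"

text \<open>
  The action \<open>m * (a + J) = [m, a]\<close> of a quotient of \<open>L\<close>, computed on a chosen representative of
  the coset.  It is independent of that choice only where \<open>[m, J] = 0\<close>.
\<close>

definition coset_action :: "('f::field, 'l) module \<Rightarrow> 'l \<Rightarrow> 'l set \<Rightarrow> 'l"
  where "coset_action L m A = m \<otimes>\<^bsub>L\<^esub> (SOME a. a \<in> A)"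

text \<open>The space \<open>G + M\<close> with the multiplication \<open>[x + m, y + n] = [x, y] + m * y\<close>.\<close>

definition hemisemidirect_sum ::
    "('f::field, 'g) module \<Rightarrow> ('f, 'm) module \<Rightarrow> ('m \<Rightarrow> 'g \<Rightarrow> 'm) \<Rightarrow> ('f, 'g \<times> 'm) module"
  where "hemisemidirect_sum G M act =
    \<lparr>carrier = carrier G \<times> carrier M,
     monoid.mult = (\<lambda>(x, m) (y, n). (x \<otimes>\<^bsub>G\<^esub> y, act m y)),
     one = (\<one>\<^bsub>G\<^esub>, \<one>\<^bsub>M\<^esub>),
     ring.zero = (\<zero>\<^bsub>G\<^esub>, \<zero>\<^bsub>M\<^esub>),
     add = (\<lambda>(x, m) (y, n). (x \<oplus>\<^bsub>G\<^esub> y, m \<oplus>\<^bsub>M\<^esub> n)),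
     module.smult = (\<lambda>c (x, m). (c \<odot>\<^bsub>G\<^esub> x, c \<odot>\<^bsub>M\<^esub> m))\<rparr>"

definition leibniz_isomorphic :: "('f::field, 'l) module \<Rightarrow> ('f, 'k) module \<Rightarrow> bool"
  where "leibniz_isomorphic L K \<longleftrightarrow> leibniz_algebra L \<and> leibniz_algebra K \<and>
    (\<exists>h. bij_betw h (carrier L) (carrier K) \<and>
      (\<forall>x\<in>carrier L. \<forall>y\<in>carrier L. h (x \<oplus>\<^bsub>L\<^esub> y) = h x \<oplus>\<^bsub>K\<^esub> h y) \<and>
      (\<forall>c. \<forall>x\<in>carrier L. h (c \<odot>\<^bsub>L\<^esub> x) = c \<odot>\<^bsub>K\<^esub> h x) \<and>
      (\<forall>x\<in>carrier L. \<forall>y\<in>carrier L. h (x \<otimes>\<^bsub>L\<^esub> y) = h x \<otimes>\<^bsub>K\<^esub> h y))"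

end

theory Submission
  imports Defs "HOL-Library.Function_Algebras"
begin

text \<open>
  Right multiplication kills \<open>[L, I]\<close>, so it turns all of \<open>L\<close> into a right module over the Lie algebra
  \<open>G = L/I\<close>, and \<open>I\<close> is a submodule.  It suffices to split this submodule off: if \<open>\<pi>\<close> is a module
  projection of \<open>L\<close> onto \<open>I\<close>, then \<open>x \<mapsto> (x + I, \<pi> x)\<close> is an isomorphism onto \<open>G + I\<close>.

  Any linear projection differs from a module projection by a cocycle \<open>G \<rightarrow> Hom(G, I)\<close>, so the
  splitting is an instance of Whitehead's first lemma.  That lemma follows from the Casimir operator
  once the trace form of a nontrivial module over a simple Lie algebra is known to be nonzero.  For
  this (Cartan's criterion) the scalars are extended to the algebraic closure: if the form vanished,
  then \<open>\<Sum> a\<^sub>i f(a\<^sub>i) = 0\<close> for the eigenvalues \<open>a\<^sub>i\<close> of any \<open>x\<close> and every rational linear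
  functional \<open>f\<close>, so every \<open>x\<close> would act nilpotently, and Engel's argument would make a perfect
  algebra act trivially.
\<close>

section \<open>Traces and triangular bases\<close>

text \<open>The cohomological argument never forms the quotient. It runs over a coordinate copy of
  \<open>L\<close>, whose bracket is a Lie bracket only modulo elements that act by zero. In Hom(L,
  I) a linear projection \<open>p\<close> onto \<open>I\<close> is the identity on \<open>I\<close>,
  so its defect \<open>act p x\<close>, the commutator with right multiplication by
  \<open>x\<close>, vanishes on \<open>I\<close>. The defects thus lie in the submodule
  \<open>W\<close> of maps killing \<open>I\<close>, a copy of Hom(L/I, I), and the task is to find
  \<open>w\<close> in \<open>W\<close> with \<open>act (p - w) x = 0\<close> for all
  \<open>x\<close>. A maximal orthogonal set \<open>E\<close> of non-isotropic vectors spans a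
  complement of the radical; the radical is an ideal that acts trivially, and the Casimir operator
  of \<open>E\<close> still commutes with the action. Its trace is \<open>card E\<close>, nonzero in
  characteristic zero, which makes its Fitting null component smaller than \<open>W\<close>.
  Cartan's criterion needs eigenvalues, hence the algebraic closure, and rational functionals
  because a vanishing sum of squares of rationals forces every term to vanish.\<close>

text \<open>
  A copy of \<open>vector_space\<close>: new constants of that locale would be shadowed by their instance for
  real vector spaces, which the library interprets globally.
\<close>

locale linear_space = vector_space scale
  for scale :: "'a::field \<Rightarrow> 'b::ab_group_add \<Rightarrow> 'b" (infixr \<open>*s\<close> 75)
begin

lemma in_span_mono: "v \<in> span A \<Longrightarrow> A \<subseteq> B \<Longrightarrow> v \<in> span B"
  using span_mono by blast

lemma linear_in_span:
  assumes "Vector_Spaces.linear (*s) (*s) T" "\<And>b. b \<in> B \<Longrightarrow> T b \<in> span C" "v \<in> span B"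
  shows "T v \<in> span C"
proof -
  interpret T: Vector_Spaces.linear "(*s)" "(*s)" T by fact
  have "span (T ` B) \<subseteq> span C" using assms(2) by (intro span_minimal) auto
  then show ?thesis using T.span_image assms(3) by auto
qed

text \<open>The ambient spaces are function spaces that may be infinite-dimensional, so finiteness
  is attached to subspaces; the finite spanning set may lie outside \<open>W\<close>.\<close>

definition fin_dim :: "'b set \<Rightarrow> bool"
  where "fin_dim W \<longleftrightarrow> subspace W \<and> (\<exists>S. finite S \<and> W \<subseteq> span S)"

lemma fin_dim_subspace: "fin_dim W \<Longrightarrow> subspace W"
  by (simp add: fin_dim_def)

lemma fin_dim_mono: "fin_dim W \<Longrightarrow> subspace V \<Longrightarrow> V \<subseteq> W \<Longrightarrow> fin_dim V"
  unfolding fin_dim_def by blast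

lemma fin_dim_span: "finite B \<Longrightarrow> fin_dim (span B)"
  unfolding fin_dim_def by blast

lemma fin_dim_basis_extend:
  assumes "fin_dim W" "S \<subseteq> W" "independent S"
  obtains B where "S \<subseteq> B" "finite B" "independent B" "span B = W"
proof -
  obtain B where B: "S \<subseteq> B" "B \<subseteq> W" "independent B" "W \<subseteq> span B"
    using maximal_independent_subset_extend assms by metis
  moreover have "finite B"
    using assms(1) B independent_span_bound unfolding fin_dim_def by (meson order_trans)
  moreover have "span B = W"
    using B assms(1) span_minimal[of B W] unfolding fin_dim_def by blast
  ultimately show ?thesis using that by blast
qed

lemma fin_dim_basis:
  assumes "fin_dim W"
  obtains B where "finite B" "independent B" "span B = W"
  using fin_dim_basis_extend[OF assms, of "{}"] independent_empty by blast

lemma dim_psubset_less: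
  assumes "fin_dim W" "subspace V" "V \<subset> W"
  shows "dim V < dim W"
proof -
  obtain B where B: "finite B" "independent B" "span B = V"
    using fin_dim_basis fin_dim_mono assms by (metis psubset_imp_subset)
  have "B \<subseteq> W" using B(3) assms(3) span_superset by auto
  then obtain C where C: "B \<subseteq> C" "finite C" "independent C" "span C = W"
    using fin_dim_basis_extend assms(1) B(2) by metis
  have "B \<noteq> C" using B C assms(3) by auto
  then have "card B < card C" using C B by (simp add: psubset_card_mono psubsetI)
  then show ?thesis
    using B C dim_span_eq_card_independent by metis
qed

text \<open>A nonzero kernel vector could be completed to a basis of \<open>W\<close>; the images of
  the other basis vectors would then already span \<open>W\<close>, with one vector too few.\<close>

lemma linear_surj_on_imp_inj_on:
  assumes "fin_dim W" "Vector_Spaces.linear (*s) (*s) T" "T ` W = W" "v \<in> W" "T v = 0"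
  shows "v = 0"
proof (rule ccontr)
  assume "v \<noteq> 0"
  interpret T: Vector_Spaces.linear "(*s)" "(*s)" T by fact
  obtain B where B: "{v} \<subseteq> B" "finite B" "independent B" "span B = W"
    using fin_dim_basis_extend[OF assms(1), of "{v}"] \<open>v \<noteq> 0\<close> assms(4) by auto
  have "span (T ` B) = W"
    using T.span_image B(4) assms(3) by auto
  moreover have TB: "T ` B \<subseteq> span (T ` (B - {v}))"
  proof clarify
    fix b assume "b \<in> B"
    then show "T b \<in> span (T ` (B - {v}))"
      using assms(5) span_zero span_base[of "T b" "T ` (B - {v})"] by (cases "b = v") auto
  qed
  ultimately have "W \<subseteq> span (T ` (B - {v}))"
    using span_minimal[OF TB] by blast
  moreover have "B \<subseteq> W" using B(4) span_superset by blast
  ultimately have "B \<subseteq> span (T ` (B - {v}))" by blast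
  then have "card B \<le> card (T ` (B - {v}))"
    using independent_span_bound[of "T ` (B - {v})" B] B by simp
  also have "\<dots> \<le> card (B - {v})" using B by (intro card_image_le) simp
  also have "\<dots> < card B" using B by (intro card_Diff1_less) auto
  finally show False by simp
qed

text \<open>Matrix multiplication with separate bases for source and target. Taking \<open>T\<close>
  to be the identity gives the change of coordinates.\<close>

lemma representation_linear:
  assumes B: "finite B" "independent B" and C: "independent C"
    and T: "Vector_Spaces.linear (*s) (*s) T" "\<And>b. b \<in> B \<Longrightarrow> T b \<in> span C" and v: "v \<in> span B"
  shows "representation C (T v) c = (\<Sum>b\<in>B. representation B v b * representation C (T b) c)"
proof -
  interpret T: Vector_Spaces.linear "(*s)" "(*s)" T by fact
  have "T v = T (\<Sum>b\<in>B. representation B v b *s b)"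
    using sum_representation_eq[OF B(2) v B(1)] by simp
  also have "\<dots> = (\<Sum>b\<in>B. representation B v b *s T b)"
    by (simp add: T.sum T.scale)
  finally show ?thesis
    using T(2) C by (simp add: representation_sum representation_scale span_scale)
qed

section \<open>Traces relative to a finite basis\<close>

definition trace :: "'b set \<Rightarrow> ('b \<Rightarrow> 'b) \<Rightarrow> 'a"
  where "trace B T = (\<Sum>b\<in>B. representation B (T b) b)"

lemma trace_add:
  assumes "independent B" "\<And>b. b \<in> B \<Longrightarrow> S b \<in> span B" "\<And>b. b \<in> B \<Longrightarrow> T b \<in> span B"
  shows "trace B (\<lambda>v. S v + T v) = trace B S + trace B T"
  using assms by (simp add: trace_def representation_add sum.distrib)

lemma trace_diff:
  assumes "independent B" "\<And>b. b \<in> B \<Longrightarrow> S b \<in> span B" "\<And>b. b \<in> B \<Longrightarrow> T b \<in> span B"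
  shows "trace B (\<lambda>v. S v - T v) = trace B S - trace B T"
  using assms by (simp add: trace_def representation_diff sum_subtractf)

lemma trace_scale:
  assumes "independent B" "\<And>b. b \<in> B \<Longrightarrow> T b \<in> span B"
  shows "trace B (\<lambda>v. k *s T v) = k * trace B T"
  using assms by (simp add: trace_def representation_scale sum_distrib_left)

lemma trace_sum:
  assumes "independent B" "\<And>i b. i \<in> I \<Longrightarrow> b \<in> B \<Longrightarrow> T i b \<in> span B"
  shows "trace B (\<lambda>v. \<Sum>i\<in>I. T i v) = (\<Sum>i\<in>I. trace B (T i))"
  using assms unfolding trace_def by (subst sum.swap) (simp add: representation_sum)

lemma trace_cong: "(\<And>b. b \<in> B \<Longrightarrow> S b = T b) \<Longrightarrow> trace B S = trace B T"
  by (simp add: trace_def)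

lemma trace_commute:
  assumes B: "finite B" "independent B"
    and S: "Vector_Spaces.linear (*s) (*s) S" "\<And>b. b \<in> B \<Longrightarrow> S b \<in> span B"
    and T: "Vector_Spaces.linear (*s) (*s) T" "\<And>b. b \<in> B \<Longrightarrow> T b \<in> span B"
  shows "trace B (\<lambda>v. S (T v)) = trace B (\<lambda>v. T (S v))"
proof -
  have "trace B (\<lambda>v. S (T v)) = (\<Sum>b\<in>B. \<Sum>c\<in>B. representation B (T b) c * representation B (S c) b)"
    unfolding trace_def by (rule sum.cong) (auto intro!: representation_linear B S T)
  also have "\<dots> = (\<Sum>c\<in>B. \<Sum>b\<in>B. representation B (S c) b * representation B (T b) c)"
    by (subst sum.swap) (simp add: mult.commute)
  also have "\<dots> = trace B (\<lambda>v. T (S v))"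
    unfolding trace_def by (rule sum.cong) (auto intro!: representation_linear[symmetric] B S T)
  finally show ?thesis .
qed

text \<open>Reading the \<open>B\<close>-coordinate of \<open>T b\<close> through \<open>C\<close>
  gives a double sum over \<open>B\<close> and \<open>C\<close>; contracting it over
  \<open>B\<close> instead leaves the diagonal of \<open>T\<close> in \<open>C\<close>.\<close>

lemma trace_basis_change:
  assumes B: "finite B" "independent B" and C: "finite C" "independent C" and "span B = span C"
    and T: "Vector_Spaces.linear (*s) (*s) T" "\<And>b. b \<in> B \<Longrightarrow> T b \<in> span B"
  shows "trace B T = trace C T"
proof -
  have id: "Vector_Spaces.linear (*s) (*s) (\<lambda>v. v)" by (rule linear_ident)
  have BC: "b \<in> B \<Longrightarrow> b \<in> span C" "c \<in> C \<Longrightarrow> c \<in> span B" for b c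
    using assms(5) span_base by blast+
  have "trace B T = (\<Sum>b\<in>B. \<Sum>c\<in>C. representation C (T b) c * representation B c b)"
    unfolding trace_def
    using assms(5) BC T(2) by (intro sum.cong refl representation_linear[OF C B(2) id]) auto
  also have "\<dots> = (\<Sum>c\<in>C. \<Sum>b\<in>B. representation B c b * representation C (T b) c)"
    by (subst sum.swap) (simp add: mult.commute)
  also have "\<dots> = trace C T"
    unfolding trace_def
    using assms(5) BC T(2) by (intro sum.cong refl representation_linear[OF B C(2) T(1), symmetric]) auto
  finally show ?thesis .
qed

lemma linear_shift: "Vector_Spaces.linear (*s) (*s) T \<Longrightarrow> Vector_Spaces.linear (*s) (*s) (\<lambda>v. T v - l *s v)"
  unfolding Vector_Spaces.linear_iff by (simp add: algebra_simps)

lemma linear_funpow: "Vector_Spaces.linear (*s) (*s) T \<Longrightarrow> Vector_Spaces.linear (*s) (*s) (T ^^ n)"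
  by (induction n) (auto simp: Vector_Spaces.linear_iff vector_space_axioms)

text \<open>
  A Jordan-type basis: \<open>T\<close> is triangular for the height \<open>r\<close>, and only interacts basis vectors
  with the same diagonal entry, so its diagonal and strictly triangular parts commute.
\<close>

definition adapted_basis :: "('b \<Rightarrow> 'b) \<Rightarrow> 'b set \<Rightarrow> ('b \<Rightarrow> 'a) \<Rightarrow> ('b \<Rightarrow> nat) \<Rightarrow> bool"
  where "adapted_basis T B \<alpha> r \<longleftrightarrow> finite B \<and> independent B \<and>
    (\<forall>b\<in>B. T b - \<alpha> b *s b \<in> span {c \<in> B. r c < r b \<and> \<alpha> c = \<alpha> b})"

text \<open>Induction on the dimension. Non-surjectivity of \<open>T - l\<close> on \<open>W\<close>
  is the useful form of an eigenvalue: it puts the image of \<open>T - l\<close> into a hyperplane,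
  which \<open>T\<close> then preserves. The set \<open>\<Lambda>\<close> serves two cases, all
  scalars over a closed field and \<open>{0}\<close> for nilpotent maps.\<close>

lemma adapted_basis_exists:
  assumes T: "Vector_Spaces.linear (*s) (*s) T" and "fin_dim W" "T ` W \<subseteq> W"
    and eig: "\<And>V. subspace V \<Longrightarrow> V \<subseteq> W \<Longrightarrow> T ` V \<subseteq> V \<Longrightarrow> V \<noteq> {0} \<Longrightarrow>
      \<exists>l\<in>\<Lambda>. (\<lambda>v. T v - l *s v) ` V \<noteq> V"
  shows "\<exists>B \<alpha> r. adapted_basis T B \<alpha> r \<and> span B = W \<and> \<alpha> ` B \<subseteq> \<Lambda>"
  using assms(2-)
proof (induction "dim W" arbitrary: W rule: less_induct)
  case less
  note W = \<open>fin_dim W\<close> \<open>T ` W \<subseteq> W\<close>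
  show ?case
  proof (cases "W = {0}")
    case True
    have "adapted_basis T {} (\<lambda>_. 0) (\<lambda>_. 0)" by (simp add: adapted_basis_def independent_empty)
    with True show ?thesis by (intro exI[of _ "{}"] exI) auto
  next
    case False
    then obtain l where l: "l \<in> \<Lambda>" "(\<lambda>v. T v - l *s v) ` W \<noteq> W"
      using less.prems(3)[OF fin_dim_subspace[OF W(1)] order_refl W(2)] by blast
    define N where "N = (\<lambda>v. T v - l *s v)"
    have linN: "Vector_Spaces.linear (*s) (*s) N" unfolding N_def by (rule linear_shift[OF T])
    interpret N: Vector_Spaces.linear "(*s)" "(*s)" N by fact
    have sW: "subspace W" using W fin_dim_subspace by blast
    have NW: "N v \<in> W" if "v \<in> W" for v
      using that W sW unfolding N_def by (auto intro!: subspace_diff subspace_scale)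
    have NWW: "N ` W \<subseteq> W" using NW by blast
    have sNW: "subspace (N ` W)" by (rule N.subspace_image[OF sW])
    obtain B0 where B0: "finite B0" "independent B0" "span B0 = N ` W"
      by (rule fin_dim_basis[OF fin_dim_mono[OF W(1) sNW NWW]])
    have "B0 \<subseteq> W" using B0(3) NWW span_superset by blast
    then obtain B1 where B1: "B0 \<subseteq> B1" "finite B1" "independent B1" "span B1 = W"
      by (rule fin_dim_basis_extend[OF W(1) _ B0(2)])
    have "B1 \<noteq> B0" using B1 B0 l(2) unfolding N_def by auto
    then obtain v where v: "v \<in> B1" "v \<notin> B0" using B1 by auto
    \<comment> \<open>\<open>B1 - {v}\<close> still contains a basis of the image of
      \<open>N\<close>, so this hyperplane contains that image.\<close>
    define V where "V = span (B1 - {v})"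
    have vV: "v \<notin> V" using B1(3) v unfolding V_def dependent_def by blast
    have VW: "V \<subseteq> W" unfolding V_def using B1(4) span_mono by blast
    have vW: "v \<in> W" using v B1 span_base by blast
    have NV: "N w \<in> V" if "w \<in> W" for w
      using that B0(3) v B1(1) span_mono[of B0 "B1 - {v}"] unfolding V_def by blast
    have sV: "subspace V" unfolding V_def by blast
    have TV: "T w \<in> V" if "w \<in> V" for w
    proof -
      have "T w = N w + l *s w" by (simp add: N_def)
      then show ?thesis using NV that VW sV by (auto intro: subspace_add subspace_scale)
    qed
    have "\<exists>B \<alpha> r. adapted_basis T B \<alpha> r \<and> span B = V \<and> \<alpha> ` B \<subseteq> \<Lambda>"
    proof (rule less.hyps)
      show "dim V < dim W" using VW vV vW by (intro dim_psubset_less[OF W(1) sV]) auto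
      show "fin_dim V" by (rule fin_dim_mono[OF W(1) sV VW])
      show "T ` V \<subseteq> V" using TV by blast
      show "\<exists>l\<in>\<Lambda>. (\<lambda>v. T v - l *s v) ` Z \<noteq> Z"
        if "subspace Z" "Z \<subseteq> V" "T ` Z \<subseteq> Z" "Z \<noteq> {0}" for Z
        using less.prems(3)[OF that(1) _ that(3,4)] that(2) VW by auto
    qed
    then obtain B \<alpha> r where B: "adapted_basis T B \<alpha> r" "span B = V" "\<alpha> ` B \<subseteq> \<Lambda>"
      by blast
    have finB: "finite B" and indB: "independent B"
      and adB: "\<And>b. b \<in> B \<Longrightarrow> T b - \<alpha> b *s b \<in> span {c \<in> B. r c < r b \<and> \<alpha> c = \<alpha> b}"
      using B(1) by (auto simp: adapted_basis_def)
    \<comment> \<open>\<open>N\<close> maps the span of the basis vectors with other diagonal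
      entries onto itself: there it is a nonzero scalar plus a part of lower height. So the
      \<open>Q\<close>-part of \<open>N v\<close> can be removed by changing \<open>v\<close> inside
      \<open>V\<close>.\<close>
    define Q where "Q = span {c \<in> B. \<alpha> c \<noteq> l}"
    have "c \<in> N ` Q" if "c \<in> B" "\<alpha> c \<noteq> l" for c
      using that
    proof (induction "r c" arbitrary: c rule: less_induct)
      case (less c)
      define t where "t = T c - \<alpha> c *s c"
      have sNQ: "subspace (N ` Q)" unfolding Q_def by (rule N.subspace_image) simp
      have "t \<in> span {d \<in> B. r d < r c \<and> \<alpha> d = \<alpha> c}"
        using adB less.prems unfolding t_def by blast
      moreover have "{d \<in> B. r d < r c \<and> \<alpha> d = \<alpha> c} \<subseteq> N ` Q"
        using less by auto
      ultimately have t: "t \<in> N ` Q" using span_minimal[OF _ sNQ] by blast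
      have "c \<in> Q" unfolding Q_def using less.prems by (simp add: span_base)
      then have "N c \<in> N ` Q" by blast
      then have "inverse (\<alpha> c - l) *s (N c - t) \<in> N ` Q"
        using t sNQ by (simp add: subspace_diff subspace_scale)
      also have "N c - t = (\<alpha> c - l) *s c"
        by (simp add: N_def t_def algebra_simps)
      finally show ?case using less.prems by simp
    qed
    then have QN: "Q \<subseteq> N ` Q"
      unfolding Q_def by (intro span_minimal) (auto intro!: N.subspace_image)
    have "N v \<in> span ({c \<in> B. \<alpha> c = l} \<union> {c \<in> B. \<alpha> c \<noteq> l})"
    proof -
      have "{c \<in> B. \<alpha> c = l} \<union> {c \<in> B. \<alpha> c \<noteq> l} = B" by auto
      then show ?thesis using NV[OF vW] B(2) by simp
    qed
    then obtain s1 s2 where s: "N v = s1 + s2" "s1 \<in> span {c \<in> B. \<alpha> c = l}" "s2 \<in> Q"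
      unfolding Q_def span_Un by blast
    obtain u where u: "u \<in> Q" "N u = s2" using QN s by blast
    have uV: "u \<in> V" using u(1) B(2) span_mono[of "{c \<in> B. \<alpha> c \<noteq> l}" B] unfolding Q_def by auto
    define v' where "v' = v - u"
    have Nv': "N v' = s1" using s u by (simp add: v'_def N.diff)
    have v'V: "v' \<notin> V" using vV uV sV subspace_add[of V v' u] by (auto simp: v'_def)
    have v'B: "v' \<notin> B" using v'V B(2) span_base by blast
    define B' where "B' = insert v' B"
    define \<alpha>' where "\<alpha>' = \<alpha>(v' := l)"
    \<comment> \<open>The new height exceeds that of every old basis vector, so all of them count as
      lower than \<open>v'\<close>.\<close>
    define r' where "r' = r(v' := Suc (\<Sum>c\<in>B. r c))"
    have r'c: "r c < Suc (\<Sum>c\<in>B. r c)" if "c \<in> B" for c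
      using member_le_sum[of c B r] that finB by simp
    have "span B' = W"
    proof
      show "span B' \<subseteq> W" unfolding B'_def
        using B(2) VW span_superset[of B] uV vW sW
        by (intro span_minimal) (auto simp: v'_def intro!: subspace_diff)
      have VB': "V \<subseteq> span B'" using B(2) span_mono[of B B'] unfolding B'_def by auto
      have "v' \<in> span B'" by (rule span_base) (simp add: B'_def)
      then have "v' + u \<in> span B'" using uV VB' by (intro span_add) auto
      then have "v \<in> span B'" by (simp add: v'_def)
      moreover have "B1 - {v} \<subseteq> span B'"
        using VB' span_superset[of "B1 - {v}"] unfolding V_def by (rule order_trans[rotated])
      ultimately have "B1 \<subseteq> span B'" by blast
      then show "W \<subseteq> span B'" using span_minimal[of B1 "span B'"] B1(4) by auto
    qed
    moreover have "adapted_basis T B' \<alpha>' r'"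
      unfolding adapted_basis_def
    proof (intro conjI ballI)
      show "finite B'" "independent B'"
        using finB indB B(2) v'V by (auto simp: B'_def independent_insertI)
      fix b assume b: "b \<in> B'"
      show "T b - \<alpha>' b *s b \<in> span {c \<in> B'. r' c < r' b \<and> \<alpha>' c = \<alpha>' b}"
      proof (cases "b = v'")
        case True
        have "{c \<in> B. \<alpha> c = l} \<subseteq> {c \<in> B'. r' c < r' b \<and> \<alpha>' c = \<alpha>' b}"
          using True r'c v'B by (auto simp: B'_def r'_def \<alpha>'_def)
        then have s1: "s1 \<in> span {c \<in> B'. r' c < r' b \<and> \<alpha>' c = \<alpha>' b}"
          by (rule in_span_mono[OF s(2)])
        have "T b - \<alpha>' b *s b = s1" using Nv' True by (simp add: N_def \<alpha>'_def)
        with s1 show ?thesis by (simp only:)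
      next
        case False
        then have "b \<in> B" using b by (simp add: B'_def)
        have sub: "{c \<in> B. r c < r b \<and> \<alpha> c = \<alpha> b} \<subseteq> {c \<in> B'. r' c < r' b \<and> \<alpha>' c = \<alpha>' b}"
          using False v'B by (auto simp: B'_def r'_def \<alpha>'_def)
        have "\<alpha>' b = \<alpha> b" using False by (simp add: \<alpha>'_def)
        then show ?thesis using in_span_mono[OF adB[OF \<open>b \<in> B\<close>] sub] by simp
      qed
    qed
    moreover have "\<alpha>' ` B' \<subseteq> \<Lambda>" using B(3) l(1) by (auto simp: \<alpha>'_def B'_def)
    ultimately show ?thesis by blast
  qed
qed

lemma adapted_basis_invariant:
  assumes "adapted_basis T B \<alpha> r" "b \<in> B"
  shows "T b \<in> span B"
proof -
  have "T b - \<alpha> b *s b \<in> span B"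
    by (rule in_span_mono[of _ "{c \<in> B. r c < r b \<and> \<alpha> c = \<alpha> b}"])
      (use assms in \<open>auto simp: adapted_basis_def\<close>)
  then have "(T b - \<alpha> b *s b) + \<alpha> b *s b \<in> span B"
    by (rule span_add) (intro span_scale span_base assms(2))
  then show ?thesis by simp
qed

lemma adapted_basis_representation:
  assumes "adapted_basis T B \<alpha> r" "b \<in> B" "c \<in> B"
  shows "representation B (T b) b = \<alpha> b"
    and "c \<noteq> b \<Longrightarrow> representation B (T b) c \<noteq> 0 \<Longrightarrow> r c < r b \<and> \<alpha> c = \<alpha> b"
proof -
  let ?S = "{c \<in> B. r c < r b \<and> \<alpha> c = \<alpha> b}"
  define t where "t = T b - \<alpha> b *s b"
  have B: "finite B" "independent B" and t: "t \<in> span ?S"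
    using assms unfolding t_def adapted_basis_def by auto
  have S: "independent ?S" using B(2) by (rule independent_mono) auto
  have bB: "b \<in> span B" using assms(2) by (rule span_base)
  have "representation B t = representation ?S t"
    using B(2) t by (rule representation_extend) auto
  then have "representation B t c = 0" if "c \<notin> ?S" for c
    using that representation_ne_zero[of ?S t c] by auto
  moreover have "T b = t + \<alpha> b *s b" by (simp add: t_def)
  moreover have "t \<in> span B" using t span_mono[of ?S B] by blast
  ultimately have *: "representation B (T b) c = \<alpha> b * (if c = b then 1 else 0)" if "c \<notin> ?S" for c
    using that B bB assms(2) by (simp add: representation_add representation_scale representation_basis span_scale)
  then show "representation B (T b) b = \<alpha> b" by simp
  show "c \<noteq> b \<Longrightarrow> representation B (T b) c \<noteq> 0 \<Longrightarrow> r c < r b \<and> \<alpha> c = \<alpha> b"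
    using *[of c] by auto
qed

text \<open>With zero diagonal \<open>T\<close> strictly lowers the height, so a number above all
  heights serves as exponent.\<close>

lemma adapted_basis_nilpotent:
  assumes "Vector_Spaces.linear (*s) (*s) T" "adapted_basis T B \<alpha> r" "\<And>b. b \<in> B \<Longrightarrow> \<alpha> b = 0"
  shows "\<exists>n. \<forall>v\<in>span B. (T ^^ n) v = 0"
proof -
  interpret T: Vector_Spaces.linear "(*s)" "(*s)" T by fact
  have *: "(T ^^ k) v = 0" if "v \<in> span {c \<in> B. r c < k}" for k v
    using that
  proof (induction k arbitrary: v)
    case (Suc k)
    have TbS: "T b \<in> span {c \<in> B. r c < k}" if b: "b \<in> {c \<in> B. r c < Suc k}" for b
    proof -
      from b have "T b \<in> span {c \<in> B. r c < r b \<and> \<alpha> c = \<alpha> b}"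
        using assms(2,3) by (auto simp: adapted_basis_def)
      then show "T b \<in> span {c \<in> B. r c < k}"
        by (rule in_span_mono) (use b in auto)
    qed
    have "T v \<in> span {c \<in> B. r c < k}"
      by (rule linear_in_span[OF assms(1) TbS Suc.prems])
    then show ?case using Suc.IH by (simp add: funpow_Suc_right del: funpow.simps)
  qed auto
  have "{c \<in> B. r c < Suc (\<Sum>c\<in>B. r c)} = B"
    using assms(2) member_le_sum[of _ B r] by (auto simp: adapted_basis_def less_Suc_eq_le)
  then show ?thesis
    using *[where k = "Suc (\<Sum>c\<in>B. r c)"] by (intro exI[of _ "Suc (\<Sum>c\<in>B. r c)"]) auto
qed

lemma trace_adapted_basis: "adapted_basis T B \<alpha> r \<Longrightarrow> trace B T = (\<Sum>b\<in>B. \<alpha> b)"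
  unfolding trace_def by (intro sum.cong refl adapted_basis_representation(1))

text \<open>A nilpotent map sends no nonzero invariant subspace onto itself, so an adapted basis
  with zero diagonal exists over every field; the trace is read off there.\<close>

lemma trace_nilpotent:
  assumes T: "Vector_Spaces.linear (*s) (*s) T" and B: "finite B" "independent B" "\<And>b. b \<in> B \<Longrightarrow> T b \<in> span B"
    and n: "\<And>v. v \<in> span B \<Longrightarrow> (T ^^ n) v = 0"
  shows "trace B T = 0"
proof -
  interpret T: Vector_Spaces.linear "(*s)" "(*s)" T by fact
  have TB: "T ` span B \<subseteq> span B"
    using linear_in_span[OF T B(3)] by blast
  have eig: "\<exists>l\<in>{0}. (\<lambda>v. T v - l *s v) ` V \<noteq> V" if V: "V \<subseteq> span B" "V \<noteq> {0}" "subspace V" for V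
  proof (rule ccontr)
    assume "\<not> ?thesis"
    then have "T ` V = V" by simp
    then have "(T ^^ n) ` V = V"
    proof (induction n)
      case (Suc n)
      have "(T ^^ Suc n) ` V = T ` ((T ^^ n) ` V)" by auto
      then show ?case using Suc \<open>T ` V = V\<close> by metis
    qed simp
    moreover have "(T ^^ n) ` V \<subseteq> {0}" using n V by auto
    ultimately show False using V subspace_0 by blast
  qed
  obtain C \<alpha> r where C: "adapted_basis T C \<alpha> r" "span C = span B" "\<alpha> ` C \<subseteq> {0}"
    using adapted_basis_exists[OF T fin_dim_span[OF B(1)] TB, of "{0}"] eig by blast
  then have "trace C T = 0" by (subst trace_adapted_basis) (auto intro!: sum.neutral)
  moreover have "trace B T = trace C T"
    using B C T by (intro trace_basis_change) (auto simp: adapted_basis_def)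
  ultimately show ?thesis by simp
qed

end

section \<open>Eigenvalues and generalised eigenspaces\<close>

context linear_space
begin

lemma linear_funpow_0:
  assumes "Vector_Spaces.linear (*s) (*s) T"
  shows "(T ^^ n) 0 = 0"
proof -
  interpret P: Vector_Spaces.linear "(*s)" "(*s)" "T ^^ n" by (rule linear_funpow[OF assms])
  show ?thesis by (rule P.zero)
qed

definition poly_op :: "('b \<Rightarrow> 'b) \<Rightarrow> 'a poly \<Rightarrow> 'b \<Rightarrow> 'b"
  where "poly_op T p v = (\<Sum>i\<le>degree p. coeff p i *s (T ^^ i) v)"

lemma poly_op_altdef:
  assumes "degree p \<le> n"
  shows "poly_op T p v = (\<Sum>i\<le>n. coeff p i *s (T ^^ i) v)"
  unfolding poly_op_def using assms
  by (intro sum.mono_neutral_left) (auto simp: coeff_eq_0)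

lemma poly_op_add: "poly_op T (p + q) v = poly_op T p v + poly_op T q v"
  using poly_op_altdef[of "p + q" "max (degree p) (degree q)"]
    poly_op_altdef[of p "max (degree p) (degree q)"] poly_op_altdef[of q "max (degree p) (degree q)"]
  by (simp add: degree_add_le_max scale_left_distrib sum.distrib)

lemma poly_op_smult: "poly_op T (smult c p) v = c *s poly_op T p v"
  using poly_op_altdef[of "smult c p" "degree p"]
  by (simp add: degree_smult_le poly_op_def scale_sum_right)

lemma poly_op_pCons_0: "poly_op T (pCons 0 p) v = poly_op T p (T v)"
proof -
  have "poly_op T (pCons 0 p) v = (\<Sum>i\<le>Suc (degree p). coeff (pCons 0 p) i *s (T ^^ i) v)"
    by (rule poly_op_altdef) (simp add: degree_pCons_le)
  also have "\<dots> = (\<Sum>i\<le>degree p. coeff p i *s (T ^^ Suc i) v)"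
    by (subst sum.atMost_Suc_shift) simp
  finally show ?thesis by (simp add: poly_op_def funpow_swap1)
qed

lemma poly_op_monom: "poly_op T (monom 1 k) v = (T ^^ k) v"
proof -
  have "poly_op T (monom 1 k) v = (\<Sum>i\<le>k. if i = k then (T ^^ k) v else 0)"
    unfolding poly_op_altdef[OF degree_monom_le] by (rule sum.cong) auto
  then show ?thesis by simp
qed

lemma linear_poly_op:
  assumes "Vector_Spaces.linear (*s) (*s) T"
  shows "poly_op T p (u - c *s v) = poly_op T p u - c *s poly_op T p v"
proof -
  have "(T ^^ i) (u - c *s v) = (T ^^ i) u - c *s (T ^^ i) v" for i
  proof -
    interpret P: Vector_Spaces.linear "(*s)" "(*s)" "T ^^ i" by (rule linear_funpow[OF assms])
    show ?thesis by (simp add: P.diff P.scale)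
  qed
  then show ?thesis
    by (simp add: poly_op_def scale_right_diff_distrib scale_sum_right sum_subtractf mult.commute)
qed

lemma poly_op_linear_factor:
  assumes "Vector_Spaces.linear (*s) (*s) T"
  shows "poly_op T ([:- l, 1:] * q) v = poly_op T q (T v - l *s v)"
proof -
  have "[:- l, 1:] * q = pCons 0 q + smult (- l) q" by (simp add: add.commute)
  then show ?thesis
    by (simp only: poly_op_add poly_op_smult poly_op_pCons_0 linear_poly_op[OF assms])
      (simp add: scale_minus_left)
qed

text \<open>Either some iterate depends on the earlier ones, which yields a monic polynomial, or
  arbitrarily many iterates are independent inside \<open>W\<close>.\<close>

lemma annihilating_poly_exists:
  assumes T: "Vector_Spaces.linear (*s) (*s) T" "T ` W \<subseteq> W" and W: "fin_dim W" and v: "v \<in> W"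
  shows "\<exists>p. p \<noteq> 0 \<and> poly_op T p v = 0"
proof (cases "\<exists>k. (T ^^ k) v \<in> span ((\<lambda>i. (T ^^ i) v) ` {..<k})")
  case True
  then obtain k where k: "(T ^^ k) v \<in> span ((\<lambda>i. (T ^^ i) v) ` {..<k})" by blast
  \<comment> \<open>A subspace containing the earlier iterates, so membership in their span produces
    a polynomial without any handling of coefficients.\<close>
  let ?S = "{poly_op T q v | q. \<forall>i\<ge>k. coeff q i = 0}"
  have "subspace ?S"
  proof (rule subspaceI)
    show "0 \<in> ?S" by (auto intro!: exI[of _ 0] simp: poly_op_def)
    show "x + y \<in> ?S" if xy: "x \<in> ?S" "y \<in> ?S" for x y
    proof -
      obtain p q where "x = poly_op T p v" "y = poly_op T q v"
        "\<forall>i\<ge>k. coeff p i = 0" "\<forall>i\<ge>k. coeff q i = 0" using xy by blast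
      then show ?thesis by (auto intro!: exI[of _ "p + q"] simp: poly_op_add)
    qed
    show "c *s x \<in> ?S" if x: "x \<in> ?S" for c x
    proof -
      obtain p where "x = poly_op T p v" "\<forall>i\<ge>k. coeff p i = 0" using x by blast
      then show ?thesis by (auto intro!: exI[of _ "smult c p"] simp: poly_op_smult)
    qed
  qed
  moreover have "(\<lambda>i. (T ^^ i) v) ` {..<k} \<subseteq> ?S"
  proof clarify
    fix i assume "i < k"
    then show "\<exists>q. (T ^^ i) v = poly_op T q v \<and> (\<forall>i\<ge>k. coeff q i = 0)"
      by (intro exI[of _ "monom 1 i"]) (auto simp: poly_op_monom)
  qed
  ultimately have "(T ^^ k) v \<in> ?S" using k span_minimal by blast
  then obtain q where q: "(T ^^ k) v = poly_op T q v" "\<forall>i\<ge>k. coeff q i = 0" by blast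
  have "coeff (monom 1 k + smult (- 1) q) k \<noteq> 0" using q(2) by simp
  then have "monom 1 k + smult (- 1) q \<noteq> 0" by (metis coeff_0)
  moreover have "poly_op T (monom 1 k + smult (- 1) q) v = 0"
    unfolding poly_op_add poly_op_smult poly_op_monom q(1) by simp
  ultimately show ?thesis by blast
next
  case False
  obtain B where B: "finite B" "independent B" "span B = W" by (rule fin_dim_basis[OF W])
  have "independent ((\<lambda>i. (T ^^ i) v) ` {..<k}) \<and> card ((\<lambda>i. (T ^^ i) v) ` {..<k}) = k" for k
  proof (induction k)
    case (Suc k)
    have "(T ^^ k) v \<notin> span ((\<lambda>i. (T ^^ i) v) ` {..<k})" using False by simp
    moreover from this have "(T ^^ k) v \<notin> (\<lambda>i. (T ^^ i) v) ` {..<k}"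
      by (rule contrapos_nn) (rule span_base)
    ultimately show ?case using Suc by (simp add: lessThan_Suc independent_insertI)
  qed (simp add: independent_empty)
  moreover have "(T ^^ k) v \<in> W" for k using T(2) v by (induction k) auto
  ultimately have "k \<le> card B" for k
    using independent_span_bound[of B "(\<lambda>i. (T ^^ i) v) ` {..<k}"] B by auto
  then show ?thesis using not_less_eq_eq by blast
qed

end

locale closed_linear_space = linear_space scale
  for scale :: "'a::alg_closed_field \<Rightarrow> 'b::ab_group_add \<Rightarrow> 'b" (infixr \<open>*s\<close> 75)
begin

text \<open>If every shift \<open>T - l\<close> mapped \<open>V\<close> onto itself, it would be
  injective there, and the linear factors of an annihilating polynomial of a nonzero vector could be
  stripped off one by one, making that vector zero.\<close>

lemma eigenvalue_exists:
  assumes T: "Vector_Spaces.linear (*s) (*s) T" and V: "fin_dim V" "T ` V \<subseteq> V" "V \<noteq> {0}"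
  shows "\<exists>l. (\<lambda>v. T v - l *s v) ` V \<noteq> V"
proof (rule ccontr)
  assume "\<not> ?thesis"
  then have surj: "(\<lambda>v. T v - l *s v) ` V = V" for l by blast
  have "u = 0" if "p \<noteq> 0" "u \<in> V" "poly_op T p u = 0" for p u
    using that
  proof (induction "degree p" arbitrary: p u)
    case 0
    then obtain c where c: "p = [:c:]" by (metis degree_eq_zeroE)
    then show ?case using "0.prems" by (simp add: poly_op_def)
  next
    case (Suc n)
    obtain l where "poly p l = 0"
      using alg_closed_imp_poly_has_root[of p] Suc.hyps(2) by auto
    then obtain q where q: "p = [:- l, 1:] * q" by (auto simp: poly_eq_0_iff_dvd elim: dvdE)
    have "q \<noteq> 0" using q Suc.prems(1) by auto
    then have "degree q = n" using Suc.hyps(2) degree_mult_eq[of "[:- l, 1:]" q] q by simp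
    moreover have "poly_op T q (T u - l *s u) = 0"
      using Suc.prems(3) poly_op_linear_factor[OF T] q by simp
    moreover have "T u - l *s u \<in> V" using surj[of l] Suc.prems(2) by blast
    ultimately have "T u - l *s u = 0" using Suc.hyps(1) \<open>q \<noteq> 0\<close> by blast
    then show ?case
      using linear_surj_on_imp_inj_on[OF V(1) linear_shift[OF T] surj Suc.prems(2)] by blast
  qed
  moreover obtain v where "v \<in> V" "v \<noteq> 0"
    using V(3) subspace_0[OF fin_dim_subspace[OF V(1)]] by blast
  ultimately show False using annihilating_poly_exists[OF T V(2,1)] by blast
qed

lemma adapted_basis_exists_closed:
  assumes T: "Vector_Spaces.linear (*s) (*s) T" and W: "fin_dim W" "T ` W \<subseteq> W"
  shows "\<exists>B \<alpha> r. adapted_basis T B \<alpha> r \<and> span B = W"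
proof -
  have "\<exists>l\<in>UNIV. (\<lambda>v. T v - l *s v) ` V \<noteq> V"
    if "subspace V" "V \<subseteq> W" "T ` V \<subseteq> V" "V \<noteq> {0}" for V
    using eigenvalue_exists[OF T fin_dim_mono[OF W(1) that(1,2)] that(3,4)] by blast
  then show ?thesis using adapted_basis_exists[OF T W, of UNIV] by blast
qed

end

section \<open>Stable images and components in generalised eigenspaces\<close>

lemma funpow_commute:
  assumes "\<And>v. f (g v) = g (f v)"
  shows "(f ^^ m) ((g ^^ n) v) = (g ^^ n) ((f ^^ m) v)"
proof -
  have *: "f ((g ^^ n) v) = (g ^^ n) (f v)" for n v
    by (induction n) (simp_all add: assms)
  show ?thesis by (induction m) (simp_all add: *)
qed

context linear_space
begin

text \<open>A strict inclusion drops the dimension, so two consecutive images agree, and from there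
  the chain is constant. This is the part of Fitting's lemma needed for the Casimir
  operator.\<close>

lemma funpow_image_stable:
  assumes T: "Vector_Spaces.linear (*s) (*s) T" and W: "fin_dim W" "T ` W \<subseteq> W"
  shows "\<exists>n. \<forall>m\<ge>n. (T ^^ m) ` W = (T ^^ n) ` W"
proof -
  have sub: "subspace ((T ^^ n) ` W)" for n
  proof -
    interpret N: Vector_Spaces.linear "(*s)" "(*s)" "T ^^ n" by (rule linear_funpow[OF T])
    show ?thesis by (rule N.subspace_image[OF fin_dim_subspace[OF W(1)]])
  qed
  have step: "(T ^^ Suc n) ` W \<subseteq> (T ^^ n) ` W" for n
    using W(2) by (auto simp: funpow_Suc_right simp del: funpow.simps)
  have inW: "(T ^^ n) ` W \<subseteq> W" for n
  proof (induction n)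
    case (Suc n)
    then show ?case using step[of n] by (rule order_trans[rotated])
  qed simp
  have "\<exists>n. (T ^^ Suc n) ` W = (T ^^ n) ` W"
  proof (rule ccontr)
    assume "\<not> ?thesis"
    then have neq: "(T ^^ Suc n) ` W \<subset> (T ^^ n) ` W" for n using step[of n] by blast
    have less: "dim ((T ^^ Suc n) ` W) < dim ((T ^^ n) ` W)" for n
      by (rule dim_psubset_less[OF fin_dim_mono[OF W(1) sub inW] sub neq])
    have "dim ((T ^^ n) ` W) + n \<le> dim W" for n
    proof (induction n)
      case (Suc n)
      then show ?case using less[of n] by linarith
    qed simp
    from this[of "Suc (dim W)"] show False by simp
  qed
  then obtain n where n: "(T ^^ Suc n) ` W = (T ^^ n) ` W" by blast
  have "(T ^^ (n + j)) ` W = (T ^^ n) ` W" for j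
  proof (induction j)
    case (Suc j)
    have "(T ^^ (n + Suc j)) ` W = T ` ((T ^^ (n + j)) ` W)" by (auto simp: image_image)
    also have "\<dots> = (T ^^ Suc n) ` W" unfolding Suc by (auto simp: image_image)
    finally show ?case using n by simp
  qed simp
  then show ?thesis by (metis le_add_diff_inverse)
qed

text \<open>A substitute for polynomial projections onto generalised eigenspaces. For
  \<open>c \<noteq> d\<close> the shift by \<open>d\<close> is injective modulo \<open>U\<close> on
  generalised eigenvectors for \<open>c\<close>, so applying its power removes the summand of
  \<open>d\<close> and loses nothing about the others.\<close>

lemma component_in_invariant_subspace:
  assumes T: "Vector_Spaces.linear (*s) (*s) T" and U: "subspace U" "\<And>u. u \<in> U \<Longrightarrow> T u \<in> U"
    and S: "finite S" "(\<Sum>c\<in>S. z c) \<in> U"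
    and z: "\<And>c. c \<in> S \<Longrightarrow> ((\<lambda>v. T v - c *s v) ^^ n) (z c) = 0"
  shows "\<forall>c\<in>S. z c \<in> U"
proof -
  define N where "N c = (\<lambda>v. T v - c *s v)" for c
  have linN: "Vector_Spaces.linear (*s) (*s) (N c)" for c
    unfolding N_def by (rule linear_shift[OF T])
  interpret T: Vector_Spaces.linear "(*s)" "(*s)" T by fact
  have NN: "N c (N d v) = N d (N c v)" for c d v
    by (simp add: N_def T.diff T.scale algebra_simps)
  have NU: "N c u \<in> U" if "u \<in> U" for c u
    using that U by (simp add: N_def subspace_diff subspace_scale)
  have N0: "(N c ^^ m) 0 = 0" for c m
    by (rule linear_funpow_0[OF linN])
  have NmU: "(N c ^^ m) u \<in> U" if "u \<in> U" for c u m
    using that by (induction m) (simp_all add: NU)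
  \<comment> \<open>\<open>(c - d) v\<close> is \<open>N d v - N c v\<close>, so membership of
    \<open>N c v\<close> in \<open>U\<close> suffices, and \<open>N c v\<close> is killed by a
    smaller power of \<open>N c\<close>.\<close>
  have step: "v \<in> U" if "(N c ^^ m) v = 0" "N d v \<in> U" "c \<noteq> d" for c d m v
    using that
  proof (induction m arbitrary: v)
    case 0
    then show ?case using subspace_0[OF U(1)] by simp
  next
    case (Suc m)
    have "(N c ^^ m) (N c v) = 0"
      using Suc.prems(1) by (simp only: funpow_Suc_right comp_apply)
    moreover have "N d (N c v) \<in> U"
      using NU[OF Suc.prems(2)] by (simp only: NN[of d c])
    ultimately have "N c v \<in> U" using Suc.prems(3) by (rule Suc.IH)
    then have "inverse (c - d) *s (N d v - N c v) \<in> U"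
      using Suc.prems U(1) by (simp add: subspace_diff subspace_scale)
    also have "N d v - N c v = (c - d) *s v" by (simp add: N_def algebra_simps)
    finally show ?case using Suc.prems(3) by simp
  qed
  have power: "v \<in> U" if "(N c ^^ m) v = 0" "(N d ^^ k) v \<in> U" "c \<noteq> d" for c d m k v
    using that(1,2)
  proof (induction k arbitrary: v)
    case (Suc k)
    have "(N c ^^ m) (N d v) = 0"
      using Suc.prems(1) funpow_commute[where f = "N c" and g = "N d" and m = m and n = 1 and v = v]
        NN N0[where c = d and m = 1] by simp
    moreover have "(N d ^^ k) (N d v) \<in> U"
      using Suc.prems(2) by (simp only: funpow_Suc_right comp_apply)
    ultimately have "N d v \<in> U" by (rule Suc.IH)
    then show ?case using step Suc.prems(1) that(3) by blast
  qed simp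
  show ?thesis
    using S z unfolding N_def[symmetric]
  proof (induction S arbitrary: z rule: finite_induct)
    case (insert d S)
    interpret P: Vector_Spaces.linear "(*s)" "(*s)" "N d ^^ n" by (rule linear_funpow[OF linN])
    have "(N d ^^ n) (\<Sum>c\<in>insert d S. z c) \<in> U" using insert.prems(1) by (rule NmU)
    moreover have "(N d ^^ n) (\<Sum>c\<in>insert d S. z c) = (\<Sum>c\<in>S. (N d ^^ n) (z c))"
      using insert.hyps insert.prems(2)[of d] by (simp add: P.add P.sum)
    moreover have "(N c ^^ n) ((N d ^^ n) (z c)) = 0" if "c \<in> S" for c
      using insert.prems(2)[of c] that funpow_commute[where f = "N c" and g = "N d" and m = n and n = n and v = "z c"] NN N0 by simp
    ultimately have "\<forall>c\<in>S. (N d ^^ n) (z c) \<in> U"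
      using insert.IH[of "\<lambda>c. (N d ^^ n) (z c)"] by simp
    then have *: "z c \<in> U" if "c \<in> S" for c
      using power[where c = c and m = n and v = "z c" and d = d and k = n] that insert.prems(2)[of c] insert.hyps(2) by auto
    have "(\<Sum>c\<in>insert d S. z c) - (\<Sum>c\<in>S. z c) \<in> U"
      using insert.prems(1) subspace_sum[OF U(1) *] by (rule subspace_diff[OF U(1)])
    then have "z d \<in> U" using insert.hyps by simp
    then show ?case using * by blast
  qed simp
qed

end

section \<open>The trace identity behind Cartan's criterion, first for matrices\<close>

lemma linear_space_matrices:
  "linear_space (\<lambda>(k::'a::field) Z (i::'i) (j::'j). k * Z i j)"
  by unfold_locales (auto simp: fun_eq_iff algebra_simps)

text \<open>
  The commutator with a matrix \<open>M = D + N\<close>, where \<open>D = diag \<alpha>\<close> commutes with the strictly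
  triangular \<open>N\<close>, has the matrices supported on \<open>\<alpha> i - \<alpha> j = c\<close> as its generalised eigenspace
  for \<open>c\<close>.  Hence a functional vanishing on all iterated commutators of \<open>Z\<close> vanishes on the
  components of \<open>Z\<close> in these eigenspaces.
\<close>

lemma weighted_pairing_eq_0:
  fixes \<alpha> :: "'i \<Rightarrow> 'a::field" and r :: "'i \<Rightarrow> nat" and A M Z :: "'i \<Rightarrow> 'i \<Rightarrow> 'a"
  assumes fin: "finite I"
    and diag: "\<And>i. i \<in> I \<Longrightarrow> M i i = \<alpha> i"
    and triang: "\<And>i j. i \<in> I \<Longrightarrow> j \<in> I \<Longrightarrow> i \<noteq> j \<Longrightarrow> M i j \<noteq> 0 \<Longrightarrow> r i < r j \<and> \<alpha> i = \<alpha> j"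
    and ad: "ad = (\<lambda>Z i j. if i \<in> I \<and> j \<in> I
      then (\<Sum>k\<in>I. M i k * Z k j) - (\<Sum>k\<in>I. Z i k * M k j) else 0)"
    and supp: "\<And>i j. Z i j \<noteq> 0 \<Longrightarrow> i \<in> I \<and> j \<in> I"
    and pairing: "\<And>k. (\<Sum>i\<in>I. \<Sum>j\<in>I. A j i * (ad ^^ k) Z i j) = 0"
  shows "(\<Sum>i\<in>I. \<Sum>j\<in>I. A j i * (g (\<alpha> i - \<alpha> j) * Z i j)) = 0"
proof -
  define sc where "sc = (\<lambda>(k::'a) Z (i::'i) (j::'i). k * Z i j)"
  interpret Mat: linear_space sc unfolding sc_def by (rule linear_space_matrices)
  define \<psi> where "\<psi> Z = (\<Sum>i\<in>I. \<Sum>j\<in>I. A j i * Z i j)" for Z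
  have \<psi>_add: "\<psi> (V + Y) = \<psi> V + \<psi> Y" and \<psi>_sc: "\<psi> (sc k V) = k * \<psi> V" for V Y k
    by (simp_all add: \<psi>_def sc_def sum.distrib sum_distrib_left algebra_simps)
  have lin_ad: "Vector_Spaces.linear sc sc ad"
    unfolding Vector_Spaces.linear_iff using Mat.vector_space_axioms
    by (auto simp: ad sc_def fun_eq_iff sum.distrib sum_distrib_left algebra_simps)
  \<comment> \<open>The matrices whose whole orbit under \<open>ad\<close> is annihilated by
    \<open>\<psi>\<close>: an invariant subspace containing \<open>Z\<close>.\<close>
  define U where "U = {V. \<forall>k. \<psi> ((ad ^^ k) V) = 0}"
  have sU: "Mat.subspace U"
  proof (rule Mat.subspaceI)
    fix V Y k assume "V \<in> U" "Y \<in> U"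
    have P: "Vector_Spaces.linear sc sc (ad ^^ n)" for n by (rule Mat.linear_funpow[OF lin_ad])
    show "V + Y \<in> U" "sc k V \<in> U"
      using \<open>V \<in> U\<close> \<open>Y \<in> U\<close> P by (simp_all add: U_def \<psi>_add \<psi>_sc Vector_Spaces.linear_iff)
  next
    have "(ad ^^ k) 0 = 0" for k by (rule Mat.linear_funpow_0[OF lin_ad])
    then show "0 \<in> U" by (simp add: U_def \<psi>_def)
  qed
  have adU: "ad V \<in> U" if "V \<in> U" for V
  proof -
    have "\<psi> ((ad ^^ Suc k) V) = 0" for k using that unfolding U_def by blast
    then show ?thesis by (simp add: U_def funpow_Suc_right del: funpow.simps)
  qed
  define S where "S = (\<lambda>(i, j). \<alpha> i - \<alpha> j) ` (I \<times> I)"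
  define z where "z c = (\<lambda>i j. if \<alpha> i - \<alpha> j = c then Z i j else 0)" for c
  have finS: "finite S" using fin by (simp add: S_def)
  have sum_z: "(\<Sum>c\<in>S. h c * z c i j) = h (\<alpha> i - \<alpha> j) * Z i j" for i j h
  proof (cases "i \<in> I \<and> j \<in> I")
    case True
    then have "\<alpha> i - \<alpha> j \<in> S" by (auto simp: S_def)
    then show ?thesis using finS by (simp add: z_def if_distrib cong: if_cong)
  next
    case False
    then have "Z i j = 0" using supp by blast
    moreover from this have "z c i j = 0" for c by (simp add: z_def)
    ultimately show ?thesis by simp
  qed
  have sum_fun: "(\<Sum>c\<in>S. z c) i j = (\<Sum>c\<in>S. z c i j)" for i j
    using finS by (induction S) simp_all
  have "(\<Sum>c\<in>S. z c) = Z"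
    using sum_z[of "\<lambda>_. 1"] by (simp add: fun_eq_iff sum_fun)
  moreover have "Z \<in> U" using pairing by (simp add: U_def \<psi>_def)
  ultimately have ZU: "(\<Sum>c\<in>S. z c) \<in> U" by simp
  define R where "R = (\<Sum>i\<in>I. r i)"
  have R: "r i \<le> R" if "i \<in> I" for i unfolding R_def using fin that by (intro member_le_sum) auto
  \<comment> \<open>On the support of \<open>z c\<close> the diagonal part of \<open>ad\<close> is
    multiplication by \<open>c\<close> and cancels. What is left moves an entry to a lower row
    height \<open>r i\<close> or a higher column height \<open>r j\<close>, which is what the
    inequality records.\<close>
  have nilp: "i \<in> I \<and> j \<in> I \<and> \<alpha> i - \<alpha> j = c \<and> r i + n \<le> r j + R"
    if "((\<lambda>V. ad V - sc c V) ^^ n) (z c) i j \<noteq> 0" for c n i j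
    using that
  proof (induction n arbitrary: i j)
    case 0
    then have "Z i j \<noteq> 0" "\<alpha> i - \<alpha> j = c" by (auto simp: z_def split: if_splits)
    moreover from this have "i \<in> I" "j \<in> I" using supp by auto
    ultimately show ?case using R[of i] by simp
  next
    case (Suc n)
    define Y where "Y = ((\<lambda>V. ad V - sc c V) ^^ n) (z c)"
    have Y: "i \<in> I \<and> j \<in> I \<and> \<alpha> i - \<alpha> j = c \<and> r i + n \<le> r j + R" if "Y i j \<noteq> 0" for i j
      using Suc.IH that unfolding Y_def by blast
    have "ad Y i j - sc c Y i j \<noteq> 0" 
      using Suc.prems unfolding funpow.simps comp_apply Y_def[symmetric] by (simp only: minus_apply not_False_eq_True)
    then have *: "ad Y i j - c * Y i j \<noteq> 0" by (simp add: sc_def)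
    have ij: "i \<in> I" "j \<in> I" using * Y[of i j] by (auto simp: ad split: if_splits)
    have "(\<Sum>k\<in>I. M i k * Y k j) = \<alpha> i * Y i j + (\<Sum>k\<in>I - {i}. M i k * Y k j)"
      using sum.remove[OF fin ij(1), of "\<lambda>k. M i k * Y k j"] diag[OF ij(1)] by simp
    moreover have "(\<Sum>k\<in>I. Y i k * M k j) = Y i j * \<alpha> j + (\<Sum>k\<in>I - {j}. Y i k * M k j)"
      using sum.remove[OF fin ij(2), of "\<lambda>k. Y i k * M k j"] diag[OF ij(2)] by simp
    moreover have "(\<alpha> i - \<alpha> j - c) * Y i j = 0" using Y[of i j] by auto
    ultimately have "ad Y i j - c * Y i j =
        (\<Sum>k\<in>I - {i}. M i k * Y k j) - (\<Sum>k\<in>I - {j}. Y i k * M k j)"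
      using ij by (simp add: ad algebra_simps)
    then have "(\<Sum>k\<in>I - {i}. M i k * Y k j) \<noteq> 0 \<or> (\<Sum>k\<in>I - {j}. Y i k * M k j) \<noteq> 0"
      using * by auto
    then show ?case
    proof
      assume "(\<Sum>k\<in>I - {i}. M i k * Y k j) \<noteq> 0"
      then obtain k where "k \<in> I - {i}" "M i k * Y k j \<noteq> 0" by (rule sum.not_neutral_contains_not_neutral)
      then show ?thesis using triang[of i k] Y[of k j] ij by auto
    next
      assume "(\<Sum>k\<in>I - {j}. Y i k * M k j) \<noteq> 0"
      then obtain k where "k \<in> I - {j}" "Y i k * M k j \<noteq> 0" by (rule sum.not_neutral_contains_not_neutral)
      then show ?thesis using triang[of k j] Y[of i k] ij by auto
    qed
  qed
  \<comment> \<open>Since all heights are at most \<open>R\<close>, the inequality fails for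
    \<open>n = 2 * R + 1\<close>.\<close>
  have "((\<lambda>V. ad V - sc c V) ^^ (2 * R + 1)) (z c) = 0" for c
  proof (rule ccontr)
    assume "\<not> ?thesis"
    then obtain i j where "((\<lambda>V. ad V - sc c V) ^^ (2 * R + 1)) (z c) i j \<noteq> 0"
      by (auto simp: fun_eq_iff)
    from nilp[OF this] R[of j] show False by simp
  qed
  then have "\<forall>c\<in>S. z c \<in> U"
    using Mat.component_in_invariant_subspace[OF lin_ad sU adU finS ZU] by blast
  then have "\<psi> (z c) = 0" if "c \<in> S" for c
    using that unfolding U_def by (metis (mono_tags, lifting) funpow_0 mem_Collect_eq)
  \<comment> \<open>\<open>\<psi>\<close> kills each component separately, so every component may be
    given its own weight.\<close>
  then have "0 = (\<Sum>c\<in>S. g c * \<psi> (z c))" by simp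
  also have "\<dots> = (\<Sum>i\<in>I. \<Sum>j\<in>I. A j i * (\<Sum>c\<in>S. g c * z c i j))"
    unfolding \<psi>_def sum_distrib_left
    by (subst sum.swap, rule sum.cong[OF refl], subst sum.swap) (simp add: algebra_simps)
  finally show ?thesis by (simp add: sum_z)
qed

context linear_space
begin

text \<open>\<open>Y\<close> is the additive map \<open>f\<close> applied to the diagonal part of
  \<open>T\<close>, so the commutator with \<open>Y\<close> multiplies the entry of \<open>b\<close>
  at \<open>i\<close>, \<open>j\<close> by \<open>f (\<alpha> i - \<alpha> j)\<close>. Cartan's
  criterion uses this in place of the classical fact that the adjoint of \<open>Y\<close> is a
  polynomial in the adjoint of \<open>T\<close>.\<close>

lemma twisted_trace_eq_0:
  assumes ad: "adapted_basis T C \<alpha> r"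
    and T: "Vector_Spaces.linear (*s) (*s) T"
    and a: "Vector_Spaces.linear (*s) (*s) a" "\<And>c. c \<in> C \<Longrightarrow> a c \<in> span C"
    and b: "\<And>k. Vector_Spaces.linear (*s) (*s) ((D ^^ k) b)" "\<And>k c. c \<in> C \<Longrightarrow> (D ^^ k) b c \<in> span C"
    and D: "D = (\<lambda>V v. T (V v) - V (T v))"
    and tr: "\<And>k. trace C (\<lambda>v. (D ^^ k) b (a v)) = 0"
    and Y: "Vector_Spaces.linear (*s) (*s) Y" "\<And>c. c \<in> C \<Longrightarrow> Y c = f (\<alpha> c) *s c"
    and f: "\<And>x y. f (x - y) = f x - f y"
  shows "trace C (\<lambda>v. Y (b (a v)) - b (Y (a v))) = 0"
proof -
  have C: "finite C" "independent C" using ad by (auto simp: adapted_basis_def)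
  have TC: "T c \<in> span C" if "c \<in> C" for c using adapted_basis_invariant[OF ad that] .
  have YC: "Y c \<in> span C" if "c \<in> C" for c using Y(2)[OF that] that by (simp add: span_scale span_base)
  have b0: "Vector_Spaces.linear (*s) (*s) b" "\<And>c. c \<in> C \<Longrightarrow> b c \<in> span C"
    using b(1)[of 0] b(2)[of _ 0] by simp_all
  define mat where "mat Z i j = (if i \<in> C \<and> j \<in> C then representation C (Z j) i else 0)" for Z i j
  \<comment> \<open>The index type may be larger than \<open>C\<close>; the cutoff keeps matrices
    supported on \<open>C\<close>.\<close>
  define adM where "adM = (\<lambda>Z i j. if i \<in> C \<and> j \<in> C
      then (\<Sum>k\<in>C. mat T i k * Z k j) - (\<Sum>k\<in>C. Z i k * mat T k j) else 0)"
  have mat_D: "adM (mat Z) = mat (D Z)"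
    if "Vector_Spaces.linear (*s) (*s) Z" "\<And>c. c \<in> C \<Longrightarrow> Z c \<in> span C" for Z
  proof (intro ext)
    fix i j
    show "adM (mat Z) i j = mat (D Z) i j"
    proof (cases "i \<in> C \<and> j \<in> C")
      case True
      have "representation C (T (Z j)) i = (\<Sum>k\<in>C. mat T i k * mat Z k j)"
        using True that TC
        by (subst representation_linear[OF C C(2) T TC]) (auto simp: mat_def mult.commute)
      moreover have "representation C (Z (T j)) i = (\<Sum>k\<in>C. mat Z i k * mat T k j)"
        using True that TC
        by (subst representation_linear[OF C C(2) that]) (auto simp: mat_def mult.commute)
      moreover have "T (Z j) \<in> span C" "Z (T j) \<in> span C"
        using linear_in_span[OF T TC that(2)] linear_in_span[OF that TC] True by auto
      ultimately show ?thesis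
        using True C(2) by (simp add: adM_def mat_def D representation_diff)
    qed (auto simp: adM_def mat_def)
  qed
  have mat_pow: "(adM ^^ k) (mat b) = mat ((D ^^ k) b)" for k
    by (induction k) (simp_all add: mat_D b)
  have pair: "(\<Sum>i\<in>C. \<Sum>j\<in>C. mat a j i * h i j * mat Z i j)
      = (\<Sum>i\<in>C. \<Sum>j\<in>C. representation C (a i) j * (h i j * representation C (Z j) i))" for h Z
    by (intro sum.cong refl) (simp add: mat_def)
  have tr': "trace C (\<lambda>v. Z (a v)) = (\<Sum>i\<in>C. \<Sum>j\<in>C. representation C (a i) j * representation C (Z j) i)"
    if "Vector_Spaces.linear (*s) (*s) Z" "\<And>c. c \<in> C \<Longrightarrow> Z c \<in> span C" for Z
    unfolding trace_def by (intro sum.cong refl representation_linear C that a)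
  have repY: "representation C (Y w) i = f (\<alpha> i) * representation C w i" if "i \<in> C" "w \<in> span C" for i w
  proof -
    have "representation C (Y w) i = (\<Sum>c\<in>C. representation C w c * representation C (Y c) i)"
      by (rule representation_linear[OF C C(2) Y(1) YC that(2)])
    also have "\<dots> = (\<Sum>c\<in>C. if c = i then f (\<alpha> i) * representation C w i else 0)"
      using C by (intro sum.cong refl)
        (auto simp: Y(2) representation_scale representation_basis span_base)
    finally show ?thesis using C that by simp
  qed
  have "(\<Sum>i\<in>C. \<Sum>j\<in>C. mat a j i * (f (\<alpha> i - \<alpha> j) * mat b i j)) = 0"
  proof (rule weighted_pairing_eq_0[where M = "mat T" and r = r and ad = adM])
    show "mat T i i = \<alpha> i" if "i \<in> C" for i
      using that adapted_basis_representation(1)[OF ad that that] by (simp add: mat_def)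
    show "r i < r j \<and> \<alpha> i = \<alpha> j" if "i \<in> C" "j \<in> C" "i \<noteq> j" "mat T i j \<noteq> 0" for i j
      using that adapted_basis_representation(2)[OF ad that(2,1)] by (simp add: mat_def)
    show "(\<Sum>i\<in>C. \<Sum>j\<in>C. mat a j i * (adM ^^ k) (mat b) i j) = 0" for k
      using tr[of k] tr'[OF b, of k] pair[of "\<lambda>_ _. 1" "(D ^^ k) b"] by (simp add: mat_pow)
  qed (auto simp: C adM_def mat_def split: if_splits)
  moreover have "trace C (\<lambda>v. Y (b (a v)) - b (Y (a v)))
      = (\<Sum>i\<in>C. \<Sum>j\<in>C. representation C (a i) j * representation C (Y (b j) - b (Y j)) i)"
  proof (rule tr'[of "\<lambda>v. Y (b v) - b (Y v)"])
    show "Vector_Spaces.linear (*s) (*s) (\<lambda>v. Y (b v) - b (Y v))"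
      using Y(1) b0(1) by (auto simp: Vector_Spaces.linear_iff scale_right_diff_distrib)
    show "Y (b c) - b (Y c) \<in> span C" if "c \<in> C" for c
      using linear_in_span[OF Y(1) YC b0(2)] linear_in_span[OF b0 YC] that by (intro span_diff) auto
  qed
  moreover have "representation C (Y (b j) - b (Y j)) i = f (\<alpha> i - \<alpha> j) * mat b i j"
    if "i \<in> C" "j \<in> C" for i j
  proof -
    have "b (Y j) = f (\<alpha> j) *s b j"
      using Y(2)[OF that(2)] b0(1) by (simp add: Vector_Spaces.linear_iff)
    then show ?thesis
      using that C b0(2) linear_in_span[OF Y(1) YC b0(2)]
      by (simp add: representation_diff representation_scale span_scale repY f mat_def left_diff_distrib)
  qed
  ultimately show ?thesis
    by (simp add: mat_def)
qed

end

section \<open>Scalar extension and rational functionals\<close>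

lemma sum_fun_apply: "(\<Sum>a\<in>A. h a) x = (\<Sum>a\<in>A. h a x)"
  by (induction A rule: infinite_finite_induct) simp_all

lemma linear_space_functions:
  "linear_space (\<lambda>(k::'a::field) v (i::'i). k * v i)"
  by unfold_locales (auto simp: fun_eq_iff algebra_simps)

text \<open>
  Extension of scalars: \<open>w \<otimes> 1\<close> and \<open>T \<otimes> 1\<close> over the algebraic closure, in coordinates with
  respect to a basis \<open>B\<close>.
\<close>

context linear_space
begin

definition ext_vec :: "'b set \<Rightarrow> 'b \<Rightarrow> 'b \<Rightarrow> 'a alg_closure"
  where "ext_vec B w = (\<lambda>b. to_ac (representation B w b))"

definition ext_op :: "'b set \<Rightarrow> ('b \<Rightarrow> 'b) \<Rightarrow> ('b \<Rightarrow> 'a alg_closure) \<Rightarrow> ('b \<Rightarrow> 'a alg_closure)"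
  where "ext_op B T v = (\<lambda>b. \<Sum>c\<in>B. to_ac (representation B (T c) b) * v c)"

abbreviation ext_scale :: "'a alg_closure \<Rightarrow> ('b \<Rightarrow> 'a alg_closure) \<Rightarrow> ('b \<Rightarrow> 'a alg_closure)"
  where "ext_scale \<equiv> (\<lambda>k v i. k * v i)"

lemma ext_op_linear: "Vector_Spaces.linear ext_scale ext_scale (ext_op B T)"
proof -
  interpret K: linear_space ext_scale by (rule linear_space_functions)
  show ?thesis
    unfolding Vector_Spaces.linear_iff using K.vector_space_axioms
    by (auto simp: ext_op_def fun_eq_iff algebra_simps sum.distrib sum_distrib_left)
qed

lemma ext_op_outside: "b \<notin> B \<Longrightarrow> ext_op B T v b = 0"
  unfolding ext_op_def using representation_ne_zero[of B _ b] by (intro sum.neutral) auto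

lemma ext_op_comp:
  assumes B: "finite B" "independent B"
    and S: "Vector_Spaces.linear (*s) (*s) S" "\<And>c. c \<in> B \<Longrightarrow> S c \<in> span B"
    and T: "\<And>c. c \<in> B \<Longrightarrow> T c \<in> span B"
  shows "ext_op B S (ext_op B T v) = ext_op B (\<lambda>u. S (T u)) v"
proof
  fix b
  have "ext_op B (\<lambda>u. S (T u)) v b =
      (\<Sum>c\<in>B. (\<Sum>d\<in>B. to_ac (representation B (T c) d) * to_ac (representation B (S d) b)) * v c)"
    unfolding ext_op_def using T
    by (intro sum.cong refl) (simp add: representation_linear[OF B B(2) S] to_ac_sum)
  also have "\<dots> = (\<Sum>d\<in>B. \<Sum>c\<in>B. to_ac (representation B (S d) b) * (to_ac (representation B (T c) d) * v c))"
    unfolding sum_distrib_right by (subst sum.swap) (simp add: algebra_simps)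
  finally show "ext_op B S (ext_op B T v) b = ext_op B (\<lambda>u. S (T u)) v b"
    by (simp add: ext_op_def sum_distrib_left)
qed

lemma ext_op_diff:
  assumes "independent B" "\<And>c. c \<in> B \<Longrightarrow> S c \<in> span B" "\<And>c. c \<in> B \<Longrightarrow> T c \<in> span B"
  shows "ext_op B (\<lambda>u. S u - T u) v = ext_op B S v - ext_op B T v"
  using assms by (simp add: ext_op_def fun_eq_iff representation_diff algebra_simps sum_subtractf)

lemma ext_op_add:
  assumes "independent B" "\<And>c. c \<in> B \<Longrightarrow> S c \<in> span B" "\<And>c. c \<in> B \<Longrightarrow> T c \<in> span B"
  shows "ext_op B (\<lambda>u. S u + T u) v = ext_op B S v + ext_op B T v"
  using assms by (simp add: ext_op_def fun_eq_iff representation_add algebra_simps sum.distrib)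

lemma ext_op_scale:
  assumes "independent B" "\<And>c. c \<in> B \<Longrightarrow> T c \<in> span B"
  shows "ext_op B (\<lambda>u. k *s T u) v = ext_scale (to_ac k) (ext_op B T v)"
  using assms by (simp add: ext_op_def fun_eq_iff representation_scale sum_distrib_left algebra_simps)

lemma ext_op_ext_vec:
  assumes "finite B" "independent B" "Vector_Spaces.linear (*s) (*s) T" "\<And>c. c \<in> B \<Longrightarrow> T c \<in> span B"
    and "w \<in> span B"
  shows "ext_op B T (ext_vec B w) = ext_vec B (T w)"
  using assms
  by (simp add: ext_op_def ext_vec_def fun_eq_iff representation_linear to_ac_sum mult.commute)

lemma ext_vec_eq_0:
  assumes "finite B" "independent B" "w \<in> span B" "ext_vec B w = 0"
  shows "w = 0"
proof -
  have "representation B w b = 0" for b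
    using assms(4) by (simp add: ext_vec_def fun_eq_iff)
  then show ?thesis using sum_representation_eq[OF assms(2,3,1)] by simp
qed

text \<open>The extended basis vectors are the unit vectors of the function space, so the
  coordinates of \<open>v\<close> are simply its values.\<close>

lemma ext_basis:
  assumes B: "finite B" "independent B"
  defines "E \<equiv> ext_vec B ` B"
  shows "finite E" "module.independent ext_scale E"
    "module.span ext_scale E = {v. \<forall>b. b \<notin> B \<longrightarrow> v b = 0}"
    "\<And>v. (\<And>b. b \<notin> B \<Longrightarrow> v b = 0) \<Longrightarrow> b \<in> B \<Longrightarrow> module.representation ext_scale E v (ext_vec B b) = v b"
    "inj_on (ext_vec B) B"
proof -
  interpret K: linear_space ext_scale by (rule linear_space_functions)
  have unit: "ext_vec B b = (\<lambda>c. if c = b then 1 else 0)" if "b \<in> B" for b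
    using that B by (auto simp: ext_vec_def representation_basis fun_eq_iff)
  show inj: "inj_on (ext_vec B) B"
  proof (rule inj_onI)
    fix b c assume "b \<in> B" "c \<in> B" "ext_vec B b = ext_vec B c"
    then have "ext_vec B c b = 1" using unit[of b] by (metis (full_types))
    then show "b = c" using unit[OF \<open>c \<in> B\<close>] by (auto split: if_splits)
  qed
  show finE: "finite E" using B by (simp add: E_def)
  have sum_E: "(\<Sum>e\<in>E. ext_scale (h e) e) = (\<lambda>b. if b \<in> B then h (ext_vec B b) else 0)" for h
  proof
    fix b
    have "(\<Sum>e\<in>E. ext_scale (h e) e) b = (\<Sum>c\<in>B. h (ext_vec B c) * ext_vec B c b)"
      unfolding E_def by (subst sum.reindex[OF inj]) (simp add: sum_fun_apply)
    also have "\<dots> = (\<Sum>c\<in>B. if c = b then h (ext_vec B b) else 0)"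
      by (intro sum.cong refl) (auto simp: unit)
    finally show "(\<Sum>e\<in>E. ext_scale (h e) e) b = (if b \<in> B then h (ext_vec B b) else 0)"
      using B by simp
  qed
  show indE: "K.independent E"
  proof (rule K.independent_if_scalars_zero[OF finE])
    fix h e assume "(\<Sum>e\<in>E. ext_scale (h e) e) = 0" "e \<in> E"
    then show "h e = 0" unfolding sum_E by (auto simp: fun_eq_iff E_def split: if_splits)
  qed
  show span_E: "K.span E = {v. \<forall>b. b \<notin> B \<longrightarrow> v b = 0}"
  proof (intro equalityI subsetI)
    fix v assume "v \<in> K.span E"
    then show "v \<in> {v :: 'b \<Rightarrow> 'a alg_closure. \<forall>b. b \<notin> B \<longrightarrow> v b = 0}"
      unfolding K.span_finite[OF finE] using sum_E by auto
  next
    fix v assume v: "v \<in> {v :: 'b \<Rightarrow> 'a alg_closure. \<forall>b. b \<notin> B \<longrightarrow> v b = 0}"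
    have eq: "v = (\<Sum>e\<in>E. ext_scale (v (inv_into B (ext_vec B) e)) e)"
      unfolding sum_E using v by (auto simp: fun_eq_iff inv_into_f_f[OF inj])
    show "v \<in> K.span E"
      by (subst eq) (intro K.span_sum K.span_scale K.span_base)
  qed
  show "K.representation E v (ext_vec B b) = v b" if "\<And>b. b \<notin> B \<Longrightarrow> v b = 0" "b \<in> B" for v b
  proof -
    have "v \<in> K.span E" using that span_E by auto
    from K.sum_representation_eq[OF indE this finE order_refl]
    have "(\<lambda>b. if b \<in> B then K.representation E v (ext_vec B b) else 0) = v"
      unfolding sum_E .
    from fun_cong[OF this, of b] show ?thesis using that(2) by simp
  qed
qed

end

text \<open>The field is a vector space over the rationals, and a functional on the line through
  \<open>z\<close> extends. Rational values later bring in positivity.\<close>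

lemma rat_linear_functional_exists:
  fixes z :: "'k::field_char_0"
  assumes "z \<noteq> 0"
  shows "\<exists>g :: 'k \<Rightarrow> rat. (\<forall>x y. g (x + y) = g x + g y) \<and> (\<forall>q x. g (of_rat q * x) = q * g x) \<and> g z = 1"
proof -
  interpret Q: vector_space_pair "\<lambda>(q::rat) (x::'k). of_rat q * x" "(*) :: rat \<Rightarrow> rat \<Rightarrow> rat"
    by unfold_locales (auto simp: algebra_simps of_rat_add of_rat_mult)
  have "Q.vs1.independent {z}" using assms by simp
  from Q.linear_independent_extend[OF this, of "\<lambda>_. 1"] show ?thesis
    by (auto simp: Vector_Spaces.linear_iff)
qed

section \<open>Cartan's criterion\<close>

text \<open>
  \<open>br\<close> need not be a Lie bracket: only its image under the action matters.  The last assumption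
  says that an ideal of \<open>G\<close> either acts trivially or is everything.
\<close>

locale simple_action =
  P: linear_space sp + U: linear_space su
  for sp :: "'f::field_char_0 \<Rightarrow> 'g::ab_group_add \<Rightarrow> 'g"
    and su :: "'f \<Rightarrow> 'u::ab_group_add \<Rightarrow> 'u" +
  fixes G :: "'g set" and br :: "'g \<Rightarrow> 'g \<Rightarrow> 'g" and act :: "'u \<Rightarrow> 'g \<Rightarrow> 'u"
  assumes fin_dim_G: "P.fin_dim G"
    and br_closed: "x \<in> G \<Longrightarrow> y \<in> G \<Longrightarrow> br x y \<in> G"
    and linear_act: "x \<in> G \<Longrightarrow> Vector_Spaces.linear su su (\<lambda>u. act u x)"
    and act_add: "x \<in> G \<Longrightarrow> y \<in> G \<Longrightarrow> act u (x + y) = act u x + act u y"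
    and act_scale: "x \<in> G \<Longrightarrow> act u (sp c x) = su c (act u x)"
    and act_br: "x \<in> G \<Longrightarrow> y \<in> G \<Longrightarrow> act u (br x y) = act (act u x) y - act (act u y) x"
    and perfect: "P.subspace J \<Longrightarrow> J \<subseteq> G \<Longrightarrow> (\<And>x y. x \<in> G \<Longrightarrow> y \<in> G \<Longrightarrow> br x y \<in> J) \<Longrightarrow> J = G"
    and proper_ideal: "P.subspace J \<Longrightarrow> J \<subseteq> G \<Longrightarrow> J \<noteq> G \<Longrightarrow>
      (\<And>x j. x \<in> G \<Longrightarrow> j \<in> J \<Longrightarrow> br x j \<in> J \<and> br j x \<in> J) \<Longrightarrow> j \<in> J \<Longrightarrow> act u j = 0"
begin

lemma subspace_G: "P.subspace G"
  by (rule P.fin_dim_subspace[OF fin_dim_G])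

lemma G_closed: "0 \<in> G" "x \<in> G \<Longrightarrow> y \<in> G \<Longrightarrow> x + y \<in> G" "x \<in> G \<Longrightarrow> y \<in> G \<Longrightarrow> x - y \<in> G"
    "x \<in> G \<Longrightarrow> sp c x \<in> G"
  using subspace_G by (auto intro: P.subspace_0 P.subspace_add P.subspace_diff P.subspace_scale)

lemma act_linear:
  assumes "x \<in> G"
  shows "act (u + v) x = act u x + act v x" "act (u - v) x = act u x - act v x"
    "act (su c u) x = su c (act u x)" "act 0 x = 0" "act (\<Sum>i\<in>I. h i) x = (\<Sum>i\<in>I. act (h i) x)"
proof -
  interpret A: Vector_Spaces.linear su su "\<lambda>u. act u x" by (rule linear_act[OF assms])
  show "act (u + v) x = act u x + act v x" "act (u - v) x = act u x - act v x"
    "act (su c u) x = su c (act u x)" "act 0 x = 0" "act (\<Sum>i\<in>I. h i) x = (\<Sum>i\<in>I. act (h i) x)"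
    using A.add A.diff A.scale A.zero A.sum by auto
qed

lemma act_0: "act u 0 = 0"
  using act_scale[OF G_closed(1), of u 0] by simp

lemma act_diff: "x \<in> G \<Longrightarrow> y \<in> G \<Longrightarrow> act u (x - y) = act u x - act u y"
  using act_add[of "x - y" y u] G_closed by simp

lemma act_sum:
  assumes "\<And>i. i \<in> I \<Longrightarrow> h i \<in> G"
  shows "act u (\<Sum>i\<in>I. h i) = (\<Sum>i\<in>I. act u (h i))"
  using assms
proof (induction I rule: infinite_finite_induct)
  case (insert i I)
  then show ?case
    using act_add[of "h i" "sum h I" u] P.subspace_sum[OF subspace_G, of I h] by simp
qed (simp_all add: act_0)

definition submod :: "'u set \<Rightarrow> bool"
  where "submod W \<longleftrightarrow> U.fin_dim W \<and> (\<forall>w\<in>W. \<forall>x\<in>G. act w x \<in> W)"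

lemma submod_subspace: "submod W \<Longrightarrow> U.subspace W"
  by (simp add: submod_def U.fin_dim_subspace)

text \<open>By \<open>act_br\<close> the elements that kill \<open>u\<close> include all brackets,
  and \<open>perfect\<close> makes them all of \<open>G\<close>.\<close>

lemma perfect_kernel:
  assumes "\<And>x y. x \<in> G \<Longrightarrow> y \<in> G \<Longrightarrow> act (act u x) y = 0" "x \<in> G"
  shows "act u x = 0"
proof -
  have "{x \<in> G. act u x = 0} = G"
  proof (rule perfect)
    show "P.subspace {x \<in> G. act u x = 0}"
      by (rule P.subspaceI) (auto simp: G_closed act_0 act_add act_scale)
    show "br x y \<in> {x \<in> G. act u x = 0}" if "x \<in> G" "y \<in> G" for x y
      using that assms(1) by (simp add: br_closed act_br)
  qed auto
  then show ?thesis using assms(2) by blast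
qed

definition trace_form :: "'u set \<Rightarrow> 'g \<Rightarrow> 'g \<Rightarrow> 'f"
  where "trace_form B x y = U.trace B (\<lambda>u. act (act u x) y)"

end

text \<open>Traces are taken on \<open>W\<close> alone while the action stays on the ambient space,
  since the lifting theorem also acts on a vector that may lie outside \<open>W\<close>.\<close>

locale simple_action_basis = simple_action sp su G br act
  for sp :: "'f::field_char_0 \<Rightarrow> 'g::ab_group_add \<Rightarrow> 'g"
    and su :: "'f \<Rightarrow> 'u::ab_group_add \<Rightarrow> 'u" and G br act +
  fixes W B :: "'u set"
  assumes submod: "submod W"
    and B: "finite B" "U.independent B" "U.span B = W"
begin

lemma act_W: "w \<in> W \<Longrightarrow> x \<in> G \<Longrightarrow> act w x \<in> W"
  using submod by (simp add: submod_def)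

lemma act_B: "b \<in> B \<Longrightarrow> x \<in> G \<Longrightarrow> act b x \<in> U.span B"
  using act_W B(3) U.span_base by blast

lemma act_span_B: "b \<in> U.span B \<Longrightarrow> x \<in> G \<Longrightarrow> act b x \<in> U.span B"
  using act_W B(3) by blast

lemma linear_act_act:
  "x \<in> G \<Longrightarrow> y \<in> G \<Longrightarrow> Vector_Spaces.linear su su (\<lambda>u. act (act u x) y)"
  unfolding Vector_Spaces.linear_iff using U.vector_space_axioms by (simp add: act_linear)

lemma trace_form_commute:
  assumes "x \<in> G" "y \<in> G"
  shows "trace_form B x y = trace_form B y x"
  unfolding trace_form_def
  by (rule U.trace_commute[OF B(1,2) linear_act[OF assms(2)] _ linear_act[OF assms(1)]])
    (use assms act_B in auto)

lemma trace_form_add: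
  assumes "x \<in> G" "x' \<in> G" "y \<in> G"
  shows "trace_form B (x + x') y = trace_form B x y + trace_form B x' y"
  unfolding trace_form_def using assms
  by (subst U.trace_add[symmetric]) (auto simp: B(1,2) act_add act_linear act_B act_span_B)

lemma trace_form_scale:
  assumes "x \<in> G" "y \<in> G"
  shows "trace_form B (sp c x) y = c * trace_form B x y"
  unfolding trace_form_def using assms
  by (subst U.trace_scale[symmetric]) (auto simp: B(1,2) act_scale act_linear act_B act_span_B)

lemma trace_form_diff:
  assumes "x \<in> G" "x' \<in> G" "y \<in> G"
  shows "trace_form B (x - x') y = trace_form B x y - trace_form B x' y"
  using trace_form_add[of "x - x'" x' y] assms by (simp add: G_closed)

lemma trace_form_0: "y \<in> G \<Longrightarrow> trace_form B 0 y = 0"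
  using trace_form_scale[of 0 y 0] by (simp add: G_closed)

lemma trace_form_sum:
  assumes "\<And>i. i \<in> I \<Longrightarrow> h i \<in> G" "y \<in> G"
  shows "trace_form B (\<Sum>i\<in>I. h i) y = (\<Sum>i\<in>I. trace_form B (h i) y)"
  using assms
proof (induction I rule: infinite_finite_induct)
  case (insert i I)
  then show ?case
    using trace_form_add[of "h i" "sum h I" y] P.subspace_sum[OF subspace_G, of I h] by simp
qed (simp_all add: trace_form_0)

text \<open>Invariance of the form, from cyclicity of the trace. The element \<open>a\<close> is the
  right factor of both brackets because \<open>br\<close> carries no antisymmetry of its
  own.\<close>

lemma trace_form_br:
  assumes "x \<in> G" "a \<in> G" "y \<in> G"
  shows "trace_form B (br x a) y = - trace_form B x (br y a)"
proof -
  have "trace_form B (br x a) y =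
      U.trace B (\<lambda>u. act (act (act u x) a) y) - U.trace B (\<lambda>u. act (act (act u a) x) y)"
    unfolding trace_form_def using assms
    by (subst U.trace_diff[symmetric]) (auto simp: B(1,2) act_br act_linear act_B act_span_B)
  moreover have "trace_form B x (br y a) =
      U.trace B (\<lambda>u. act (act (act u x) y) a) - U.trace B (\<lambda>u. act (act (act u x) a) y)"
    unfolding trace_form_def using assms
    by (subst U.trace_diff[symmetric]) (auto simp: B(1,2) act_br act_linear act_B act_span_B)
  moreover have "U.trace B (\<lambda>u. act (act (act u a) x) y) = U.trace B (\<lambda>u. act (act (act u x) y) a)"
    using assms
    by (intro U.trace_commute[OF B(1,2), of "\<lambda>u. act (act u x) y" "\<lambda>u. act u a"]
      linear_act_act linear_act act_B act_span_B)
  ultimately show ?thesis by simp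
qed

text \<open>After scalar extension let \<open>Y\<close> have diagonal \<open>f (\<alpha> c)\<close>
  on an adapted basis of \<open>R x\<close>. The traces of \<open>Y\<close> against all brackets
  vanish, hence by perfectness also against \<open>x\<close>, and that trace is the sum of all
  \<open>f (\<alpha> c) * \<alpha> c\<close>.\<close>

lemma nilpotent_if_trace_form_0:
  assumes zero: "\<And>x y. x \<in> G \<Longrightarrow> y \<in> G \<Longrightarrow> trace_form B x y = 0" and x: "x \<in> G"
  shows "\<exists>n. \<forall>w\<in>W. ((\<lambda>u. act u x) ^^ n) w = 0"
proof -
  let ?sk = "U.ext_scale :: 'f alg_closure \<Rightarrow> ('u \<Rightarrow> 'f alg_closure) \<Rightarrow> ('u \<Rightarrow> 'f alg_closure)"
  interpret K: closed_linear_space ?sk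
    by (intro closed_linear_space.intro linear_space_functions)
  interpret KK: vector_space_pair ?sk ?sk by unfold_locales
  define E where "E = U.ext_vec B ` B"
  note E = U.ext_basis[OF B(1,2), folded E_def]
  define R where "R x = U.ext_op B (\<lambda>u. act u x)" for x
  have linR: "Vector_Spaces.linear ?sk ?sk (R x)" for x
    unfolding R_def by (rule U.ext_op_linear)
  have R_span: "R x v \<in> K.span E" if "x \<in> G" for x v
    unfolding E(3) R_def by (simp add: U.ext_op_outside)
  have R_br: "R (br y z) v = R z (R y v) - R y (R z v)" if "y \<in> G" "z \<in> G" for y z v
    unfolding R_def using that
    by (simp add: act_br U.ext_op_diff U.ext_op_comp B(1,2) linear_act act_B act_span_B)
  have R_add: "R (y + z) v = R y v + R z v" if "y \<in> G" "z \<in> G" for y z v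
    unfolding R_def using that by (simp add: act_add U.ext_op_add B(1,2) act_B)
  have R_scale: "R (sp c y) v = ?sk (to_ac c) (R y v)" if "y \<in> G" for c y v
    unfolding R_def using that by (simp add: act_scale U.ext_op_scale B(1,2) act_B)
  have trE: "K.trace E (U.ext_op B T) = to_ac (U.trace B T)" for T
  proof -
    have "K.trace E (U.ext_op B T) = (\<Sum>b\<in>B. K.representation E (U.ext_op B T (U.ext_vec B b)) (U.ext_vec B b))"
      unfolding K.trace_def E_def by (rule sum.reindex_cong[OF E(5) refl refl])
    also have "\<dots> = (\<Sum>b\<in>B. U.ext_op B T (U.ext_vec B b) b)"
      by (intro sum.cong refl E(4)) (simp_all add: U.ext_op_outside)
    also have "\<dots> = (\<Sum>b\<in>B. to_ac (U.representation B (T b) b))"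
    proof (rule sum.cong[OF refl])
      fix b assume b: "b \<in> B"
      have "U.ext_op B T (U.ext_vec B b) b = (\<Sum>c\<in>B. if c = b then to_ac (U.representation B (T b) b) else 0)"
        unfolding U.ext_op_def U.ext_vec_def using b B
        by (intro sum.cong refl) (auto simp: U.representation_basis)
      then show "U.ext_op B T (U.ext_vec B b) b = to_ac (U.representation B (T b) b)"
        using b B(1) by simp
    qed
    finally show ?thesis by (simp add: U.trace_def to_ac_sum)
  qed
  obtain C \<alpha> r where C: "K.adapted_basis (R x) C \<alpha> r" "K.span C = K.span E"
    using K.adapted_basis_exists_closed[OF linR K.fin_dim_span[OF E(1)], of x] R_span[OF x] by blast
  have finC: "finite C" and indC: "K.independent C" using C(1) by (auto simp: K.adapted_basis_def)
  have R_C: "R x v \<in> K.span C" if "x \<in> G" for x v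
    using R_span that C(2) by simp
  have "\<alpha> c = 0" if "c \<in> C" for c
  proof (rule ccontr)
    assume "\<alpha> c \<noteq> 0"
    then obtain g :: "'f alg_closure \<Rightarrow> rat" where g: "\<And>x y. g (x + y) = g x + g y"
      "\<And>q x. g (of_rat q * x) = q * g x" "g (\<alpha> c) = 1"
      using rat_linear_functional_exists by metis
    define f where "f z = (of_rat (g z) :: 'f alg_closure)" for z
    have g0: "g 0 = 0" using g(1)[of 0 0] by simp
    have gd: "g (x - y) = g x - g y" for x y using g(1)[of "x - y" y] by simp
    have fd: "f (x - y) = f x - f y" for x y by (simp add: f_def gd of_rat_diff)
    obtain Y where Y: "Vector_Spaces.linear ?sk ?sk Y" "\<And>d. d \<in> C \<Longrightarrow> Y d = ?sk (f (\<alpha> d)) d"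
      using KK.linear_independent_extend[OF indC, of "\<lambda>d. ?sk (f (\<alpha> d)) d"] by metis
    have YC: "Y d \<in> K.span C" if "d \<in> C" for d
      unfolding Y(2)[OF that] using that by (intro K.span_scale K.span_base)
    have Y_span: "Y v \<in> K.span C" if "v \<in> K.span C" for v
      by (rule K.linear_in_span[OF Y(1) YC that])
    have comm: "K.trace C (\<lambda>v. Y (R b (R a v)) - R b (Y (R a v))) = 0" if ab: "a \<in> G" "b \<in> G" for a b
    proof -
      define D where "D = (\<lambda>V v. R x (V v) - V (R x v))"
      \<comment> \<open>The commutator with \<open>R x\<close> stays within the image of the action,
        so the traces required of its iterates are values of the trace form.\<close>
      have D_R: "D (R z) = R (br z x)" if "z \<in> G" for z
        by (rule ext) (simp only: D_def R_br[OF that x])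
      show ?thesis
    proof (rule K.twisted_trace_eq_0[OF C(1) linR linR R_C[OF ab(1)] _ _ D_def _ Y(1,2)])
      have Dk: "(D ^^ k) (R b) = R (((\<lambda>z. br z x) ^^ k) b) \<and> ((\<lambda>z. br z x) ^^ k) b \<in> G" for k
      proof (induction k)
        case (Suc k)
        then show ?case using D_R by (simp add: br_closed x)
      qed (simp add: ab)
      show "Vector_Spaces.linear ?sk ?sk ((D ^^ k) (R b))" for k
        using Dk[of k] linR by simp
      show "(D ^^ k) (R b) d \<in> K.span C" for k d
        using Dk[of k] R_C by simp
      show "K.trace C (\<lambda>v. (D ^^ k) (R b) (R a v)) = 0" for k
      proof -
        define z where "z = ((\<lambda>z. br z x) ^^ k) b"
        have z: "z \<in> G" "(D ^^ k) (R b) = R z" using Dk[of k] by (auto simp: z_def)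
        have eq: "(\<lambda>v. R z (R a v)) = U.ext_op B (\<lambda>u. act (act u a) z)"
          unfolding R_def using z ab by (simp add: U.ext_op_comp B(1,2) linear_act act_B)
        have "K.trace C (\<lambda>v. R z (R a v)) = K.trace E (\<lambda>v. R z (R a v))"
          by (rule K.trace_basis_change[OF finC indC E(1,2) C(2)])
            (use U.ext_op_linear[of B "\<lambda>u. act (act u a) z"] R_C[OF z(1)] in \<open>auto simp: eq[symmetric]\<close>)
        also have "\<dots> = to_ac (trace_form B a z)"
          unfolding eq trE trace_form_def ..
        finally show ?thesis using zero ab(1) z by simp
      qed
    qed (simp_all add: fd)
    qed
    \<comment> \<open>A subspace over the base field although the traces live in the closure, so
      \<open>perfect\<close> applies to it.\<close>
    define J where "J = {z \<in> G. K.trace C (\<lambda>v. Y (R z v)) = 0}"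
    have trY_comm: "K.trace C (\<lambda>v. Y (R (br a b) v)) = 0" if ab: "a \<in> G" "b \<in> G" for a b
    proof -
      interpret Y: Vector_Spaces.linear ?sk ?sk Y by (rule Y(1))
      have 1: "K.trace C (\<lambda>v. R b (Y (R a v))) = K.trace C (\<lambda>v. Y (R a (R b v)))"
      proof (rule K.trace_commute[OF finC indC linR R_C[OF ab(2)], of "\<lambda>v. Y (R a v)"])
        show "Vector_Spaces.linear ?sk ?sk (\<lambda>v. Y (R a v))"
          using Vector_Spaces.linear_compose[OF linR[of a] Y(1)] by (simp add: comp_def)
        show "Y (R a d) \<in> K.span C" for d by (rule Y_span[OF R_C[OF ab(1)]])
      qed
      have "K.trace C (\<lambda>v. Y (R (br a b) v)) =
          K.trace C (\<lambda>v. Y (R b (R a v)) - Y (R a (R b v)))"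
        by (simp add: R_br[OF ab] Y.diff)
      also have "\<dots> = K.trace C (\<lambda>v. Y (R b (R a v))) - K.trace C (\<lambda>v. Y (R a (R b v)))"
        by (intro K.trace_diff indC Y_span R_C ab)
      also have "\<dots> = K.trace C (\<lambda>v. Y (R b (R a v)) - R b (Y (R a v)))"
        unfolding 1[symmetric] by (intro K.trace_diff[symmetric] indC Y_span R_C ab)
      also have "\<dots> = 0" by (rule comm[OF ab])
      finally show ?thesis .
    qed
    have "J = G"
    proof (rule perfect)
      interpret Y: Vector_Spaces.linear ?sk ?sk Y by (rule Y(1))
      have R0: "R 0 v = 0" for v
        unfolding R_def U.ext_op_def by (simp add: act_0 U.representation_zero fun_eq_iff)
      show "P.subspace J"
      proof (rule P.subspaceI)
        show "0 \<in> J" by (simp add: J_def G_closed R0 Y.zero K.trace_def K.representation_zero)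
        show "y + z \<in> J" if "y \<in> J" "z \<in> J" for y z
          using that K.trace_add[OF indC, of "\<lambda>v. Y (R y v)" "\<lambda>v. Y (R z v)"] Y_span R_C
          by (simp add: J_def G_closed R_add Y.add)
        show "sp k z \<in> J" if "z \<in> J" for k z
          using that K.trace_scale[OF indC, of "\<lambda>v. Y (R z v)" "to_ac k"] Y_span R_C
          by (simp add: J_def G_closed R_scale Y.scale)
      qed
      show "br a b \<in> J" if "a \<in> G" "b \<in> G" for a b
        using that trY_comm by (simp add: J_def br_closed)
    qed (auto simp: J_def)
    then have "K.trace C (\<lambda>v. Y (R x v)) = 0" using x unfolding J_def by blast
    moreover have "K.trace C (\<lambda>v. Y (R x v)) = (\<Sum>d\<in>C. of_rat (g (\<alpha> d)) * \<alpha> d)"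
    proof -
      have "K.trace C (\<lambda>v. Y (R x v)) = K.trace C (\<lambda>v. R x (Y v))"
        by (rule K.trace_commute[OF finC indC Y(1) YC linR R_C[OF x]])
      also have "\<dots> = (\<Sum>d\<in>C. of_rat (g (\<alpha> d)) * \<alpha> d)"
        unfolding K.trace_def
      proof (rule sum.cong[OF refl])
        fix d assume d: "d \<in> C"
        have "R x (Y d) = ?sk (f (\<alpha> d)) (R x d)"
          using linR[of x] unfolding Y(2)[OF d] Vector_Spaces.linear_iff by blast
        then have "K.representation C (R x (Y d)) d = f (\<alpha> d) * K.representation C (R x d) d"
          by (simp only: K.representation_scale[OF indC R_C[OF x]])
        then show "K.representation C (R x (Y d)) d = of_rat (g (\<alpha> d)) * \<alpha> d"
          using K.adapted_basis_representation(1)[OF C(1) d d] by (simp add: f_def)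
      qed
      finally show ?thesis .
    qed
    ultimately have "(\<Sum>d\<in>C. of_rat (g (\<alpha> d)) * \<alpha> d) = 0" by simp
    \<comment> \<open>Applying \<open>g\<close> once more turns the relation into a sum of rational
      squares, one of which is \<open>1\<close>.\<close>
    moreover have "g (\<Sum>d\<in>I. of_rat (g (\<alpha> d)) * \<alpha> d) = (\<Sum>d\<in>I. g (\<alpha> d) * g (\<alpha> d))" for I
      by (induction I rule: infinite_finite_induct) (simp_all add: g(1,2) g0)
    ultimately have "(\<Sum>d\<in>C. g (\<alpha> d) * g (\<alpha> d)) = 0" using g0 by metis
    then have "g (\<alpha> c) * g (\<alpha> c) = 0"
      using finC \<open>c \<in> C\<close> by (subst (asm) sum_nonneg_eq_0_iff) auto
    then show False using g(3) by simp
  qed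
  then obtain n where n: "\<And>v. v \<in> K.span C \<Longrightarrow> (R x ^^ n) v = 0"
    using K.adapted_basis_nilpotent[OF linR C(1)] by blast
  have pow: "(R x ^^ k) (U.ext_vec B w) = U.ext_vec B (((\<lambda>u. act u x) ^^ k) w)
      \<and> ((\<lambda>u. act u x) ^^ k) w \<in> W" if "w \<in> W" for k w
  proof (induction k)
    case (Suc k)
    then show ?case
      using U.ext_op_ext_vec[OF B(1,2) linear_act[OF x] act_B[OF _ x]] B(3) act_W[OF _ x]
      by (simp add: R_def)
  qed (simp add: that)
  show ?thesis
  proof (intro exI ballI)
    fix w assume w: "w \<in> W"
    have "U.ext_vec B w \<in> K.span C"
      unfolding C(2) E(3) U.ext_vec_def by (auto dest: U.representation_ne_zero)
    then have "U.ext_vec B (((\<lambda>u. act u x) ^^ n) w) = 0" using n pow[OF w, of n] by simp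
    then show "((\<lambda>u. act u x) ^^ n) w = 0"
      using U.ext_vec_eq_0[OF B(1,2)] pow[OF w, of n] B(3) by blast
  qed
qed

end

section \<open>Engel's theorem and Whitehead's first lemma\<close>

context simple_action
begin

text \<open>The ascending annihilator series: the vectors of \<open>W\<close> sent to zero by any
  \<open>i\<close> successive elements of \<open>K\<close>. Reaching \<open>W\<close> means that
  \<open>K\<close> acts by simultaneously strictly triangular operators.\<close>

primrec flag :: "'u set \<Rightarrow> 'g set \<Rightarrow> nat \<Rightarrow> 'u set"
  where "flag W K 0 = {0}"
  | "flag W K (Suc i) = {w \<in> W. \<forall>k\<in>K. act w k \<in> flag W K i}"

lemma flag_subset: "submod W \<Longrightarrow> flag W K i \<subseteq> W"
  by (cases i) (auto dest: submod_subspace intro: U.subspace_0)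

lemma subspace_flag:
  assumes "submod W" "K \<subseteq> G"
  shows "U.subspace (flag W K i)"
proof (induction i)
  case (Suc i)
  note W = submod_subspace[OF assms(1)]
  show ?case
  proof (rule U.subspaceI)
    show "0 \<in> flag W K (Suc i)"
      using assms(2) U.subspace_0[OF W] U.subspace_0[OF Suc] by (auto simp: act_linear)
    show "u + v \<in> flag W K (Suc i)" if "u \<in> flag W K (Suc i)" "v \<in> flag W K (Suc i)" for u v
      using that assms(2) U.subspace_add[OF W] U.subspace_add[OF Suc] by (auto simp: act_linear subset_iff)
    show "su c u \<in> flag W K (Suc i)" if "u \<in> flag W K (Suc i)" for c u
      using that assms(2) U.subspace_scale[OF W] U.subspace_scale[OF Suc] by (auto simp: act_linear subset_iff)
  qed
qed simp

lemma flag_Suc_mono: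
  assumes "submod W" "K \<subseteq> G"
  shows "flag W K i \<subseteq> flag W K (Suc i)"
proof (induction i)
  case 0
  show ?case using U.subspace_0[OF subspace_flag[OF assms, of 1]] by simp
next
  case (Suc i)
  show ?case
  proof
    fix w assume "w \<in> flag W K (Suc i)"
    then have "w \<in> W" "\<forall>k\<in>K. act w k \<in> flag W K i" by simp_all
    then show "w \<in> flag W K (Suc (Suc i))" using Suc by (simp only: flag.simps(2)[of _ _ "Suc i"]) blast
  qed
qed

lemma flag_mono:
  assumes "submod W" "K \<subseteq> G" "i \<le> j"
  shows "flag W K i \<subseteq> flag W K j"
  using lift_Suc_mono_le[of "flag W K" i j] flag_Suc_mono[OF assms(1,2)] assms(3) by blast

lemma flag_act:
  assumes "submod W" "K \<subseteq> G" "w \<in> flag W K i" "k \<in> K"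
  shows "act w k \<in> flag W K (i - 1)"
  using assms by (cases i) (auto simp: act_linear subset_iff)

text \<open>
  Bracketing with \<open>K\<close> lowers the degree of operators with respect to the flag of \<open>K\<close>, so if the
  flag exhausts \<open>W\<close> then iterated brackets with \<open>K\<close> eventually act trivially.
\<close>

lemma flag_normalizer_exists:
  assumes W: "submod W" and K: "K \<subseteq> G" and N: "flag W K N = W"
    and triv: "\<And>x. x \<in> G \<Longrightarrow> (\<And>w. w \<in> W \<Longrightarrow> act w x = 0) \<Longrightarrow> x \<in> K"
    and "K \<noteq> G"
  shows "\<exists>x. x \<in> G - K \<and> (\<forall>k\<in>K. br x k \<in> K)"
proof (rule ccontr)
  assume not: "\<not> ?thesis"
  have exhaust: "flag W K j = W" if "N \<le> j" for j
    using flag_mono[OF W K that] flag_subset[OF W] N by blast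
  have actW: "act w x \<in> W" if "w \<in> W" "x \<in> G" for w x
    using W that by (simp add: submod_def)
  \<comment> \<open>\<open>n\<close> measures how far \<open>z\<close> pushes down. At the start
    \<open>act w z\<close> lies in \<open>W\<close>, which is \<open>flag W K (i + N)\<close>, and
    each bracket with an element of \<open>K\<close> gains one level. Truncated subtraction is
    harmless because \<open>flag W K 0\<close> is zero.\<close>
  have "\<exists>z\<in>G - K. \<forall>i. \<forall>w\<in>flag W K i. act w z \<in> flag W K (i + N - n)" for n
  proof (induction n)
    case 0
    obtain z where "z \<in> G - K" using K assms(5) by blast
    then show ?case using exhaust subsetD[OF flag_subset[OF W]] actW by (intro bexI[of _ z]) auto
  next
    case (Suc n)
    then obtain z where z: "z \<in> G" "z \<notin> K" "\<And>i w. w \<in> flag W K i \<Longrightarrow> act w z \<in> flag W K (i + N - n)"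
      by blast
    then obtain k where k: "k \<in> K" "br z k \<notin> K" using not by blast
    have kG: "k \<in> G" using k K by blast
    have "act w (br z k) \<in> flag W K (i + N - Suc n)" if w: "w \<in> flag W K i" for i w
    proof (cases i)
      case 0
      then have "w = 0" using w by simp
      then show ?thesis
        using U.subspace_0[OF subspace_flag[OF W K]] z kG by (simp add: br_closed act_linear)
    next
      case (Suc j)
      have "act (act w z) k \<in> flag W K (i + N - n - 1)"
        by (rule flag_act[OF W K z(3)[OF w] k(1)])
      moreover have "act w k \<in> flag W K j" using flag_act[OF W K w k(1)] Suc by simp
      then have "act (act w k) z \<in> flag W K (j + N - n)" by (rule z(3))
      ultimately show ?thesis
        using Suc z kG U.subspace_diff[OF subspace_flag[OF W K]] by (simp add: act_br)
    qed
    then show ?case using k z(1) kG by (intro bexI[of _ "br z k"]) (auto simp: br_closed)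
  qed
  \<comment> \<open>After \<open>N + N\<close> brackets every \<open>w\<close> in
    \<open>flag W K N\<close>, that is in \<open>W\<close>, is sent to level
    \<open>0\<close>.\<close>
  from this[of "N + N"] obtain z where z: "z \<in> G - K"
    "\<And>i w. w \<in> flag W K i \<Longrightarrow> act w z \<in> flag W K (i + N - (N + N))" by blast
  have "act w z = 0" if "w \<in> W" for w
    using z(2)[of w N] that N by simp
  then show False using triv z(1) by blast
qed

text \<open>Since \<open>x\<close> normalises \<open>K\<close>, it preserves every term of the old
  flag; its nilpotency exponent \<open>m\<close> then bounds the number of new levels needed per old
  level.\<close>

lemma flag_adjoin:
  assumes W: "submod W" and K: "K \<subseteq> G" and N: "flag W K N = W"
    and x: "x \<in> G" "\<And>w. w \<in> W \<Longrightarrow> ((\<lambda>u. act u x) ^^ m) w = 0" "\<And>k. k \<in> K \<Longrightarrow> br x k \<in> K"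
    and K': "K' \<subseteq> G" "\<And>k'. k' \<in> K' \<Longrightarrow> \<exists>k\<in>K. \<exists>c. k' = k + sp c x"
  shows "flag W K' (N * m) = W"
proof -
  have actW: "act w y \<in> W" if "w \<in> W" "y \<in> G" for w y
    using W that by (simp add: submod_def)
  note sK' = subspace_flag[OF W K'(1)]
  have xF: "act w x \<in> flag W K i" if "w \<in> flag W K i" for w i
    using that
  proof (induction i arbitrary: w)
    case (Suc i)
    have "act (act w x) k \<in> flag W K i" if k: "k \<in> K" for k
    proof -
      have kG: "k \<in> G" using k K by blast
      have "act (act w x) k = act w (br x k) + act (act w k) x"
        by (simp add: act_br[OF x(1) kG])
      then show ?thesis
        using Suc k x(3)[OF k] U.subspace_add[OF subspace_flag[OF W K]] by simp
    qed
    then show ?case using Suc.prems actW x(1) by simp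
  qed (simp add: act_linear x)
  have "flag W K i \<subseteq> flag W K' (i * m)" for i
  proof (induction i)
    case (Suc i)
    \<comment> \<open>Here \<open>j\<close> counts the applications of \<open>x\<close> that bring
      \<open>w\<close> down to the part already treated.\<close>
    have "w \<in> flag W K' (i * m + j)"
      if "w \<in> flag W K (Suc i)" "((\<lambda>u. act u x) ^^ j) w \<in> flag W K' (i * m)" for w j
      using that
    proof (induction j arbitrary: w)
      case (Suc j)
      have "act w k' \<in> flag W K' (i * m + j)" if k': "k' \<in> K'" for k'
      proof -
        obtain k c where k: "k \<in> K" "k' = k + sp c x" using K'(2)[OF k'] by blast
        have "act w k \<in> flag W K i" using Suc.prems(1) k(1) by simp
        then have 1: "act w k \<in> flag W K' (i * m + j)"
          using \<open>flag W K i \<subseteq> flag W K' (i * m)\<close> flag_mono[OF W K'(1), of "i * m" "i * m + j"] by auto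
        have 2: "act w x \<in> flag W K' (i * m + j)"
          using xF[OF Suc.prems(1)] Suc.prems(2)
          by (intro Suc.IH) (simp_all only: funpow_Suc_right comp_apply)
        have kG: "k \<in> G" using k K by blast
        have "act w k' = act w k + su c (act w x)"
          using kG x(1) by (simp add: k(2) act_add act_scale G_closed)
        then show ?thesis using 1 2 by (simp add: U.subspace_add U.subspace_scale sK')
      qed
      then show ?case using Suc.prems(1) by simp
    qed simp
    note * = this
    show ?case
    proof
      fix w assume w: "w \<in> flag W K (Suc i)"
      then have "((\<lambda>u. act u x) ^^ m) w \<in> flag W K' (i * m)"
        using x(2) U.subspace_0[OF sK'] by simp
      from *[OF w this] show "w \<in> flag W K' (Suc i * m)" by (simp add: add.commute)
    qed
  qed simp
  from this[of N] show ?thesis using N flag_subset[OF W] by blast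
qed

end

context simple_action_basis
begin

text \<open>Engel's argument: among the subspaces containing the kernel \<open>Z\<close> of the
  action, a maximal one whose flag exhausts \<open>W\<close> must be \<open>G\<close>, as a
  normalising element could otherwise be adjoined. Perfectness then collapses the flag to its first
  term.\<close>

lemma act_eq_0_if_nilpotent:
  assumes nil: "\<And>x. x \<in> G \<Longrightarrow> \<exists>n. \<forall>w\<in>W. ((\<lambda>u. act u x) ^^ n) w = 0"
    and "w \<in> W" "x \<in> G"
  shows "act w x = 0"
proof -
  define Z where "Z = {x \<in> G. \<forall>w\<in>W. act w x = 0}"
  \<comment> \<open>\<open>Z\<close> is built in because the normaliser lemma asks \<open>K\<close>
    to contain whatever acts trivially; counting the independent set \<open>S\<close> guarantees a
    maximum.\<close>
  define good where "good S \<longleftrightarrow> P.independent S \<and> S \<subseteq> G \<and> (\<exists>N. flag W (P.span (Z \<union> S)) N = W)" for S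
  have sZ: "P.subspace Z"
    unfolding Z_def by (rule P.subspaceI) (auto simp: G_closed act_0 act_add act_scale)
  have spanG: "P.span T \<subseteq> G" if "T \<subseteq> G" for T using P.span_minimal[OF that subspace_G] .
  obtain D where D: "finite D" "P.independent D" "P.span D = G" by (rule P.fin_dim_basis[OF fin_dim_G])
  have bound: "finite S \<and> card S \<le> card D" if "good S" for S
    using P.independent_span_bound[of D S] D that by (simp add: good_def)
  have span_Z: "P.span (Z \<union> {}) = Z" using sZ by (simp add: P.span_eq_iff)
  have "flag W Z 1 = W" by (auto simp: Z_def)
  then have "flag W (P.span (Z \<union> {})) 1 = W" by (simp only: span_Z)
  then have "good {}" unfolding good_def using P.independent_empty by blast
  then obtain S where S: "good S" "\<And>S'. good S' \<Longrightarrow> card S' \<le> card S"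
    using ex_has_greatest_nat[of good "{}" card "Suc (card D)"] bound by (auto simp: less_Suc_eq_le)
  define K where "K = P.span (Z \<union> S)"
  have ZG: "Z \<subseteq> G" by (auto simp: Z_def)
  have SG: "S \<subseteq> G" and indS: "P.independent S" using S(1) by (auto simp: good_def)
  have KG: "K \<subseteq> G" unfolding K_def using ZG SG by (intro spanG) blast
  obtain N where N: "flag W K N = W" using S(1) unfolding good_def K_def by blast
  have ZK: "Z \<subseteq> K" unfolding K_def by (auto intro: P.span_base)
  have "K = G"
  proof (rule ccontr)
    assume "K \<noteq> G"
    moreover have "x \<in> K" if "x \<in> G" "\<And>w. w \<in> W \<Longrightarrow> act w x = 0" for x
      using that ZK by (auto simp: Z_def)
    ultimately obtain x where x: "x \<in> G" "x \<notin> K" "\<And>k. k \<in> K \<Longrightarrow> br x k \<in> K"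
      using flag_normalizer_exists[OF submod KG N] by blast
    obtain m where m: "\<And>w. w \<in> W \<Longrightarrow> ((\<lambda>u. act u x) ^^ m) w = 0" using nil[OF x(1)] by blast
    have "x \<notin> P.span S" using x(2) P.in_span_mono[of x S "Z \<union> S"] unfolding K_def by blast
    have "flag W (P.span (Z \<union> insert x S)) (N * m) = W"
    proof (rule flag_adjoin[OF submod KG N x(1) m x(3)])
      show "P.span (Z \<union> insert x S) \<subseteq> G" using ZG SG x(1) by (intro spanG) blast
      show "\<exists>k\<in>K. \<exists>c. k' = k + sp c x" if "k' \<in> P.span (Z \<union> insert x S)" for k'
      proof -
        have "k' \<in> P.span (insert x (Z \<union> S))" using that by simp
        then obtain c where "k' - sp c x \<in> K" unfolding K_def P.span_breakdown_eq by blast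
        then show ?thesis by (intro bexI[of _ "k' - sp c x"] exI[of _ c]) simp_all
      qed
    qed
    then have "good (insert x S)"
      unfolding good_def using \<open>x \<notin> P.span S\<close> indS SG x(1) P.independent_insertI by blast
    moreover have "x \<notin> S" using \<open>x \<notin> P.span S\<close> P.span_base by blast
    ultimately show False using S(2)[of "insert x S"] bound[OF S(1)] by simp
  qed
  \<comment> \<open>A vector killed by all pairs of elements is killed by single ones, so the flag
    of \<open>G\<close> stops growing after its first step.\<close>
  have F2: "flag W G (Suc (Suc 0)) = flag W G (Suc 0)"
  proof
    show "flag W G (Suc (Suc 0)) \<subseteq> flag W G (Suc 0)"
    proof
      fix w assume "w \<in> flag W G (Suc (Suc 0))"
      then show "w \<in> flag W G (Suc 0)" using perfect_kernel[of w] by simp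
    qed
    show "flag W G (Suc 0) \<subseteq> flag W G (Suc (Suc 0))" by (rule flag_Suc_mono[OF submod order_refl])
  qed
  have "flag W G (Suc i) = flag W G (Suc 0)" for i
  proof (induction i)
    case (Suc i)
    have "flag W G (Suc (Suc i)) = {w \<in> W. \<forall>k\<in>G. act w k \<in> flag W G (Suc i)}" by simp
    also have "\<dots> = flag W G (Suc (Suc 0))" unfolding Suc by simp
    finally show ?case using F2 by simp
  qed simp
  moreover have "W = flag W G N" using N \<open>K = G\<close> by simp
  moreover have "flag W G N \<subseteq> flag W G (Suc N)" by (rule flag_Suc_mono[OF submod order_refl])
  ultimately have "w \<in> flag W G (Suc 0)" using assms(2) by blast
  then show ?thesis using assms(3) by simp
qed

lemma trace_form_nonzero:
  assumes "w \<in> W" "x \<in> G" "act w x \<noteq> 0"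
  shows "\<exists>x\<in>G. \<exists>y\<in>G. trace_form B x y \<noteq> 0"
proof (rule ccontr)
  assume "\<not> ?thesis"
  then have "\<And>x y. x \<in> G \<Longrightarrow> y \<in> G \<Longrightarrow> trace_form B x y = 0" by blast
  from act_eq_0_if_nilpotent[OF nilpotent_if_trace_form_0[OF this] assms(1,2)] assms(3)
  show False by blast
qed

section \<open>Orthogonal sets for the trace form and the Casimir operator\<close>

definition orthogonal :: "'g set \<Rightarrow> bool"
  where "orthogonal E \<longleftrightarrow> finite E \<and> E \<subseteq> G \<and> (\<forall>e\<in>E. trace_form B e e \<noteq> 0) \<and>
    (\<forall>e\<in>E. \<forall>d\<in>E. e \<noteq> d \<longrightarrow> trace_form B e d = 0)"

lemma orthogonal_coeff:
  assumes "orthogonal E" "e \<in> E"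
  shows "trace_form B (\<Sum>d\<in>E. sp (h d) d) e = h e * trace_form B e e"
proof -
  have E: "finite E" "E \<subseteq> G" "\<And>d. d \<in> E \<Longrightarrow> d \<noteq> e \<Longrightarrow> trace_form B d e = 0"
    using assms by (auto simp: orthogonal_def)
  have "trace_form B (\<Sum>d\<in>E. sp (h d) d) e = (\<Sum>d\<in>E. h d * trace_form B d e)"
    using E(2) assms(2) by (subst trace_form_sum) (auto simp: trace_form_scale G_closed subset_iff)
  also have "\<dots> = (\<Sum>d\<in>E. if d = e then h e * trace_form B e e else 0)"
    using E(3) by (intro sum.cong refl) auto
  finally show ?thesis using E(1) assms(2) by simp
qed

text \<open>Gram-Schmidt without normalisation. Maximality makes every vector orthogonal to
  \<open>E\<close> isotropic, so by polarisation the form vanishes on the orthogonal complement, and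
  the residues fall into the radical.\<close>

lemma maximal_orthogonal_exists:
  assumes nz: "\<exists>x\<in>G. \<exists>y\<in>G. trace_form B x y \<noteq> 0"
  shows "\<exists>E. orthogonal E \<and> E \<noteq> {} \<and> (\<forall>v\<in>G. \<forall>y\<in>G.
    trace_form B (v - (\<Sum>e\<in>E. sp (trace_form B v e / trace_form B e e) e)) y = 0)"
proof -
  obtain D where D: "finite D" "P.independent D" "P.span D = G" by (rule P.fin_dim_basis[OF fin_dim_G])
  have bound: "card E \<le> card D" if E: "orthogonal E" for E
  proof -
    have "P.independent E"
    proof (rule P.independent_if_scalars_zero)
      show "finite E" using E by (simp add: orthogonal_def)
      fix h e assume "(\<Sum>e\<in>E. sp (h e) e) = 0" "e \<in> E"
      moreover from this have "e \<in> G" "trace_form B e e \<noteq> 0" using E by (auto simp: orthogonal_def)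
      ultimately show "h e = 0" using orthogonal_coeff[OF E, of e h] trace_form_0 by simp
    qed
    then show ?thesis using P.independent_span_bound[OF D(1)] D(3) E by (simp add: orthogonal_def)
  qed
  have "orthogonal {}" by (simp add: orthogonal_def)
  then obtain E where E: "orthogonal E" "\<And>E'. orthogonal E' \<Longrightarrow> card E' \<le> card E"
    using ex_has_greatest_nat[of orthogonal "{}" card "Suc (card D)"] bound by (auto simp: less_Suc_eq_le)
  have finE: "finite E" and EG: "E \<subseteq> G" and Enz: "\<And>e. e \<in> E \<Longrightarrow> trace_form B e e \<noteq> 0"
    using E(1) by (auto simp: orthogonal_def)
  define perp where "perp z \<longleftrightarrow> z \<in> G \<and> (\<forall>e\<in>E. trace_form B z e = 0)" for z
  have perp_null: "trace_form B z z = 0" if "perp z" for z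
  proof (rule ccontr)
    assume nz: "trace_form B z z \<noteq> 0"
    then have "z \<notin> E" using that by (auto simp: perp_def)
    moreover have "orthogonal (insert z E)"
      unfolding orthogonal_def
    proof (intro conjI ballI impI)
      show "finite (insert z E)" "insert z E \<subseteq> G" using finE EG that by (auto simp: perp_def)
      show "trace_form B e e \<noteq> 0" if "e \<in> insert z E" for e using that nz Enz by blast
      fix e d assume ed: "e \<in> insert z E" "d \<in> insert z E" "e \<noteq> d"
      then show "trace_form B e d = 0"
        using E(1) that trace_form_commute[of e z] EG by (auto simp: perp_def orthogonal_def)
    qed
    ultimately show False using E(2)[of "insert z E"] finE by simp
  qed
  have perp_perp: "trace_form B z y = 0" if z: "perp z" "perp y" for z y
  proof -
    have zy: "z \<in> G" "y \<in> G" using z by (auto simp: perp_def)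
    have "trace_form B (z + y) e = 0" if "e \<in> E" for e
      using trace_form_add[OF zy, of e] z that EG by (auto simp: perp_def)
    then have "perp (z + y)" using zy by (simp add: perp_def G_closed)
    \<comment> \<open>Polarisation; the factor 2 cancels in characteristic zero.\<close>
    moreover have "trace_form B (z + y) (z + y) = trace_form B z z + 2 * trace_form B z y + trace_form B y y"
    proof -
      have zyG: "z + y \<in> G" using zy by (rule G_closed)
      have "trace_form B z (z + y) = trace_form B z z + trace_form B y z"
        using trace_form_commute[OF zy(1) zyG] trace_form_add[OF zy zy(1)] by simp
      moreover have "trace_form B y (z + y) = trace_form B z y + trace_form B y y"
        using trace_form_commute[OF zy(2) zyG] trace_form_add[OF zy zy(2)] by simp
      ultimately show ?thesis
        using trace_form_add[OF zy zyG] trace_form_commute[OF zy] by simp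
    qed
    ultimately show ?thesis using perp_null z by simp
  qed
  define res where "res v = v - (\<Sum>e\<in>E. sp (trace_form B v e / trace_form B e e) e)" for v
  have sumG: "(\<Sum>e\<in>E. sp (h e) e) \<in> G" for h
    using EG by (intro P.subspace_sum[OF subspace_G] G_closed) auto
  have res: "perp (res v)" if "v \<in> G" for v
    unfolding perp_def res_def using that EG Enz
    by (auto simp: G_closed sumG trace_form_diff orthogonal_coeff[OF E(1)] subset_iff)
  have rad: "trace_form B (res v) y = 0" if "v \<in> G" "y \<in> G" for v y
  proof -
    let ?s = "\<Sum>e\<in>E. sp (trace_form B y e / trace_form B e e) e"
    have pv: "perp (res v)" by (rule res[OF that(1)])
    then have vG: "res v \<in> G" by (simp add: perp_def)
    have "trace_form B (res y + ?s) (res v) = trace_form B (res y) (res v) + trace_form B ?s (res v)"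
      using res[OF that(2)] vG sumG by (intro trace_form_add) (auto simp: perp_def)
    also have "trace_form B (res y) (res v) = 0" by (rule perp_perp[OF res[OF that(2)] pv])
    also have "trace_form B ?s (res v) = 0"
    proof -
      have "trace_form B ?s (res v) = (\<Sum>e\<in>E. trace_form B (sp (trace_form B y e / trace_form B e e) e) (res v))"
        using EG vG by (intro trace_form_sum) (auto simp: G_closed)
      also have "\<dots> = 0"
        using EG vG pv by (intro sum.neutral) (auto simp: trace_form_scale perp_def trace_form_commute[of _ "res v"])
      finally show ?thesis .
    qed
    finally have "trace_form B y (res v) = 0" by (simp add: res_def)
    then show ?thesis using trace_form_commute[OF vG that(2)] by simp
  qed
  moreover have "E \<noteq> {}" using nz rad unfolding res_def by auto
  ultimately show ?thesis using E(1) unfolding res_def by blast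
qed

text \<open>The radical is an ideal by invariance and proper because the form is nonzero, so
  \<open>proper_ideal\<close> applies.\<close>

lemma radical_acts_trivially:
  assumes nz: "\<exists>x\<in>G. \<exists>y\<in>G. trace_form B x y \<noteq> 0"
    and j: "j \<in> G" "\<And>y. y \<in> G \<Longrightarrow> trace_form B j y = 0"
  shows "act u j = 0"
proof -
  define J where "J = {x \<in> G. \<forall>y\<in>G. trace_form B x y = 0}"
  show ?thesis
  proof (rule proper_ideal[of J])
    show "P.subspace J"
      unfolding J_def
      by (rule P.subspaceI) (auto simp: G_closed trace_form_0 trace_form_add trace_form_scale)
    show "J \<subseteq> G" "J \<noteq> G" "j \<in> J" using nz j by (auto simp: J_def)
    fix x i assume x: "x \<in> G" "i \<in> J"
    then have i: "i \<in> G" "\<And>y. y \<in> G \<Longrightarrow> trace_form B i y = 0" by (auto simp: J_def)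
    have 1: "trace_form B (br i x) y = 0" if "y \<in> G" for y
      using trace_form_br[OF i(1) x(1) that] i(2)[OF br_closed[OF that x(1)]] by simp
    \<comment> \<open>\<open>br x i\<close> and \<open>- br i x\<close> may differ, but they act in
      the same way, which is all the form sees.\<close>
    have "trace_form B (br x i) y = - trace_form B (br i x) y" if "y \<in> G" for y
    proof -
      have "trace_form B (br x i) y = trace_form B (- br i x) y"
        unfolding trace_form_def using x(1) i(1) that
        by (intro U.trace_cong) (simp add: act_br act_linear act_scale[of "br i x" _ "-1", simplified] br_closed)
      also have "- br i x = sp (-1) (br i x)" by simp
      finally show ?thesis using trace_form_scale[of "br i x" y "-1"] x(1) i(1) that by (simp add: br_closed)
    qed
    then show "br x i \<in> J \<and> br i x \<in> J" using 1 x i by (simp add: J_def br_closed)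
  qed
qed

text \<open>The usual Casimir element: dividing each \<open>e\<close> by
  \<open>trace_form B e e\<close> turns \<open>E\<close> into its own dual family.\<close>

definition casimir :: "'g set \<Rightarrow> 'u \<Rightarrow> 'u"
  where "casimir E u = (\<Sum>e\<in>E. su (1 / trace_form B e e) (act (act u e) e))"

lemma casimir_linear:
  assumes "E \<subseteq> G"
  shows "Vector_Spaces.linear su su (casimir E)"
  unfolding Vector_Spaces.linear_iff using U.vector_space_axioms assms
  by (auto simp: casimir_def act_linear subset_iff sum.distrib U.scale_right_distrib
      U.scale_sum_right mult.commute intro!: sum.cong)

text \<open>Phrased through \<open>act u e\<close> so that it also carries the vector
  \<open>p\<close> to be lifted, which may lie outside \<open>W\<close>, into
  \<open>W\<close>.\<close>

lemma casimir_closed: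
  assumes "E \<subseteq> G" "U.subspace V" "\<And>e. e \<in> E \<Longrightarrow> act u e \<in> V" "\<And>v e. v \<in> V \<Longrightarrow> e \<in> E \<Longrightarrow> act v e \<in> V"
  shows "casimir E u \<in> V"
  unfolding casimir_def using assms by (intro U.subspace_sum U.subspace_scale) auto

text \<open>Each summand is scaled to contribute \<open>1\<close>. In characteristic zero the
  Casimir operator is therefore not nilpotent on \<open>W\<close> once \<open>E\<close> is
  nonempty.\<close>

lemma trace_casimir:
  assumes "orthogonal E"
  shows "U.trace B (casimir E) = of_nat (card E)"
proof -
  have EG: "E \<subseteq> G" and nz: "\<And>e. e \<in> E \<Longrightarrow> trace_form B e e \<noteq> 0"
    using assms by (auto simp: orthogonal_def)
  have AB: "act (act b e) e \<in> U.span B" if "e \<in> E" "b \<in> B" for b e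
    using act_span_B[OF act_B[OF that(2)]] EG that(1) by blast
  have "U.trace B (casimir E) = (\<Sum>e\<in>E. U.trace B (\<lambda>u. su (1 / trace_form B e e) (act (act u e) e)))"
    unfolding casimir_def[abs_def]
    by (intro U.trace_sum B) (simp add: U.span_scale AB)
  also have "\<dots> = (\<Sum>e\<in>E. 1 / trace_form B e e * trace_form B e e)"
    unfolding trace_form_def
    by (intro sum.cong refl U.trace_scale B) (simp add: AB)
  also have "\<dots> = of_nat (card E)" using nz by simp
  finally show ?thesis .
qed

text \<open>The classical cancellation. Modulo the radical \<open>br e a\<close> expands in
  \<open>E\<close> with coefficients \<open>q d * \<gamma> e d\<close>, where
  \<open>\<gamma>\<close> is antisymmetric by invariance. The radical drops out because it acts by
  zero on every \<open>u\<close>, not only on \<open>W\<close>.\<close>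

lemma casimir_commute:
  assumes E: "orthogonal E" and rad: "\<And>v y. v \<in> G \<Longrightarrow> y \<in> G \<Longrightarrow>
      trace_form B (v - (\<Sum>e\<in>E. sp (trace_form B v e / trace_form B e e) e)) y = 0"
    and nz: "\<exists>x\<in>G. \<exists>y\<in>G. trace_form B x y \<noteq> 0" and a: "a \<in> G"
  shows "act (casimir E u) a = casimir E (act u a)"
proof -
  have EG: "\<And>e. e \<in> E \<Longrightarrow> e \<in> G" using E by (auto simp: orthogonal_def)
  define q where "q e = 1 / trace_form B e e" for e
  define \<gamma> where "\<gamma> e d = trace_form B (br e a) d" for e d
  have act_br_e: "act u (br e a) = (\<Sum>d\<in>E. su (q d * \<gamma> e d) (act u d))" if "e \<in> E" for e u
  proof -
    let ?s = "\<Sum>d\<in>E. sp (trace_form B (br e a) d / trace_form B d d) d"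
    have bG: "br e a \<in> G" using EG[OF that] a by (rule br_closed)
    have sG: "?s \<in> G" using EG by (intro P.subspace_sum[OF subspace_G] G_closed)
    have "act u (br e a - ?s) = 0"
      by (rule radical_acts_trivially[OF nz _ rad[OF bG]]) (simp add: G_closed bG sG)
    then have "act u (br e a) = act u ?s" using bG sG by (simp add: act_diff)
    also have "\<dots> = (\<Sum>d\<in>E. su (q d * \<gamma> e d) (act u d))"
      using EG by (subst act_sum) (auto simp: G_closed act_scale q_def \<gamma>_def)
    finally show ?thesis .
  qed
  have \<gamma>: "\<gamma> e d = - \<gamma> d e" if "e \<in> E" "d \<in> E" for e d
    unfolding \<gamma>_def using trace_form_br[of e a d] trace_form_commute[of e "br d a"] EG that a
    by (simp add: br_closed)
  have *: "act (act (act u e) e) a = act (act (act u a) e) e + (act (act u (br e a)) e + act (act u e) (br e a))"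
    if "e \<in> E" for e
    using EG[OF that] a by (simp add: act_br br_closed act_linear)
  \<comment> \<open>The factor \<open>q e\<close> comes from the Casimir sum and \<open>q d\<close>
    from the expansion of the bracket; together they keep the antisymmetry of
    \<open>\<gamma>\<close>.\<close>
  define t where "t e d = q e * (q d * \<gamma> e d)" for e d
  have t: "t e d + t d e = 0" if "e \<in> E" "d \<in> E" for e d using \<gamma>[OF that] by (simp add: t_def)
  have "act (casimir E u) a - casimir E (act u a)
      = (\<Sum>e\<in>E. su (q e) (act (act u (br e a)) e + act (act u e) (br e a)))"
    unfolding casimir_def using EG a
    by (simp add: act_linear * q_def U.scale_right_distrib sum.distrib sum_subtractf)
  also have "\<dots> = (\<Sum>e\<in>E. \<Sum>d\<in>E. su (t e d) (act (act u d) e) + su (t e d) (act (act u e) d))"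
    using EG by (intro sum.cong refl)
      (simp add: act_br_e act_linear t_def U.scale_right_distrib U.scale_sum_right sum.distrib)
  also have "\<dots> = (\<Sum>e\<in>E. \<Sum>d\<in>E. su (t e d) (act (act u d) e)) + (\<Sum>e\<in>E. \<Sum>d\<in>E. su (t d e) (act (act u d) e))"
    by (simp only: sum.distrib) (subst (3) sum.swap, rule refl)
  also have "\<dots> = (\<Sum>e\<in>E. \<Sum>d\<in>E. su (t e d + t d e) (act (act u d) e))"
    by (simp add: U.scale_left_distrib sum.distrib)
  also have "\<dots> = 0"
    by (intro sum.neutral ballI) (simp add: t)
  finally show ?thesis by simp
qed

end

context simple_action
begin

text \<open>
  Vanishing of the first cohomology of \<open>W\<close>, for the cocycle \<open>x \<mapsto> p x\<close>.  The Casimir operator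
  splits \<open>W\<close> into its Fitting components; on the invertible one the cocycle is a coboundary, and
  the nilpotent one is smaller than \<open>W\<close>.
\<close>

theorem invariant_lift_exists:
  assumes "submod W" "\<And>x. x \<in> G \<Longrightarrow> act p x \<in> W"
  shows "\<exists>w\<in>W. \<forall>x\<in>G. act (p - w) x = 0"
  using assms
proof (induction "U.dim W" arbitrary: W p rule: less_induct)
  case less
  note W = \<open>submod W\<close> and p = \<open>\<And>x. x \<in> G \<Longrightarrow> act p x \<in> W\<close>
  note sW = submod_subspace[OF W]
  have fW: "U.fin_dim W" using W by (simp add: submod_def)
  show ?case
  proof (cases "\<forall>w\<in>W. \<forall>x\<in>G. act w x = 0")
    case True
    then have "\<forall>x\<in>G. act p x = 0" using perfect_kernel[of p] p by blast
    then show ?thesis using U.subspace_0[OF sW] by (intro bexI[of _ 0]) auto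
  next
    case False
    obtain B where B: "finite B" "U.independent B" "U.span B = W" by (rule U.fin_dim_basis[OF fW])
    interpret simple_action_basis sp su G br act W B
      by unfold_locales (fact W B)+
    have nz: "\<exists>x\<in>G. \<exists>y\<in>G. trace_form B x y \<noteq> 0" using False trace_form_nonzero by blast
    then obtain E where E: "orthogonal E" "E \<noteq> {}" "\<And>v y. v \<in> G \<Longrightarrow> y \<in> G \<Longrightarrow>
        trace_form B (v - (\<Sum>e\<in>E. sp (trace_form B v e / trace_form B e e) e)) y = 0"
      using maximal_orthogonal_exists by blast
    have EG: "E \<subseteq> G" and finE: "finite E" using E(1) by (auto simp: orthogonal_def)
    define C where "C = casimir E"
    have linC: "Vector_Spaces.linear su su C" unfolding C_def by (rule casimir_linear[OF EG])
    have C_comm: "act (C u) a = C (act u a)" if "a \<in> G" for u a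
      unfolding C_def by (rule casimir_commute[OF E(1,3) nz that])
    have Cn_comm: "act ((C ^^ n) u) a = (C ^^ n) (act u a)" if "a \<in> G" for n u a
      using that by (induction n) (simp_all add: C_comm)
    have CW: "C w \<in> W" if "\<And>x. x \<in> G \<Longrightarrow> act w x \<in> W" for w
      unfolding C_def using EG that act_W by (intro casimir_closed[OF EG sW]) auto
    have CWW: "C ` W \<subseteq> W" using CW act_W by blast
    have CnW: "(C ^^ n) w \<in> W" if "w \<in> W" for n w
      using CWW that by (induction n) auto
    obtain n where n: "\<And>m. m \<ge> n \<Longrightarrow> (C ^^ m) ` W = (C ^^ n) ` W"
      using U.funpow_image_stable[OF linC fW CWW] by blast
    \<comment> \<open>\<open>C p\<close> lies in \<open>W\<close> even if \<open>p\<close> does not,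
      and the images of the powers of \<open>C\<close> are stable from \<open>n\<close> on. Hence
      \<open>C ^^ Suc n\<close> takes the same value at \<open>p\<close> and at some vector of
      \<open>W\<close>.\<close>
    have "(C ^^ n) (C p) \<in> (C ^^ (Suc n + n)) ` W"
      using n[of "Suc n + n"] CW[OF p] by auto
    then obtain w1 where w1: "w1 \<in> W" "(C ^^ n) (C p) = (C ^^ Suc n) ((C ^^ n) w1)"
      unfolding funpow_add comp_apply by blast
    have Cp: "(C ^^ Suc n) p = (C ^^ Suc n) ((C ^^ n) w1)"
      using w1(2) by (simp only: funpow_Suc_right comp_apply)
    define p' where "p' = p - (C ^^ n) w1"
    interpret Cn: Vector_Spaces.linear su su "C ^^ Suc n" by (rule U.linear_funpow[OF linC])
    have Cp': "(C ^^ Suc n) p' = 0" unfolding p'_def Cn.diff Cp by simp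
    \<comment> \<open>The Fitting null component. The corrected \<open>p'\<close> is killed by
      \<open>C ^^ Suc n\<close>, so its defects \<open>act p' x\<close> fall into \<open>V\<close>,
      where the induction continues.\<close>
    define V where "V = {w \<in> W. (C ^^ Suc n) w = 0}"
    have sV: "U.subspace V"
      unfolding V_def using sW Cn.subspace_kernel by (auto simp: U.subspace_def simp del: funpow.simps)
    have VW: "V \<subseteq> W" by (auto simp: V_def)
    \<comment> \<open>Otherwise \<open>C\<close> would be nilpotent on \<open>W\<close> and have
      trace zero.\<close>
    have "V \<noteq> W"
    proof
      assume "V = W"
      then have "U.trace B C = 0"
        using B CWW U.span_base by (intro U.trace_nilpotent[OF linC, of B "Suc n"]) (auto simp: V_def)
      then show False using trace_casimir[OF E(1)] E(2) finE by (simp add: C_def)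
    qed
    then have "U.dim V < U.dim W" using VW by (intro U.dim_psubset_less[OF fW sV]) blast
    moreover have "submod V"
      unfolding submod_def
    proof (intro conjI ballI)
      show "U.fin_dim V" by (rule U.fin_dim_mono[OF fW sV VW])
      fix w x assume "w \<in> V" "x \<in> G"
      then show "act w x \<in> V"
        using act_W Cn_comm[of x "Suc n" w] act_linear(4)[of x] by (simp add: V_def del: funpow.simps)
    qed
    moreover have "act p' x \<in> V" if "x \<in> G" for x
    proof -
      have "act p' x \<in> W"
        unfolding p'_def using that p act_W CnW[OF w1(1)] by (simp add: act_linear U.subspace_diff[OF sW])
      moreover have "(C ^^ Suc n) (act p' x) = 0"
        using Cn_comm[OF that, of "Suc n" p'] act_linear(4)[OF that] Cp' by simp
      ultimately show ?thesis by (simp only: V_def mem_Collect_eq)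
    qed
    ultimately obtain w0 where w0: "w0 \<in> V" "\<forall>x\<in>G. act (p' - w0) x = 0"
      using less.hyps[of V p'] by blast
    have eq: "p' - w0 = p - ((C ^^ n) w1 + w0)" by (simp add: p'_def)
    have "(C ^^ n) w1 + w0 \<in> W"
      using CnW[OF w1(1)] w0(1) VW by (intro U.subspace_add[OF sW]) auto
    then show ?thesis using w0(2) unfolding eq by blast
  qed
qed

end

section \<open>Simple Leibniz algebras\<close>

lemma ring_of_type_algebra_simps:
  "carrier ring_of_type_algebra = UNIV" "add ring_of_type_algebra = (+)"
  "monoid.mult ring_of_type_algebra = (*)" "one ring_of_type_algebra = 1"
  "ring.zero ring_of_type_algebra = 0"
  by (simp_all add: ring_of_type_algebra_def fun_eq_iff)

locale field_module = module "ring_of_type_algebra :: 'f ring" V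
  for V :: "('f::field, 'v) module" (structure)
begin

lemma scale_closed: "x \<in> carrier V \<Longrightarrow> c \<odot> x \<in> carrier V"
  by (rule smult_closed) (simp_all add: ring_of_type_algebra_simps)

lemma scale_add_left: "x \<in> carrier V \<Longrightarrow> (a + b) \<odot> x = (a \<odot> x) \<oplus> (b \<odot> x)"
  using smult_l_distr[of a b x] by (simp add: ring_of_type_algebra_simps)

lemma scale_add_right: "x \<in> carrier V \<Longrightarrow> y \<in> carrier V \<Longrightarrow> a \<odot> (x \<oplus> y) = (a \<odot> x) \<oplus> (a \<odot> y)"
  using smult_r_distr[of a x y] by (simp add: ring_of_type_algebra_simps)

lemma scale_scale: "x \<in> carrier V \<Longrightarrow> (a * b) \<odot> x = a \<odot> (b \<odot> x)"
  using smult_assoc1[of a b x] by (simp add: ring_of_type_algebra_simps)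

lemma scale_one: "x \<in> carrier V \<Longrightarrow> 1 \<odot> x = x"
  using smult_one[of x] by (simp add: ring_of_type_algebra_simps)

lemma scale_zero_left: "x \<in> carrier V \<Longrightarrow> 0 \<odot> x = \<zero>"
  using smult_l_null[of x] by (simp add: ring_of_type_algebra_simps)

lemma scale_zero_right: "c \<odot> \<zero> = \<zero>"
  using smult_r_null[of c] by (simp add: ring_of_type_algebra_simps)

lemma scale_uminus_one:
  assumes "x \<in> carrier V"
  shows "(- 1) \<odot> x = \<ominus> x"
proof -
  have "((- 1) \<odot> x) \<oplus> x = \<zero>"
    using scale_add_left[OF assms, of "- 1" 1] assms by (simp add: scale_one scale_zero_left)
  then show ?thesis using assms by (metis minus_equality scale_closed)
qed

lemma subspace_ofI:
  assumes "H \<subseteq> carrier V" "\<zero> \<in> H" "\<And>x y. x \<in> H \<Longrightarrow> y \<in> H \<Longrightarrow> x \<oplus> y \<in> H"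
    and "\<And>c x. x \<in> H \<Longrightarrow> c \<odot> x \<in> H"
  shows "subspace_of H V"
proof (rule submoduleI)
  show "\<ominus> a \<in> H" if "a \<in> H" for a
    using assms(4)[OF that, of "- 1"] assms(1) that by (simp add: scale_uminus_one subset_iff)
qed (use assms in auto)

lemma subspace_ofD:
  assumes "subspace_of H V"
  shows "H \<subseteq> carrier V" "\<zero> \<in> H" "x \<in> H \<Longrightarrow> y \<in> H \<Longrightarrow> x \<oplus> y \<in> H"
    "x \<in> H \<Longrightarrow> c \<odot> x \<in> H" "x \<in> H \<Longrightarrow> \<ominus> x \<in> H"
proof -
  note E = submoduleE[OF assms]
  show "H \<subseteq> carrier V" "x \<in> H \<Longrightarrow> y \<in> H \<Longrightarrow> x \<oplus> y \<in> H" "x \<in> H \<Longrightarrow> \<ominus> x \<in> H"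
    using E by auto
  show scale: "x \<in> H \<Longrightarrow> c \<odot> x \<in> H" for x c
    using E(4)[of c x] by (simp add: ring_of_type_algebra_simps)
  obtain z where "z \<in> H" using E(2) by blast
  then show "\<zero> \<in> H" using scale[of z 0] E(1) by (auto simp: scale_zero_left)
qed

lemma subspace_of_diff:
  assumes "subspace_of H V" "x \<in> H" "y \<in> H"
  shows "x \<ominus> y \<in> H"
  unfolding a_minus_def using subspace_ofD[OF assms(1)] assms(2,3) by blast

lemma subspace_of_carrier: "subspace_of (carrier V) V"
  by (rule subspace_ofI) (auto simp: scale_closed)

lemma span_in_superset: "S \<subseteq> span_in V S"
  by (simp add: span_in_def hull_subset)

lemma span_in_minimal: "S \<subseteq> H \<Longrightarrow> subspace_of H V \<Longrightarrow> span_in V S \<subseteq> H"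
  by (simp add: span_in_def hull_minimal)

lemma subspace_of_span_in:
  assumes "S \<subseteq> carrier V"
  shows "subspace_of (span_in V S) V"
proof (rule subspace_ofI)
  show "span_in V S \<subseteq> carrier V" by (rule span_in_minimal[OF assms subspace_of_carrier])
qed (auto simp: span_in_def hull_def intro: subspace_ofD)

text \<open>
  Coordinates of \<open>V\<close> in a function space, for which the library has linear algebra: a linear
  surjection \<open>lam\<close> from functions onto \<open>V\<close>, only depending on the values on a finite set, together
  with a linear section \<open>\<kappa>\<close>.
\<close>

lemma coordinates_exist:
  assumes "finite_dimensional V"
  obtains lam :: "('v \<Rightarrow> 'f) \<Rightarrow> 'v" and \<kappa> :: "'v \<Rightarrow> 'v \<Rightarrow> 'f" and B
  where "finite B" "\<And>v. lam v \<in> carrier V" "\<And>v w. lam (v + w) = lam v \<oplus> lam w"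
    "\<And>k v. lam (\<lambda>b. k * v b) = k \<odot> lam v"
    "\<And>x. x \<in> carrier V \<Longrightarrow> lam (\<kappa> x) = x"
    "\<And>x y. x \<in> carrier V \<Longrightarrow> y \<in> carrier V \<Longrightarrow> \<kappa> (x \<oplus> y) = \<kappa> x + \<kappa> y"
    "\<And>k x. x \<in> carrier V \<Longrightarrow> \<kappa> (k \<odot> x) = (\<lambda>b. k * \<kappa> x b)"
    "\<And>v w. (\<And>b. b \<in> B \<Longrightarrow> v b = w b) \<Longrightarrow> lam v = lam w"
proof -
  obtain B where B: "finite B" "B \<subseteq> carrier V" "span_in V B = carrier V"
    using assms unfolding finite_dimensional_def by blast
  \<comment> \<open>\<open>B\<close> only spans, so \<open>lam\<close> may identify functions that
    differ on \<open>B\<close>; the section \<open>\<kappa>\<close> has to come from a linear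
    complement of its kernel.\<close>
  define lam where "lam v = (\<Oplus>b\<in>B. v b \<odot> b)" for v :: "'v \<Rightarrow> 'f"
  define sc where "sc = (\<lambda>(k::'f) v (i::'v). k * v i)"
  interpret S: linear_space sc unfolding sc_def by (rule linear_space_functions)
  interpret SS: vector_space_pair sc sc by unfold_locales
  have term_closed: "(\<lambda>b. v b \<odot> b) \<in> B \<rightarrow> carrier V" for v :: "'v \<Rightarrow> 'f"
    using B(2) scale_closed by blast
  have lam_closed: "lam v \<in> carrier V" for v
    unfolding lam_def by (rule finsum_closed[OF term_closed])
  have lam_cong: "lam v = lam w" if "\<And>b. b \<in> B \<Longrightarrow> v b = w b" for v w
    unfolding lam_def using that by (intro finsum_cong' refl term_closed) simp
  have lam_add: "lam (v + w) = lam v \<oplus> lam w" for v w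
  proof -
    have "lam (v + w) = (\<Oplus>b\<in>B. (v b \<odot> b) \<oplus> (w b \<odot> b))"
      unfolding lam_def using B(2) scale_closed
      by (intro finsum_cong' refl) (auto simp: scale_add_left)
    also have "\<dots> = lam v \<oplus> lam w"
      unfolding lam_def by (rule finsum_addf[OF term_closed term_closed])
    finally show ?thesis .
  qed
  have lam_scale: "lam (sc k v) = k \<odot> lam v" for k v
  proof -
    have "k \<odot> lam v = (\<Oplus>b\<in>B. k \<odot> (v b \<odot> b))"
      unfolding lam_def
      by (rule finsum_smult_ldistr[OF B(1) _ term_closed]) (simp add: ring_of_type_algebra_simps)
    also have "\<dots> = lam (sc k v)"
      unfolding lam_def sc_def using B(2) scale_closed
      by (intro finsum_cong' refl) (auto simp: scale_scale)
    finally show ?thesis by simp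
  qed
  have lam_unit: "lam (\<lambda>c. if b = c then 1 else 0) = b" if "b \<in> B" for b
  proof -
    have "lam (\<lambda>c. if b = c then 1 else 0) = (\<Oplus>c\<in>B. if b = c then c else \<zero>)"
      unfolding lam_def using B(2)
      by (intro finsum_cong' refl) (auto simp: scale_one scale_zero_left)
    also have "\<dots> = b" using that B by (intro finsum_singleton) auto
    finally show ?thesis .
  qed
  have lam_0: "lam 0 = \<zero>"
  proof -
    have "0 = sc 0 0" by (simp add: sc_def fun_eq_iff)
    then have "lam 0 = lam (sc 0 0)" by (rule arg_cong)
    then show ?thesis using lam_scale[of 0 0] lam_closed by (simp add: scale_zero_left)
  qed
  have "subspace_of (range lam) V"
  proof (rule subspace_ofI)
    show "range lam \<subseteq> carrier V" using lam_closed by blast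
    show "\<zero> \<in> range lam" using lam_0 by (metis rangeI)
    show "x \<oplus> y \<in> range lam" if "x \<in> range lam" "y \<in> range lam" for x y
      using that lam_add by (metis (mono_tags, lifting) imageE rangeI)
    show "c \<odot> x \<in> range lam" if "x \<in> range lam" for c x
      using that lam_scale by (metis (mono_tags, lifting) imageE rangeI)
  qed
  moreover have "B \<subseteq> range lam" using lam_unit by (metis rangeI subsetI)
  ultimately have surj: "carrier V \<subseteq> range lam" using span_in_minimal B(3) by metis
  define Z where "Z = {v. lam v = \<zero>}"
  have "S.subspace Z"
    unfolding Z_def
    by (rule S.subspaceI) (simp_all add: lam_0 lam_add lam_scale scale_zero_right)
  from SS.linear_exists_left_inverse_on[OF S.linear_ident this]
  obtain g where g: "\<And>v. g v \<in> Z" "Vector_Spaces.linear sc sc g" "\<And>v. v \<in> Z \<Longrightarrow> g v = v"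
    by auto
  interpret g: Vector_Spaces.linear sc sc g by (rule g(2))
  \<comment> \<open>The projection along the kernel of \<open>lam\<close>. It depends on
    \<open>lam v\<close> alone, so the arbitrary preimage chosen in \<open>\<kappa>\<close> does no
    harm.\<close>
  define P where "P v = v - g v" for v
  have P_add: "P (v + w) = P v + P w" for v w by (simp add: P_def g.add)
  have P_scale: "P (sc k v) = sc k (P v)" for k v by (simp add: P_def g.scale S.scale_right_diff_distrib)
  have P_cong: "P v = P w" if "lam v = lam w" for v w
  proof -
    have "v - w = v + sc (- 1) w" by (simp add: sc_def fun_eq_iff)
    then have "lam (v - w) = lam (v + sc (- 1) w)" by (rule arg_cong)
    also have "\<dots> = lam v \<oplus> (- 1) \<odot> lam w" by (simp only: lam_add lam_scale)
    finally have "v - w \<in> Z"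
      using lam_closed by (simp add: Z_def that scale_uminus_one r_neg)
    then have "P (v - w) = 0" by (simp add: P_def g(3))
    then show ?thesis using P_add[of "v - w" w] by simp
  qed
  have lam_P: "lam (P v) = lam v" for v
  proof -
    have "lam v = lam (P v) \<oplus> lam (g v)" using lam_add[of "P v" "g v"] by (simp add: P_def)
    then show ?thesis using g(1)[of v] lam_closed by (simp add: Z_def)
  qed
  define \<kappa> where "\<kappa> x = P (SOME v. lam v = x)" for x
  have \<kappa>_lam: "\<kappa> (lam v) = P v" for v
    unfolding \<kappa>_def by (rule P_cong) (rule someI[of "\<lambda>w. lam w = lam v"], rule refl)
  have lam_\<kappa>: "lam (\<kappa> x) = x" if "x \<in> carrier V" for x
    using that surj by (auto simp: \<kappa>_lam lam_P)
  have \<kappa>_add: "\<kappa> (x \<oplus> y) = \<kappa> x + \<kappa> y" if xy: "x \<in> carrier V" "y \<in> carrier V" for x y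
  proof -
    obtain v w where "x = lam v" "y = lam w" using xy surj by blast
    then show ?thesis by (simp add: lam_add[symmetric] \<kappa>_lam P_add)
  qed
  have \<kappa>_scale: "\<kappa> (k \<odot> x) = sc k (\<kappa> x)" if x: "x \<in> carrier V" for k x
  proof -
    obtain v where "x = lam v" using x surj by blast
    then show ?thesis by (simp add: lam_scale[symmetric] \<kappa>_lam P_scale)
  qed
  show ?thesis
    by (rule that[OF B(1) lam_closed lam_add _ lam_\<kappa> \<kappa>_add _ lam_cong])
      (use lam_scale \<kappa>_scale in \<open>auto simp: sc_def\<close>)
qed

end

sublocale bilinear_algebra \<subseteq> field_module L
  by unfold_locales

context bilinear_algebra
begin

lemma mult_zero_left: "y \<in> carrier L \<Longrightarrow> \<zero> \<otimes> y = \<zero>"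
  using mult_smult_left[of \<zero> y 0] by (simp add: scale_zero_left mult_closed)

lemma mult_zero_right: "x \<in> carrier L \<Longrightarrow> x \<otimes> \<zero> = \<zero>"
  using mult_smult_right[of x \<zero> 0] by (simp add: scale_zero_left mult_closed)

lemma mult_minus_left: "x \<in> carrier L \<Longrightarrow> y \<in> carrier L \<Longrightarrow> (\<ominus> x) \<otimes> y = \<ominus> (x \<otimes> y)"
  using mult_smult_left[of x y "- 1"] by (simp add: scale_uminus_one mult_closed)

lemma mult_minus_right: "x \<in> carrier L \<Longrightarrow> y \<in> carrier L \<Longrightarrow> x \<otimes> (\<ominus> y) = \<ominus> (x \<otimes> y)"
  using mult_smult_right[of x y "- 1"] by (simp add: scale_uminus_one mult_closed)

lemma subspace_of_squares_ideal: "subspace_of (squares_ideal L) L"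
  unfolding squares_ideal_def by (rule subspace_of_span_in) (auto simp: mult_closed)

lemma square_in_squares_ideal: "x \<in> carrier L \<Longrightarrow> x \<otimes> x \<in> squares_ideal L"
  unfolding squares_ideal_def by (rule subsetD[OF span_in_superset]) blast

lemma subspace_of_derived_algebra: "subspace_of (derived_algebra L) L"
  unfolding derived_algebra_def by (rule subspace_of_span_in) (auto simp: mult_closed)

lemma mult_in_derived_algebra: "x \<in> carrier L \<Longrightarrow> y \<in> carrier L \<Longrightarrow> x \<otimes> y \<in> derived_algebra L"
  unfolding derived_algebra_def by (rule subsetD[OF span_in_superset]) blast

lemma derived_algebra_minimal:
  assumes "subspace_of H L" "\<And>x y. x \<in> carrier L \<Longrightarrow> y \<in> carrier L \<Longrightarrow> x \<otimes> y \<in> H"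
  shows "derived_algebra L \<subseteq> H"
  unfolding derived_algebra_def by (rule span_in_minimal) (use assms in auto)

lemma algebra_ideal_derived_algebra: "algebra_ideal L (derived_algebra L)"
  unfolding algebra_ideal_def
  using subspace_of_derived_algebra subspace_ofD(1)[OF subspace_of_derived_algebra] mult_in_derived_algebra
  by blast

end

context leibniz_algebra
begin

text \<open>\<open>[x, [y, y]]\<close> is \<open>[[x, y], y] - [[x, y], y]\<close>, and the elements
  killed by left multiplication with \<open>x\<close> form a subspace.\<close>

lemma mult_squares_ideal:
  assumes "x \<in> carrier L" "m \<in> squares_ideal L"
  shows "x \<otimes> m = \<zero>"
proof -
  have "subspace_of {m \<in> carrier L. x \<otimes> m = \<zero>} L"
    using assms(1)
    by (intro subspace_ofI)
      (auto simp: mult_zero_right mult_add_right mult_smult_right scale_zero_right scale_closed)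
  moreover have "{y \<otimes> y |y. y \<in> carrier L} \<subseteq> {m \<in> carrier L. x \<otimes> m = \<zero>}"
    using assms(1) by (auto simp: mult_closed leibniz r_neg a_minus_def)
  ultimately have "squares_ideal L \<subseteq> {m \<in> carrier L. x \<otimes> m = \<zero>}"
    unfolding squares_ideal_def by (rule span_in_minimal[rotated])
  then show ?thesis using assms(2) by blast
qed

lemma squares_ideal_closed: "m \<in> squares_ideal L \<Longrightarrow> m \<in> carrier L"
  using subspace_ofD(1)[OF subspace_of_squares_ideal] by blast

text \<open>\<open>[m, x] = (m + x)\<^sup>2 - m\<^sup>2 - x\<^sup>2\<close> since \<open>[x, m] = 0\<close>.\<close>

lemma squares_ideal_mult:
  assumes m: "m \<in> squares_ideal L" and x: "x \<in> carrier L"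
  shows "m \<otimes> x \<in> squares_ideal L"
proof -
  note S = subspace_of_squares_ideal and mL = squares_ideal_closed[OF m]
  have "(m \<oplus> x) \<otimes> (m \<oplus> x) = (m \<otimes> x) \<oplus> (x \<otimes> x)"
    using mL x by (simp add: mult_add_left mult_add_right mult_closed mult_squares_ideal m)
  then have "m \<otimes> x = ((m \<oplus> x) \<otimes> (m \<oplus> x)) \<ominus> (x \<otimes> x)"
    using mL x by (simp add: mult_closed a_minus_def a_assoc r_neg)
  moreover have "((m \<oplus> x) \<otimes> (m \<oplus> x)) \<ominus> (x \<otimes> x) \<in> squares_ideal L"
    using mL x by (intro subspace_of_diff[OF S] square_in_squares_ideal) auto
  ultimately show ?thesis by simp
qed

lemma algebra_ideal_squares_ideal: "algebra_ideal L (squares_ideal L)"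
  unfolding algebra_ideal_def
  using subspace_of_squares_ideal mult_squares_ideal squares_ideal_mult
    subspace_ofD(2)[OF subspace_of_squares_ideal] by simp

end

locale simple_leibniz = leibniz_algebra L for L :: "('f::field, 'l) module" (structure) +
  assumes ideals: "algebra_ideal L J \<Longrightarrow> J = {\<zero>} \<or> J = squares_ideal L \<or> J = carrier L"
    and derived_neq: "derived_algebra L \<noteq> squares_ideal L"
begin

text \<open>The derived algebra is an ideal containing all squares; were it zero, the ideal of
  squares would be zero too and the two would agree.\<close>

lemma derived_algebra_eq_carrier: "derived_algebra L = carrier L"
proof -
  have "derived_algebra L \<noteq> {\<zero>}"
  proof
    assume D: "derived_algebra L = {\<zero>}"
    have "squares_ideal L \<subseteq> derived_algebra L"
      unfolding squares_ideal_def
      by (rule span_in_minimal[OF _ subspace_of_derived_algebra]) (auto intro: mult_in_derived_algebra)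
    then have "squares_ideal L = {\<zero>}"
      using D subspace_ofD(2)[OF subspace_of_squares_ideal] by blast
    with D derived_neq show False by simp
  qed
  then show ?thesis using ideals[OF algebra_ideal_derived_algebra] derived_neq by blast
qed

lemma squares_ideal_neq_carrier: "squares_ideal L \<noteq> carrier L"
  using derived_neq derived_algebra_eq_carrier by simp

lemma perfect_subspace:
  assumes "subspace_of H L" "\<And>x y. x \<in> carrier L \<Longrightarrow> y \<in> carrier L \<Longrightarrow> x \<otimes> y \<in> H"
  shows "H = carrier L"
  using derived_algebra_minimal[OF assms] subspace_ofD(1)[OF assms(1)] derived_algebra_eq_carrier by blast

text \<open>Right multiplication by a proper ideal is therefore zero, which supplies
  \<open>proper_ideal\<close> of the abstract action.\<close>

lemma proper_ideal_subset:
  assumes "algebra_ideal L J" "J \<noteq> carrier L"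
  shows "J \<subseteq> squares_ideal L"
  using ideals[OF assms(1)] assms(2) subspace_ofD(2)[OF subspace_of_squares_ideal] by blast

end

lemma simple_leibniz_iff: "simple_leibniz_algebra L \<longleftrightarrow> simple_leibniz L"
  unfolding simple_leibniz_algebra_def simple_leibniz_def simple_leibniz_axioms_def by blast

text \<open>
  Since \<open>[L, I] = 0\<close>, right multiplication makes \<open>L\<close> a right module over \<open>L/I\<close>, with the
  submodule \<open>I\<close>.  A projection onto \<open>I\<close> is corrected by a linear map \<open>L/I \<rightarrow> I\<close> to a module
  homomorphism, by the vanishing of the cohomology of \<open>Hom(L/I, I)\<close>.
\<close>

lemma equivariant_projection_exists:
  fixes L :: "('f::field_char_0, 'l) module" (structure)
  assumes simple: "simple_leibniz_algebra L" and fd: "finite_dimensional L"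
  shows "\<exists>\<pi>. (\<forall>x\<in>carrier L. \<pi> x \<in> squares_ideal L) \<and> (\<forall>m\<in>squares_ideal L. \<pi> m = m) \<and>
    (\<forall>x\<in>carrier L. \<forall>y\<in>carrier L. \<pi> (x \<oplus> y) = \<pi> x \<oplus> \<pi> y) \<and>
    (\<forall>c. \<forall>x\<in>carrier L. \<pi> (c \<odot> x) = c \<odot> \<pi> x) \<and>
    (\<forall>x\<in>carrier L. \<forall>y\<in>carrier L. \<pi> (x \<otimes> y) = \<pi> x \<otimes> y)"
proof -
  interpret simple_leibniz L using simple by (simp add: simple_leibniz_iff)
  define I where "I = squares_ideal L"
  note sI = subspace_of_squares_ideal[folded I_def]
  note II = subspace_ofD[OF sI]
  obtain lam :: "('l \<Rightarrow> 'f) \<Rightarrow> 'l" and \<kappa> :: "'l \<Rightarrow> 'l \<Rightarrow> 'f" and B where B: "finite B"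
    and lam_closed: "\<And>v. lam v \<in> carrier L"
    and lam_add: "\<And>v w. lam (v + w) = lam v \<oplus> lam w"
    and lam_scale': "\<And>k v. lam (\<lambda>b. k * v b) = k \<odot> lam v"
    and lam_\<kappa>: "\<And>x. x \<in> carrier L \<Longrightarrow> lam (\<kappa> x) = x"
    and \<kappa>_add: "\<And>x y. x \<in> carrier L \<Longrightarrow> y \<in> carrier L \<Longrightarrow> \<kappa> (x \<oplus> y) = \<kappa> x + \<kappa> y"
    and \<kappa>_scale': "\<And>k x. x \<in> carrier L \<Longrightarrow> \<kappa> (k \<odot> x) = (\<lambda>b. k * \<kappa> x b)"
    and lam_cong: "\<And>v w. (\<And>b. b \<in> B \<Longrightarrow> v b = w b) \<Longrightarrow> lam v = lam w"
    by (rule coordinates_exist[OF fd]) blast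
  define sc where "sc = (\<lambda>(k::'f) v (i::'l). k * v i)"
  define su where "su = (\<lambda>(k::'f) Z (i::'l) (j::'l). k * Z i j)"
  have sc_apply: "sc k v b = k * v b" for k v b by (simp add: sc_def)
  interpret V: linear_space sc unfolding sc_def by (rule linear_space_functions)
  interpret VV: vector_space_pair sc sc by unfold_locales
  interpret U: linear_space su unfolding su_def by (rule linear_space_matrices)
  have su_apply: "su k Z b = sc k (Z b)" for k Z b by (simp add: su_def sc_def)
  have lam_scale: "lam (sc k v) = k \<odot> lam v" for k v unfolding sc_def by (rule lam_scale')
  have \<kappa>_scale: "\<kappa> (k \<odot> x) = sc k (\<kappa> x)" if "x \<in> carrier L" for k x
    unfolding sc_def by (rule \<kappa>_scale'[OF that])
  have lam_0: "lam 0 = \<zero>"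
    using lam_scale[of 0 0] lam_closed by (simp add: scale_zero_left)
  have \<kappa>_0: "\<kappa> \<zero> = 0"
    using \<kappa>_scale[of \<zero> 0] by (simp add: scale_zero_left)
  have \<kappa>_minus: "\<kappa> (x \<ominus> y) = \<kappa> x - \<kappa> y" if "x \<in> carrier L" "y \<in> carrier L" for x y
  proof -
    have "\<kappa> (x \<ominus> y) + \<kappa> y = \<kappa> ((x \<ominus> y) \<oplus> y)" using that by (simp add: \<kappa>_add)
    also have "(x \<ominus> y) \<oplus> y = x" using that by (simp add: a_minus_def a_assoc l_neg)
    finally show ?thesis by (simp only: eq_diff_eq)
  qed
  have lam_eqI: "lam v = lam w" if "\<And>b. b \<in> B \<Longrightarrow> v b = w b" for v w using that by (rule lam_cong)
  define unit where "unit b = (\<lambda>c. if b = c then 1 else (0::'f))" for b :: 'l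
  \<comment> \<open>The projection of all functions onto the coordinate copy of
    \<open>L\<close>.\<close>
  define P where "P v = \<kappa> (lam v)" for v
  have P_add: "P (v + w) = P v + P w" for v w by (simp add: P_def lam_add \<kappa>_add lam_closed)
  have P_scale: "P (sc k v) = sc k (P v)" for k v by (simp add: P_def lam_scale \<kappa>_scale lam_closed)
  have linP: "Vector_Spaces.linear sc sc P"
    unfolding Vector_Spaces.linear_iff using V.vector_space_axioms by (simp add: P_add P_scale)
  interpret P: Vector_Spaces.linear sc sc P by (rule linP)
  have expand: "P v = (\<Sum>b\<in>B. sc (v b) (P (unit b)))" for v
  proof -
    have "lam v = lam (\<Sum>b\<in>B. sc (v b) (unit b))"
      using B by (intro lam_eqI) (simp add: sum_fun_apply sc_def unit_def if_distrib cong: if_cong)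
    then have "P v = P (\<Sum>b\<in>B. sc (v b) (unit b))" by (simp add: P_def)
    then show ?thesis by (simp add: P.sum P.scale)
  qed
  \<comment> \<open>A copy of \<open>L\<close> rather than of \<open>L/I\<close>: elements of
    \<open>I\<close> act by zero, which the abstract action tolerates.\<close>
  define G where "G = \<kappa> ` carrier L"
  have G_iff: "v \<in> G \<longleftrightarrow> P v = v" for v
  proof
    show "P v = v" if "v \<in> G" using that by (auto simp: G_def P_def lam_\<kappa>)
    show "v \<in> G" if "P v = v"
    proof -
      have "P v \<in> G" unfolding G_def P_def by (intro imageI lam_closed)
      then show ?thesis by (simp only: that)
    qed
  qed
  have \<kappa>_G: "\<kappa> x \<in> G" if "x \<in> carrier L" for x using that by (simp add: G_def)
  define \<rho> where "\<rho> x v = \<kappa> (lam v \<otimes> lam x)" for x v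
  have \<rho>_add: "\<rho> x (v + w) = \<rho> x v + \<rho> x w" and \<rho>_scale: "\<rho> x (sc k v) = sc k (\<rho> x v)" for x v w k
    by (simp_all add: \<rho>_def lam_add lam_scale lam_closed mult_add_left mult_smult_left mult_closed \<kappa>_add \<kappa>_scale)
  have \<rho>_add': "\<rho> (x + y) v = \<rho> x v + \<rho> y v" and \<rho>_scale': "\<rho> (sc k x) v = sc k (\<rho> x v)" for x y v k
    by (simp_all add: \<rho>_def lam_add lam_scale lam_closed mult_add_right mult_smult_right mult_closed \<kappa>_add \<kappa>_scale)
  have lin\<rho>: "Vector_Spaces.linear sc sc (\<rho> x)" for x
    unfolding Vector_Spaces.linear_iff using V.vector_space_axioms by (simp add: \<rho>_add \<rho>_scale)
  have \<rho>_diff: "\<rho> x (v - w) = \<rho> x v - \<rho> x w" for x v w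
  proof -
    interpret R: Vector_Spaces.linear sc sc "\<rho> x" by (rule lin\<rho>)
    show ?thesis by (rule R.diff)
  qed
  have \<rho>_0: "\<rho> x 0 = 0" for x using \<rho>_diff[of x 0 0] by simp
  have \<rho>_sum: "\<rho> x (\<Sum>i\<in>A. h i) = (\<Sum>i\<in>A. \<rho> x (h i))" for x A and h :: "'l \<Rightarrow> 'l \<Rightarrow> 'f"
  proof -
    interpret R: Vector_Spaces.linear sc sc "\<rho> x" by (rule lin\<rho>)
    show ?thesis by (rule R.sum)
  qed
  have \<rho>_P: "\<rho> x (P v) = \<rho> x v" for x v by (simp add: \<rho>_def P_def lam_\<kappa> lam_closed)
  have P_\<rho>: "P (\<rho> x v) = \<rho> x v" for x v by (simp add: \<rho>_def P_def lam_\<kappa> lam_closed mult_closed)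
  have \<rho>_\<kappa>: "\<rho> (\<kappa> a) (\<kappa> x) = \<kappa> (x \<otimes> a)" if "x \<in> carrier L" "a \<in> carrier L" for x a
    using that by (simp add: \<rho>_def lam_\<kappa>)
  define br where "br x y = \<rho> y x" for x y
  have \<rho>_br: "\<rho> (br x y) v = \<rho> y (\<rho> x v) - \<rho> x (\<rho> y v)" for x y v
    by (simp add: br_def \<rho>_def lam_\<kappa> mult_closed lam_closed leibniz \<kappa>_minus)
  \<comment> \<open>\<open>u\<close> stores a linear map by its values on the unit vectors for
    \<open>B\<close>; \<open>ext u\<close> is the map itself.\<close>
  define ext where "ext u v = (\<Sum>b\<in>B. sc (v b) (u b))" for u :: "'l \<Rightarrow> 'l \<Rightarrow> 'f" and v
  have ext_add: "ext u (v + w) = ext u v + ext u w"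
    and ext_scale: "ext u (sc k v) = sc k (ext u v)" for u v w k
    by (simp_all add: ext_def V.scale_left_distrib sum.distrib V.scale_sum_right sc_apply)
  have ext_diff: "ext u (v - w) = ext u v - ext u w" for u v w
    using ext_add[of u "v - w" w] by simp
  have ext_add': "ext (u + u') v = ext u v + ext u' v"
    and ext_diff': "ext (u - u') v = ext u v - ext u' v"
    and ext_scale': "ext (su k u) v = sc k (ext u v)" for u u' v k
    by (simp_all add: ext_def fun_eq_iff sum_fun_apply sc_def su_def algebra_simps sum.distrib
        sum_subtractf sum_distrib_left)
  have ext_0: "ext 0 v = 0" for v by (simp add: ext_def fun_eq_iff sum_fun_apply sc_def)
  \<comment> \<open>The action on linear maps: the commutator of right multiplication by
    \<open>x\<close> with the map stored in \<open>u\<close>.\<close>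
  define act where "act u x = (\<lambda>b. \<rho> x (u b) - ext u (\<rho> x (unit b)))" for u x
  have ext_act: "ext (act u x) v = \<rho> x (ext u v) - ext u (\<rho> x v)" for u x v
  proof -
    have "ext (act u x) v = (\<Sum>b\<in>B. sc (v b) (\<rho> x (u b))) - (\<Sum>b\<in>B. sc (v b) (ext u (\<rho> x (unit b))))"
      unfolding ext_def[of "act u x" v] by (simp add: act_def V.scale_right_diff_distrib sum_subtractf)
    moreover have "(\<Sum>b\<in>B. sc (v b) (\<rho> x (u b))) = \<rho> x (ext u v)"
      by (simp add: ext_def \<rho>_sum \<rho>_scale)
    moreover have "(\<Sum>b\<in>B. sc (v b) (ext u (\<rho> x (unit b)))) = ext u (\<rho> x v)"
    proof -
      interpret E: Vector_Spaces.linear sc sc "ext u"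
        unfolding Vector_Spaces.linear_iff using V.vector_space_axioms by (simp add: ext_add ext_scale)
      have "\<rho> x v = \<rho> x (\<Sum>b\<in>B. sc (v b) (P (unit b)))" unfolding expand[of v, symmetric] \<rho>_P ..
      also have "\<dots> = (\<Sum>b\<in>B. sc (v b) (\<rho> x (unit b)))" by (simp add: \<rho>_sum \<rho>_scale \<rho>_P)
      finally show ?thesis by (simp add: E.sum E.scale)
    qed
    ultimately show ?thesis by simp
  qed
  have pull: "subspace_of {l \<in> carrier L. \<kappa> l \<in> J} L" if "V.subspace J" for J
    using that
    by (intro subspace_ofI)
      (auto simp: \<kappa>_0 \<kappa>_add \<kappa>_scale scale_closed V.subspace_0 V.subspace_add V.subspace_scale)
  interpret A: simple_action sc su G br act
  proof (intro simple_action.intro simple_action_axioms.intro)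
    show "linear_space sc" "linear_space su" by unfold_locales
    have "V.subspace G"
      by (rule V.subspaceI) (simp_all add: G_iff P_add P_scale P.zero)
    moreover have "G \<subseteq> V.span ((\<lambda>b. P (unit b)) ` B)"
    proof
      fix v assume "v \<in> G"
      then have "v = (\<Sum>b\<in>B. sc (v b) (P (unit b)))" using expand[of v] by (simp add: G_iff)
      moreover have "(\<Sum>b\<in>B. sc (h b) (P (unit b))) \<in> V.span ((\<lambda>b. P (unit b)) ` B)" for h
        by (intro V.span_sum V.span_scale V.span_base) simp
      ultimately show "v \<in> V.span ((\<lambda>b. P (unit b)) ` B)" by metis
    qed
    ultimately show "V.fin_dim G" unfolding V.fin_dim_def using B by blast
    show "br x y \<in> G" for x y by (simp add: br_def \<rho>_def \<kappa>_G mult_closed lam_closed)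
    show "Vector_Spaces.linear su su (\<lambda>u. act u x)" for x
      unfolding Vector_Spaces.linear_iff using U.vector_space_axioms
      by (simp add: act_def fun_eq_iff \<rho>_add ext_add' ext_scale')
        (simp add: su_def \<rho>_scale[unfolded sc_def] sc_def algebra_simps)
    show "act u (x + y) = act u x + act u y" for u x y
      by (simp add: act_def fun_eq_iff \<rho>_add' ext_add)
    show "act u (sc k x) = su k (act u x)" for u k x
      by (simp add: act_def fun_eq_iff \<rho>_scale' ext_scale su_def) (simp add: sc_def algebra_simps)
    show "act u (br x y) = act (act u x) y - act (act u y) x" for u x y
      unfolding act_def[of "act u x"] act_def[of "act u y"] ext_act
      by (simp add: act_def \<rho>_br ext_diff \<rho>_diff fun_eq_iff)
    show "J = G" if J: "V.subspace J" "J \<subseteq> G" "\<And>x y. x \<in> G \<Longrightarrow> y \<in> G \<Longrightarrow> br x y \<in> J" for J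
    proof -
      have "{l \<in> carrier L. \<kappa> l \<in> J} = carrier L"
        using J(3)[OF \<kappa>_G \<kappa>_G] by (intro perfect_subspace[OF pull[OF J(1)]]) (simp add: mult_closed br_def \<rho>_\<kappa>)
      then show ?thesis using J(2) by (auto simp: G_def)
    qed
    \<comment> \<open>A proper ideal of the copy pulls back to an ideal inside \<open>I\<close>, and
      right multiplication by \<open>I\<close> is zero.\<close>
    show "act u j = 0" if J: "V.subspace J" "J \<subseteq> G" "J \<noteq> G"
      "\<And>x j. x \<in> G \<Longrightarrow> j \<in> J \<Longrightarrow> br x j \<in> J \<and> br j x \<in> J" "j \<in> J" for J j u
    proof -
      let ?J = "{l \<in> carrier L. \<kappa> l \<in> J}"
      have "algebra_ideal L ?J"
      proof -
        have "\<kappa> (x \<otimes> l) \<in> J \<and> \<kappa> (l \<otimes> x) \<in> J"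
          if "x \<in> carrier L" "l \<in> carrier L" "\<kappa> l \<in> J" for x l
          using J(4)[OF \<kappa>_G that(3), of x] that by (simp add: br_def \<rho>_\<kappa>)
        then show ?thesis
          unfolding algebra_ideal_def using pull[OF J(1)] by (simp add: mult_closed)
      qed
      moreover have "?J \<noteq> carrier L" using J(2,3) by (auto simp: G_def)
      ultimately have "?J \<subseteq> squares_ideal L" by (rule proper_ideal_subset)
      moreover have "lam j \<in> ?J"
        using J(2,5) lam_closed G_iff[of j] by (auto simp: P_def)
      ultimately have *: "\<rho> j v = 0" for v
        unfolding \<rho>_def using mult_squares_ideal[OF lam_closed] \<kappa>_0 by auto
      have "act u j b = 0" for b using ext_diff[of u 0 0] by (simp add: act_def *)
      then show ?thesis by (intro HOL.ext) simp
    qed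
  qed
  define KI where "KI = \<kappa> ` I"
  have KI_iff: "v \<in> KI \<longleftrightarrow> v \<in> G \<and> lam v \<in> I" for v
    unfolding KI_def G_def using II(1) lam_\<kappa> by (auto simp: image_iff subset_iff) 
  have sKI: "V.subspace KI"
    using V.fin_dim_subspace[OF A.fin_dim_G]
    by (intro V.subspaceI) (auto simp: KI_iff lam_0 lam_add lam_scale II V.subspace_0 V.subspace_add V.subspace_scale)
  have \<rho>_KI: "\<rho> x v \<in> KI" if "v \<in> KI" for x v
    using that squares_ideal_mult[of "lam v" "lam x"] lam_closed
    by (simp add: KI_iff G_iff P_\<rho>) (simp add: \<rho>_def lam_\<kappa> mult_closed lam_closed I_def)
  have ext_KI: "ext u v \<in> KI" if "\<And>b. u b \<in> KI" for u v
    unfolding ext_def using that by (intro V.subspace_sum[OF sKI] V.subspace_scale[OF sKI])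
  \<comment> \<open>Hom(L/I, I), seen as maps into \<open>I\<close> that vanish on \<open>I\<close>;
    fixing the entries outside \<open>B\<close> to zero keeps the space finite-dimensional.\<close>
  define W where "W = {u. (\<forall>b. u b \<in> KI) \<and> (\<forall>m\<in>KI. ext u m = 0) \<and> (\<forall>b. b \<notin> B \<longrightarrow> u b = 0)}"
  have \<rho>_unit: "\<rho> x (unit b) = 0" if "b \<notin> B" for x b
  proof -
    have "lam (unit b) = lam 0" using that by (intro lam_eqI) (auto simp: unit_def)
    then show ?thesis by (simp add: \<rho>_def lam_0 mult_zero_left lam_closed \<kappa>_0)
  qed
  have ext_0': "ext u 0 = 0" for u using ext_diff[of u 0 0] by simp
  \<comment> \<open>A finite family whose span contains \<open>W\<close>: each value
    \<open>u b\<close> lies in the image of \<open>P\<close>, hence expands in the vectors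
    \<open>P (unit d)\<close>.\<close>
  define E where "E b d = (\<lambda>c. if c = b then P (unit d) else 0)" for b d :: 'l
  have W: "A.submod W"
    unfolding A.submod_def
  proof (intro conjI ballI)
    have "U.subspace W"
    proof (rule U.subspaceI)
      show "0 \<in> W" using V.subspace_0[OF sKI] by (simp add: W_def ext_0)
      show "u + u' \<in> W" if "u \<in> W" "u' \<in> W" for u u'
        using that V.subspace_add[OF sKI] by (simp add: W_def ext_add')
      show "su k u \<in> W" if "u \<in> W" for k u
      proof -
        have "su k u b = sc k (u b)" for b by (simp add: su_def sc_def)
        then show ?thesis using that V.subspace_scale[OF sKI] by (simp add: W_def ext_scale')
      qed
    qed
    moreover have "W \<subseteq> U.span {E b d |b d. b \<in> B \<and> d \<in> B}"
    proof
      fix u assume u: "u \<in> W"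
      have "u c = (\<Sum>b\<in>B. \<Sum>d\<in>B. su (u b d) (E b d)) c" for c
      proof -
        have "(\<Sum>b\<in>B. \<Sum>d\<in>B. su (u b d) (E b d)) c
            = (\<Sum>b\<in>B. if b = c then \<Sum>d\<in>B. sc (u c d) (P (unit d)) else 0)"
          unfolding sum_fun_apply[where x = c]
          by (intro sum.cong refl) (simp add: sum_fun_apply[where x = c] su_apply E_def)
        also have "\<dots> = (if c \<in> B then P (u c) else 0)" using B expand[of "u c"] by simp
        also have "\<dots> = u c" using u by (auto simp: W_def KI_iff G_iff)
        finally show ?thesis by simp
      qed
      then have eq: "u = (\<Sum>b\<in>B. \<Sum>d\<in>B. su (u b d) (E b d))" by (rule HOL.ext)
      show "u \<in> U.span {E b d |b d. b \<in> B \<and> d \<in> B}"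
        by (subst eq) (intro U.span_sum U.span_scale U.span_base, blast)
    qed
    moreover have "{E b d |b d. b \<in> B \<and> d \<in> B} = (\<lambda>(b, d). E b d) ` (B \<times> B)" by auto
    then have "finite {E b d |b d. b \<in> B \<and> d \<in> B}" using B by simp
    ultimately show "U.fin_dim W" unfolding U.fin_dim_def by blast
    fix u x assume u: "u \<in> W"
    then have uKI: "\<And>b. u b \<in> KI" and u0: "\<And>m. m \<in> KI \<Longrightarrow> ext u m = 0" and uB: "\<And>b. b \<notin> B \<Longrightarrow> u b = 0"
      by (auto simp: W_def)
    have "act u x b \<in> KI" for b
      unfolding act_def using \<rho>_KI[OF uKI] ext_KI[OF uKI] by (rule V.subspace_diff[OF sKI])
    moreover have "ext (act u x) m = 0" if "m \<in> KI" for m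
      using u0[OF that] u0[OF \<rho>_KI[OF that]] by (simp add: ext_act \<rho>_0)
    moreover have "act u x b = 0" if "b \<notin> B" for b
      using that by (simp add: act_def uB \<rho>_0 \<rho>_unit ext_0')
    ultimately show "act u x \<in> W" by (simp add: W_def)
  qed
  obtain Q where Q: "\<And>v. Q v \<in> KI" "Vector_Spaces.linear sc sc Q" "\<And>v. v \<in> KI \<Longrightarrow> Q v = v"
    using VV.linear_exists_left_inverse_on[OF V.linear_ident sKI] by auto
  interpret Q: Vector_Spaces.linear sc sc Q by (rule Q(2))
  \<comment> \<open>Any linear projection onto the copy of \<open>I\<close>, not yet
    equivariant.\<close>
  define p where "p b = (if b \<in> B then Q (P (unit b)) else 0)" for b
  have pKI: "p b \<in> KI" for b using Q(1) V.subspace_0[OF sKI] by (simp add: p_def)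
  have ext_p: "ext p v = Q (P v)" for v
    by (subst expand) (simp add: ext_def p_def Q.sum Q.scale)
  have ext_p_KI: "ext p m = m" if "m \<in> KI" for m
    using that Q(3) by (simp add: ext_p KI_iff G_iff)
  \<comment> \<open>On \<open>KI\<close> the map \<open>p\<close> is the identity and so commutes
    with \<open>\<rho> x\<close>; its defect vanishes there.\<close>
  have "act p x \<in> W" for x
  proof -
    have "act p x b \<in> KI" for b
      unfolding act_def using \<rho>_KI[OF pKI] ext_KI[OF pKI] by (rule V.subspace_diff[OF sKI])
    moreover have "ext (act p x) m = 0" if "m \<in> KI" for m
      using ext_p_KI[OF that] ext_p_KI[OF \<rho>_KI[OF that]] by (simp add: ext_act)
    moreover have "act p x b = 0" if "b \<notin> B" for b
      using that by (simp add: act_def p_def \<rho>_0 \<rho>_unit ext_0')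
    ultimately show ?thesis by (simp add: W_def)
  qed
  then obtain w where w: "w \<in> W" "\<And>x. x \<in> G \<Longrightarrow> act (p - w) x = 0"
    using A.invariant_lift_exists[OF W, of p] by blast
  \<comment> \<open>Subtracting \<open>w\<close> makes the map equivariant and, as \<open>w\<close>
    vanishes on \<open>KI\<close>, keeps it a projection.\<close>
  define q where "q = p - w"
  have qKI: "q b \<in> KI" for b
    using pKI w(1) V.subspace_diff[OF sKI] by (simp add: q_def W_def)
  have q_comm: "ext q (\<rho> x v) = \<rho> x (ext q v)" if "x \<in> G" for x v
    using ext_act[of q x v] w(2)[OF that] by (simp add: q_def ext_0)
  define \<pi> where "\<pi> l = lam (ext q (\<kappa> l))" for l
  have \<pi>I: "\<pi> l \<in> I" for l using ext_KI[OF qKI] by (simp add: \<pi>_def KI_iff)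
  show ?thesis
    unfolding I_def[symmetric]
  proof (intro exI[of _ \<pi>] conjI ballI allI \<pi>I)
    show "\<pi> m = m" if "m \<in> I" for m
    proof -
      have m: "\<kappa> m \<in> KI" using that by (simp add: KI_def)
      then have "ext q (\<kappa> m) = \<kappa> m" using w(1) by (simp add: q_def ext_diff' ext_p_KI W_def)
      then show ?thesis using that II(1) lam_\<kappa> by (auto simp: \<pi>_def)
    qed
    show "\<pi> (x \<oplus> y) = \<pi> x \<oplus> \<pi> y" if "x \<in> carrier L" "y \<in> carrier L" for x y
      using that by (simp add: \<pi>_def \<kappa>_add ext_add lam_add)
    show "\<pi> (c \<odot> x) = c \<odot> \<pi> x" if "x \<in> carrier L" for c x
      using that by (simp add: \<pi>_def \<kappa>_scale ext_scale lam_scale)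
    show "\<pi> (x \<otimes> y) = \<pi> x \<otimes> y" if "x \<in> carrier L" "y \<in> carrier L" for x y
    proof -
      have "\<pi> (x \<otimes> y) = lam (ext q (\<rho> (\<kappa> y) (\<kappa> x)))" using that by (simp add: \<pi>_def \<rho>_\<kappa>)
      also have "\<dots> = lam (\<rho> (\<kappa> y) (ext q (\<kappa> x)))" using that by (simp add: q_comm \<kappa>_G)
      also have "\<dots> = \<pi> x \<otimes> y" using that by (simp add: \<rho>_def \<pi>_def lam_\<kappa> lam_closed mult_closed)
      finally show ?thesis .
    qed
  qed
qed

section \<open>Quotients and the isomorphism\<close>

context bilinear_algebra
begin

text \<open>Every law of \<open>K\<close> is pulled back along \<open>h\<close>, which settles the
  quotient and the direct sum alike.\<close>

lemma surjective_image:
  fixes K :: "('f, 'k) module"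
  assumes surj: "h ` carrier L = carrier K"
    and add: "\<And>x y. x \<in> carrier L \<Longrightarrow> y \<in> carrier L \<Longrightarrow> h (x \<oplus> y) = h x \<oplus>\<^bsub>K\<^esub> h y"
    and scale: "\<And>c x. x \<in> carrier L \<Longrightarrow> h (c \<odot> x) = c \<odot>\<^bsub>K\<^esub> h x"
    and mult: "\<And>x y. x \<in> carrier L \<Longrightarrow> y \<in> carrier L \<Longrightarrow> h (x \<otimes> y) = h x \<otimes>\<^bsub>K\<^esub> h y"
    and zero: "h \<zero> = \<zero>\<^bsub>K\<^esub>"
  shows "bilinear_algebra K"
proof -
  have pre: "\<exists>x\<in>carrier L. u = h x" if "u \<in> carrier K" for u using that surj by auto
  have closed: "h x \<in> carrier K" if "x \<in> carrier L" for x using that surj by auto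
  note hom = add[symmetric] scale[symmetric] mult[symmetric]
  have "abelian_group K"
  proof (rule abelian_groupI)
    fix u assume "u \<in> carrier K"
    then obtain x where x: "x \<in> carrier L" "u = h x" using pre by blast
    show "\<exists>v\<in>carrier K. v \<oplus>\<^bsub>K\<^esub> u = \<zero>\<^bsub>K\<^esub>"
      using x by (intro bexI[of _ "h (\<ominus> x)"]) (auto simp: hom l_neg zero closed)
    show "\<zero>\<^bsub>K\<^esub> \<oplus>\<^bsub>K\<^esub> u = u" using x by (simp add: zero[symmetric] hom)
    fix v assume "v \<in> carrier K"
    then obtain y where y: "y \<in> carrier L" "v = h y" using pre by blast
    show "u \<oplus>\<^bsub>K\<^esub> v \<in> carrier K" "u \<oplus>\<^bsub>K\<^esub> v = v \<oplus>\<^bsub>K\<^esub> u"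
      using x y by (simp_all add: hom closed a_comm)
    fix w assume "w \<in> carrier K"
    then obtain z where z: "z \<in> carrier L" "w = h z" using pre by blast
    show "u \<oplus>\<^bsub>K\<^esub> v \<oplus>\<^bsub>K\<^esub> w = u \<oplus>\<^bsub>K\<^esub> (v \<oplus>\<^bsub>K\<^esub> w)"
      using x y z by (simp add: hom a_assoc)
  qed (use closed[of \<zero>] zero in simp)
  moreover have "module (ring_of_type_algebra :: 'f ring) K"
  proof (rule moduleI[OF cring_from_type_algebra \<open>abelian_group K\<close>])
    fix a b :: 'f and u assume "u \<in> carrier K"
    then obtain x where x: "x \<in> carrier L" "u = h x" using pre by blast
    show "a \<odot>\<^bsub>K\<^esub> u \<in> carrier K" using x by (simp add: hom closed scale_closed)
    show "(a \<oplus>\<^bsub>ring_of_type_algebra\<^esub> b) \<odot>\<^bsub>K\<^esub> u = a \<odot>\<^bsub>K\<^esub> u \<oplus>\<^bsub>K\<^esub> b \<odot>\<^bsub>K\<^esub> u"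
      using x by (simp add: hom scale_closed scale_add_left ring_of_type_algebra_simps)
    show "(a \<otimes>\<^bsub>ring_of_type_algebra\<^esub> b) \<odot>\<^bsub>K\<^esub> u = a \<odot>\<^bsub>K\<^esub> (b \<odot>\<^bsub>K\<^esub> u)"
      using x by (simp add: hom scale_closed scale_scale ring_of_type_algebra_simps)
    show "\<one>\<^bsub>ring_of_type_algebra\<^esub> \<odot>\<^bsub>K\<^esub> u = u"
      using x by (simp add: hom scale_one ring_of_type_algebra_simps)
    fix v assume "v \<in> carrier K"
    then obtain y where y: "y \<in> carrier L" "v = h y" using pre by blast
    show "a \<odot>\<^bsub>K\<^esub> (u \<oplus>\<^bsub>K\<^esub> v) = a \<odot>\<^bsub>K\<^esub> u \<oplus>\<^bsub>K\<^esub> a \<odot>\<^bsub>K\<^esub> v"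
      using x y by (simp add: hom scale_closed scale_add_right)
  qed
  moreover have "bilinear_algebra_axioms K"
  proof
    fix u v assume "u \<in> carrier K" "v \<in> carrier K"
    then obtain x y where xy: "x \<in> carrier L" "u = h x" "y \<in> carrier L" "v = h y" using pre by metis
    show "u \<otimes>\<^bsub>K\<^esub> v \<in> carrier K" using xy by (simp add: hom closed mult_closed)
    show "(c \<odot>\<^bsub>K\<^esub> u) \<otimes>\<^bsub>K\<^esub> v = c \<odot>\<^bsub>K\<^esub> (u \<otimes>\<^bsub>K\<^esub> v)" for c
      using xy by (simp add: hom scale_closed mult_closed mult_smult_left)
    show "u \<otimes>\<^bsub>K\<^esub> (c \<odot>\<^bsub>K\<^esub> v) = c \<odot>\<^bsub>K\<^esub> (u \<otimes>\<^bsub>K\<^esub> v)" for c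
      using xy by (simp add: hom scale_closed mult_closed mult_smult_right)
    fix w assume "w \<in> carrier K"
    then obtain z where z: "z \<in> carrier L" "w = h z" using pre by blast
    show "(u \<oplus>\<^bsub>K\<^esub> v) \<otimes>\<^bsub>K\<^esub> w = u \<otimes>\<^bsub>K\<^esub> w \<oplus>\<^bsub>K\<^esub> v \<otimes>\<^bsub>K\<^esub> w"
      using xy z by (simp add: hom mult_closed mult_add_left)
    show "u \<otimes>\<^bsub>K\<^esub> (v \<oplus>\<^bsub>K\<^esub> w) = u \<otimes>\<^bsub>K\<^esub> v \<oplus>\<^bsub>K\<^esub> u \<otimes>\<^bsub>K\<^esub> w"
      using xy z by (simp add: hom mult_closed mult_add_right)
  qed
  ultimately show ?thesis by (intro bilinear_algebra.intro)
qed

end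

context leibniz_algebra
begin

text \<open>Used for the coset map and for the isomorphism itself; in the second case it replaces a
  direct verification of the Leibniz identity on \<open>G + M\<close>.\<close>

lemma leibniz_surjective_image:
  fixes K :: "('b, 'k) module"
  assumes surj: "h ` carrier L = carrier K"
    and add: "\<And>x y. x \<in> carrier L \<Longrightarrow> y \<in> carrier L \<Longrightarrow> h (x \<oplus> y) = h x \<oplus>\<^bsub>K\<^esub> h y"
    and scale: "\<And>c x. x \<in> carrier L \<Longrightarrow> h (c \<odot> x) = c \<odot>\<^bsub>K\<^esub> h x"
    and mult: "\<And>x y. x \<in> carrier L \<Longrightarrow> y \<in> carrier L \<Longrightarrow> h (x \<otimes> y) = h x \<otimes>\<^bsub>K\<^esub> h y"
    and zero: "h \<zero> = \<zero>\<^bsub>K\<^esub>"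
  shows "leibniz_algebra K"
proof -
  interpret K: bilinear_algebra K by (rule surjective_image[OF assms])
  have closed: "h x \<in> carrier K" if "x \<in> carrier L" for x using that surj by auto
  have h_minus: "h (x \<ominus> y) = h x \<ominus>\<^bsub>K\<^esub> h y" if "x \<in> carrier L" "y \<in> carrier L" for x y
  proof -
    have "h (\<ominus> y) = \<ominus>\<^bsub>K\<^esub> h y"
      using scale[of y "- 1"] that(2) by (simp add: scale_uminus_one K.scale_uminus_one closed)
    then show ?thesis using that add[of x "\<ominus> y"] by (simp add: a_minus_def)
  qed
  show ?thesis
  proof
    fix u v w assume uvw: "u \<in> carrier K" "v \<in> carrier K" "w \<in> carrier K"
    have pre: "\<exists>x\<in>carrier L. t = h x" if "t \<in> carrier K" for t using that surj by auto
    obtain x y z where "x \<in> carrier L" "u = h x" "y \<in> carrier L" "v = h y" "z \<in> carrier L" "w = h z"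
      using pre[OF uvw(1)] pre[OF uvw(2)] pre[OF uvw(3)] by blast
    then show "u \<otimes>\<^bsub>K\<^esub> (v \<otimes>\<^bsub>K\<^esub> w) = (u \<otimes>\<^bsub>K\<^esub> v \<otimes>\<^bsub>K\<^esub> w) \<ominus>\<^bsub>K\<^esub> (u \<otimes>\<^bsub>K\<^esub> w \<otimes>\<^bsub>K\<^esub> v)"
      by (simp add: mult[symmetric] mult_closed h_minus[symmetric] leibniz)
  qed
qed

text \<open>Squaring a sum gives antisymmetry, which rewrites the right Leibniz identity as the
  Jacobi identity.\<close>

lemma lie_algebra_if_alternating:
  assumes alt: "\<And>x. x \<in> carrier L \<Longrightarrow> x \<otimes> x = \<zero>"
  shows "lie_algebra L"
proof
  show "x \<otimes> x = \<zero>" if "x \<in> carrier L" for x using that by (rule alt)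
  have anti: "y \<otimes> x = \<ominus> (x \<otimes> y)" if "x \<in> carrier L" "y \<in> carrier L" for x y
  proof -
    have "(y \<otimes> x) \<oplus> (x \<otimes> y) = \<zero>"
      using alt[of "x \<oplus> y"] alt[of x] alt[of y] that
      by (simp add: mult_add_left mult_add_right mult_closed)
    then show ?thesis using that by (simp add: minus_equality[symmetric] mult_closed)
  qed
  fix x y z assume xyz: "x \<in> carrier L" "y \<in> carrier L" "z \<in> carrier L"
  have "y \<otimes> (z \<otimes> x) = (x \<otimes> z) \<otimes> y"
    using xyz anti[of "z \<otimes> x" y] anti[of x z] by (simp add: mult_closed mult_minus_left)
  moreover have "z \<otimes> (x \<otimes> y) = \<ominus> ((x \<otimes> y) \<otimes> z)"
    using xyz anti[of "x \<otimes> y" z] by (simp add: mult_closed)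
  ultimately show "x \<otimes> (y \<otimes> z) \<oplus> y \<otimes> (z \<otimes> x) \<oplus> z \<otimes> (x \<otimes> y) = \<zero>"
    using xyz by (simp add: leibniz mult_closed a_minus_def a_assoc l_neg r_neg)
qed

end

section \<open>Cosets and quotient algebras\<close>

context bilinear_algebra
begin

lemma mem_coset_iff:
  assumes "subspace_of J L" "a \<in> carrier L"
  shows "x \<in> J +> a \<longleftrightarrow> x \<in> carrier L \<and> x \<ominus> a \<in> J"
proof
  assume "x \<in> J +> a"
  then obtain j where "j \<in> J" "x = j \<oplus> a" by (auto simp: a_r_coset_def')
  then show "x \<in> carrier L \<and> x \<ominus> a \<in> J"
    using subspace_ofD(1)[OF assms(1)] assms(2) by (auto simp: a_minus_def a_assoc r_neg)
next
  assume x: "x \<in> carrier L \<and> x \<ominus> a \<in> J"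
  then have "x = (x \<ominus> a) \<oplus> a" using assms(2) by (simp add: a_minus_def a_assoc l_neg)
  then show "x \<in> J +> a" using x unfolding a_r_coset_def' by blast
qed

lemma coset_eq_iff:
  assumes J: "subspace_of J L" and ab: "a \<in> carrier L" "b \<in> carrier L"
  shows "J +> a = J +> b \<longleftrightarrow> a \<ominus> b \<in> J"
proof
  assume "J +> a = J +> b"
  moreover have "a \<in> J +> a"
    using mem_coset_iff[OF J ab(1)] ab subspace_ofD(2)[OF J] by (simp add: a_minus_def r_neg)
  ultimately show "a \<ominus> b \<in> J" using mem_coset_iff[OF J ab(2)] by blast
next
  assume *: "a \<ominus> b \<in> J"
  have trans: "x \<ominus> c = (x \<ominus> d) \<oplus> (d \<ominus> c)"
    if "x \<in> carrier L" "c \<in> carrier L" "d \<in> carrier L" for x c d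
    using that by (simp add: a_minus_def a_assoc r_neg1)
  have "b \<ominus> a = \<ominus> (a \<ominus> b)" using ab by (simp add: a_minus_def minus_add a_comm)
  then have **: "b \<ominus> a \<in> J" using subspace_ofD(5)[OF J *] by simp
  have "x \<ominus> a \<in> J \<longleftrightarrow> x \<ominus> b \<in> J" if "x \<in> carrier L" for x
  proof
    assume "x \<ominus> a \<in> J"
    from subspace_ofD(3)[OF J this *] show "x \<ominus> b \<in> J"
      unfolding trans[OF that ab(2,1), symmetric] .
  next
    assume "x \<ominus> b \<in> J"
    from subspace_ofD(3)[OF J this **] show "x \<ominus> a \<in> J"
      unfolding trans[OF that ab, symmetric] .
  qed
  then show "J +> a = J +> b"
    using mem_coset_iff[OF J ab(1)] mem_coset_iff[OF J ab(2)] by blast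
qed

context
  fixes J assumes J: "algebra_ideal L J"
begin

lemma ideal_subspace: "subspace_of J L"
  using J by (simp add: algebra_ideal_def)

lemma quotient_carrier: "carrier (quotient_algebra L J) = (\<lambda>a. J +> a) ` carrier L"
  by (auto simp: quotient_algebra_def ring.defs FactRing_def A_RCOSETS_def' )

lemma quotient_zero: "\<zero>\<^bsub>quotient_algebra L J\<^esub> = J +> \<zero>"
  using subspace_ofD(1)[OF ideal_subspace]
  by (force simp: quotient_algebra_def ring.defs FactRing_def a_r_coset_def')

lemma quotient_add:
  assumes "a \<in> carrier L" "b \<in> carrier L"
  shows "(J +> a) \<oplus>\<^bsub>quotient_algebra L J\<^esub> (J +> b) = J +> (a \<oplus> b)"
proof -
  have "abelian_group L" by unfold_locales
  then interpret S: abelian_subgroup J L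
    using ideal_subspace by (intro abelian_subgroupI3 additive_subgroup.intro submodule.axioms(1))
  show ?thesis using S.a_rcos_sum[OF assms] by (simp add: quotient_algebra_def ring.defs FactRing_def)
qed

text \<open>The scalar multiplication of the quotient is a union over representatives; it is a
  single coset once the result does not depend on them.\<close>

lemma coset_Union:
  assumes "\<And>x. x \<in> J +> a \<Longrightarrow> J +> f x = J +> f a" "a \<in> carrier L"
  shows "(\<Union>x\<in>J +> a. J +> f x) = J +> f a"
proof -
  have "a \<in> J +> a"
    using mem_coset_iff[OF ideal_subspace assms(2)] assms(2) subspace_ofD(2)[OF ideal_subspace]
    by (simp add: a_minus_def r_neg)
  then show ?thesis using assms(1) by blast
qed

lemma quotient_scale:
  assumes "a \<in> carrier L"
  shows "c \<odot>\<^bsub>quotient_algebra L J\<^esub> (J +> a) = J +> (c \<odot> a)"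
proof -
  note S = ideal_subspace
  have "J +> (c \<odot> x) = J +> (c \<odot> a)" if "x \<in> J +> a" for x
  proof -
    have x: "x \<in> carrier L" "x \<ominus> a \<in> J" using that mem_coset_iff[OF S assms] by auto
    have "(c \<odot> x) \<ominus> (c \<odot> a) = c \<odot> (x \<ominus> a)"
      using x(1) assms
      by (simp add: a_minus_def scale_add_right scale_uminus_one[symmetric] scale_closed scale_scale[symmetric])
    then show ?thesis
      using subspace_ofD(4)[OF S x(2)] x(1) assms by (simp add: coset_eq_iff[OF S] scale_closed)
  qed
  then show ?thesis
    using coset_Union[OF _ assms] by (simp add: quotient_algebra_def ring.defs module.defs FactRing_def)
qed

lemma quotient_mult:
  assumes "a \<in> carrier L" "b \<in> carrier L"
  shows "(J +> a) \<otimes>\<^bsub>quotient_algebra L J\<^esub> (J +> b) = J +> (a \<otimes> b)"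
proof -
  note S = ideal_subspace
  have "J +> (x \<otimes> y) = J +> (a \<otimes> b)" if "x \<in> J +> a" "y \<in> J +> b" for x y
  proof -
    have x: "x \<in> carrier L" "x \<ominus> a \<in> J" and y: "y \<in> carrier L" "y \<ominus> b \<in> J"
      using that mem_coset_iff[OF S assms(1)] mem_coset_iff[OF S assms(2)] by auto
    \<comment> \<open>Both terms on the right lie in \<open>J\<close> because the ideal is
      two-sided.\<close>
    have "(x \<otimes> y) \<ominus> (a \<otimes> b) = ((x \<ominus> a) \<otimes> y) \<oplus> (a \<otimes> (y \<ominus> b))"
      using x(1) y(1) assms
      by (simp add: a_minus_def mult_add_left mult_add_right mult_minus_left mult_minus_right mult_closed
          a_assoc r_neg1 r_neg2 l_neg r_neg)
    also have "\<dots> \<in> J"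
      using J x y assms subspace_ofD(3)[OF S] by (simp add: algebra_ideal_def)
    finally show ?thesis using x(1) y(1) assms by (simp add: coset_eq_iff[OF S] mult_closed)
  qed
  moreover have "a \<in> J +> a" "b \<in> J +> b"
    using mem_coset_iff[OF S] assms subspace_ofD(2)[OF S] by (simp_all add: a_minus_def r_neg)
  ultimately have "(\<Union>x\<in>J +> a. \<Union>y\<in>J +> b. J +> (x \<otimes> y)) = J +> (a \<otimes> b)" by blast
  then show ?thesis by (simp add: quotient_algebra_def ring.defs FactRing_def rcoset_mult_def)
qed

end

end

theorem theorem3p1:
  fixes L :: "('f::field_char_0, 'l) module"
    and I :: "'l set"
    and G :: "('f, 'l set) module"
    and M :: "('f, 'l) module"
    and act :: "'l \<Rightarrow> 'l set \<Rightarrow> 'l"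
  assumes "simple_leibniz_algebra L"
    and "finite_dimensional L"
    and "I = squares_ideal L"
    and "G = quotient_algebra L I"
    and "M = L\<lparr>carrier := I\<rparr>"
    and "act = coset_action L"
  shows "simple_lie_algebra G
    \<and> (\<forall>m\<in>I. \<forall>a\<in>carrier L. act m (I +>\<^bsub>L\<^esub> a) = m \<otimes>\<^bsub>L\<^esub> a)
    \<and> right_lie_module G M act
    \<and> (irreducible_lie_module G M act \<or> (lie_algebra L \<and> carrier M = {\<zero>\<^bsub>M\<^esub>}))
    \<and> leibniz_isomorphic L (hemisemidirect_sum G M act)"
proof -
  interpret simple_leibniz L using assms(1) by (simp add: simple_leibniz_iff)
  note I_def = assms(3)
  have idI: "algebra_ideal L I" unfolding I_def by (rule algebra_ideal_squares_ideal)
  have sI: "subspace_of I L" by (rule ideal_subspace[OF idI])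
  note II = subspace_ofD[OF sI]
  have I_carrier: "m \<in> carrier L" if "m \<in> I" for m using that II(1) by blast
  have mult_I: "x \<otimes>\<^bsub>L\<^esub> m = \<zero>\<^bsub>L\<^esub>" if "x \<in> carrier L" "m \<in> I" for x m
    using that mult_squares_ideal by (simp add: I_def)
  have I_mult: "m \<otimes>\<^bsub>L\<^esub> x \<in> I" if "m \<in> I" "x \<in> carrier L" for x m
    using that squares_ideal_mult by (simp add: I_def)
  define q where "q a = I +>\<^bsub>L\<^esub> a" for a
  have Gq: "carrier G = q ` carrier L"
    "\<And>a b. a \<in> carrier L \<Longrightarrow> b \<in> carrier L \<Longrightarrow> q (a \<oplus>\<^bsub>L\<^esub> b) = q a \<oplus>\<^bsub>G\<^esub> q b"
    "\<And>c a. a \<in> carrier L \<Longrightarrow> q (c \<odot>\<^bsub>L\<^esub> a) = c \<odot>\<^bsub>G\<^esub> q a"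
    "\<And>a b. a \<in> carrier L \<Longrightarrow> b \<in> carrier L \<Longrightarrow> q (a \<otimes>\<^bsub>L\<^esub> b) = q a \<otimes>\<^bsub>G\<^esub> q b"
    "q \<zero>\<^bsub>L\<^esub> = \<zero>\<^bsub>G\<^esub>"
    unfolding assms(4) q_def
    by (simp_all add: quotient_carrier[OF idI] quotient_add[OF idI] quotient_scale[OF idI]
        quotient_mult[OF idI] quotient_zero[OF idI])
  have q_eq: "q a = q b \<longleftrightarrow> a \<ominus>\<^bsub>L\<^esub> b \<in> I" if "a \<in> carrier L" "b \<in> carrier L" for a b
    unfolding q_def by (rule coset_eq_iff[OF sI that])
  have q_zero: "q a = \<zero>\<^bsub>G\<^esub> \<longleftrightarrow> a \<in> I" if "a \<in> carrier L" for a
  proof -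
    have minus_zero: "\<ominus>\<^bsub>L\<^esub> \<zero>\<^bsub>L\<^esub> = \<zero>\<^bsub>L\<^esub>" using scale_uminus_one[of "\<zero>\<^bsub>L\<^esub>"] by (simp add: scale_zero_right)
    show ?thesis using q_eq[OF that zero_closed] that by (simp add: Gq(5) a_minus_def minus_zero)
  qed
  have qG: "q a \<in> carrier G" if "a \<in> carrier L" for a using that Gq(1) by blast
  interpret G: leibniz_algebra G
    by (rule leibniz_surjective_image[of q]) (use Gq in auto)
  have lieG: "lie_algebra G"
  proof (rule G.lie_algebra_if_alternating)
    fix u assume "u \<in> carrier G"
    then obtain a where a: "a \<in> carrier L" "u = q a" using Gq(1) by blast
    have "q (a \<otimes>\<^bsub>L\<^esub> a) = \<zero>\<^bsub>G\<^esub>"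
      using a q_zero square_in_squares_ideal by (simp add: mult_closed I_def)
    then show "u \<otimes>\<^bsub>G\<^esub> u = \<zero>\<^bsub>G\<^esub>" using a by (simp add: Gq(4))
  qed
  have simpleG: "simple_lie_algebra G"
    unfolding simple_lie_algebra_def
  proof (intro conjI allI impI lieG)
    fix J assume J: "algebra_ideal G J"
    note sJ = G.subspace_ofD[OF G.ideal_subspace[OF J]]
    \<comment> \<open>The preimage of \<open>J\<close> in \<open>L\<close>, where simplicity can be
      applied.\<close>
    define J' where "J' = {a \<in> carrier L. q a \<in> J}"
    have "algebra_ideal L J'"
      unfolding algebra_ideal_def
    proof (intro conjI ballI)
      show "subspace_of J' L"
        by (rule subspace_ofI) (auto simp: J'_def Gq scale_closed sJ)
      show "x \<otimes>\<^bsub>L\<^esub> j \<in> J'" "j \<otimes>\<^bsub>L\<^esub> x \<in> J'" if "x \<in> carrier L" "j \<in> J'" for x j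
        using that J qG[of x] by (simp_all add: J'_def Gq(4) mult_closed algebra_ideal_def)
    qed
    then consider "J' = carrier L" | "J' \<subseteq> I" using proper_ideal_subset I_def by blast
    then show "J = {\<zero>\<^bsub>G\<^esub>} \<or> J = carrier G"
    proof cases
      case 1
      then have "carrier G \<subseteq> J" using Gq(1) by (auto simp: J'_def)
      then show ?thesis using sJ(1) by blast
    next
      case 2
      have "u = \<zero>\<^bsub>G\<^esub>" if u: "u \<in> J" for u
      proof -
        obtain a where a: "a \<in> carrier L" "u = q a" using u sJ(1) Gq(1) by blast
        then have "a \<in> I" using u 2 by (auto simp: J'_def)
        then show ?thesis using a q_zero by simp
      qed
      then show ?thesis using sJ(2) by blast
    qed
  next
    show "derived_algebra G \<noteq> {\<zero>\<^bsub>G\<^esub>}"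
    proof
      assume D: "derived_algebra G = {\<zero>\<^bsub>G\<^esub>}"
      have "I = carrier L"
      proof (rule perfect_subspace[OF sI])
        fix x y assume xy: "x \<in> carrier L" "y \<in> carrier L"
        have "q (x \<otimes>\<^bsub>L\<^esub> y) \<in> derived_algebra G"
          using xy G.mult_in_derived_algebra[OF qG qG] by (simp add: Gq(4))
        then show "x \<otimes>\<^bsub>L\<^esub> y \<in> I" using D q_zero xy by (simp add: mult_closed)
      qed
      then show False using squares_ideal_neq_carrier I_def by simp
    qed
  qed
  have act_q: "act m (q a) = m \<otimes>\<^bsub>L\<^esub> a" if "m \<in> I" "a \<in> carrier L" for m a
  proof -
    \<comment> \<open>The representative chosen by \<open>coset_action\<close>. It differs from
      \<open>a\<close> by an element of \<open>I\<close>, and left multiplication by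
      \<open>m\<close> sends that element to zero.\<close>
    define b where "b = (SOME b. b \<in> q a)"
    have "a \<in> q a"
      using mem_coset_iff[OF sI that(2), of a] that(2) II(2) by (simp add: q_def a_minus_def r_neg)
    then have "b \<in> q a" unfolding b_def by (rule someI[of "\<lambda>b. b \<in> q a"])
    then have b: "b \<in> carrier L" "b \<ominus>\<^bsub>L\<^esub> a \<in> I"
      using mem_coset_iff[OF sI that(2), of b] by (auto simp: q_def)
    have "b = (b \<ominus>\<^bsub>L\<^esub> a) \<oplus>\<^bsub>L\<^esub> a" using b(1) that(2) by (simp add: a_minus_def a_assoc l_neg)
    then have "m \<otimes>\<^bsub>L\<^esub> b = m \<otimes>\<^bsub>L\<^esub> ((b \<ominus>\<^bsub>L\<^esub> a) \<oplus>\<^bsub>L\<^esub> a)" by (rule arg_cong)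
    also have "\<dots> = m \<otimes>\<^bsub>L\<^esub> a"
      using I_carrier[OF that(1)] that(2) b by (simp add: mult_add_right mult_I mult_closed I_carrier)
    finally show ?thesis by (simp add: assms(6) coset_action_def b_def)
  qed
  have M_simps: "carrier M = I" "add M = add L" "\<zero>\<^bsub>M\<^esub> = \<zero>\<^bsub>L\<^esub>" "module.smult M = module.smult L"
    by (simp_all add: assms(5))
  have modM: "module (ring_of_type_algebra :: 'f ring) M"
    unfolding assms(5) by (rule submodule.submodule_is_module[OF sI]) unfold_locales
  interpret M: field_module M by (rule field_module.intro[OF modM])
  have M_minus: "m \<ominus>\<^bsub>M\<^esub> n = m \<ominus>\<^bsub>L\<^esub> n" if "m \<in> I" "n \<in> I" for m n
    using that M.scale_uminus_one[of n] scale_uminus_one[of n] I_carrier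
    by (simp add: a_minus_def M_simps)
  have rep: "\<exists>a\<in>carrier L. u = q a" if "u \<in> carrier G" for u using that Gq(1) by blast
  have rlm: "right_lie_module G M act"
  proof (rule right_lie_module.intro[OF lieG modM], unfold_locales)
    fix m u assume mu: "m \<in> carrier M" "u \<in> carrier G"
    then obtain a where a: "a \<in> carrier L" "u = q a" using rep by blast
    have m: "m \<in> I" "m \<in> carrier L" using mu I_carrier by (auto simp: M_simps)
    show "act m u \<in> carrier M" using a m by (simp add: act_q I_mult M_simps)
    show "act (c \<odot>\<^bsub>M\<^esub> m) u = c \<odot>\<^bsub>M\<^esub> act m u" for c
      using a m II(4) by (simp add: act_q M_simps mult_smult_left)
    show "act m (c \<odot>\<^bsub>G\<^esub> u) = c \<odot>\<^bsub>M\<^esub> act m u" for c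
      using a m by (simp add: act_q M_simps mult_smult_right Gq(3)[symmetric] scale_closed)
    show "act (m \<oplus>\<^bsub>M\<^esub> n) u = act m u \<oplus>\<^bsub>M\<^esub> act n u" if "n \<in> carrier M" for n
      using a m that II(3) I_carrier by (simp add: act_q M_simps mult_add_left)
    fix v assume "v \<in> carrier G"
    then obtain b where b: "b \<in> carrier L" "v = q b" using rep by blast
    show "act m (u \<oplus>\<^bsub>G\<^esub> v) = act m u \<oplus>\<^bsub>M\<^esub> act m v"
      using a b m by (simp add: act_q M_simps mult_add_right Gq(2)[symmetric])
    show "act m (u \<otimes>\<^bsub>G\<^esub> v) = act (act m u) v \<ominus>\<^bsub>M\<^esub> act (act m v) u"
      using a b m by (simp add: act_q M_minus I_mult leibniz Gq(4)[symmetric] mult_closed)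
  qed
  have irr: "irreducible_lie_module G M act \<or> (lie_algebra L \<and> carrier M = {\<zero>\<^bsub>M\<^esub>})"
  proof (cases "I = {\<zero>\<^bsub>L\<^esub>}")
    case True
    have "lie_algebra L"
      using square_in_squares_ideal True I_def by (intro lie_algebra_if_alternating) auto
    then show ?thesis using True by (simp add: M_simps)
  next
    case False
    have "N = {\<zero>\<^bsub>M\<^esub>} \<or> N = carrier M" if N: "lie_submodule G M act N" for N
    proof -
      have sN: "subspace_of N M" and actN: "\<And>n u. n \<in> N \<Longrightarrow> u \<in> carrier G \<Longrightarrow> act n u \<in> N"
        using N by (auto simp: lie_submodule_def)
      note NN = M.subspace_ofD[OF sN, unfolded M_simps]
      \<comment> \<open>Stability under left multiplication comes from \<open>[L, I] = 0\<close>, so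
        a submodule of \<open>I\<close> is an ideal of \<open>L\<close> and simplicity
        applies.\<close>
      have "algebra_ideal L N"
        unfolding algebra_ideal_def
      proof (intro conjI ballI)
        show "subspace_of N L" using NN I_carrier by (intro subspace_ofI) auto
        fix x n assume xn: "x \<in> carrier L" "n \<in> N"
        then have nI: "n \<in> I" using NN(1) by blast
        show "x \<otimes>\<^bsub>L\<^esub> n \<in> N" using mult_I[OF xn(1) nI] NN(2) by simp
        show "n \<otimes>\<^bsub>L\<^esub> x \<in> N" using actN[OF xn(2) qG[OF xn(1)]] act_q[OF nI xn(1)] by simp
      qed
      then have "N = {\<zero>\<^bsub>L\<^esub>} \<or> N = I \<or> N = carrier L" unfolding I_def by (rule ideals)
      then show ?thesis using NN(1) II(1) by (auto simp: M_simps)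
    qed
    then show ?thesis using rlm False by (simp add: irreducible_lie_module_def M_simps)
  qed
  obtain \<pi> where \<pi>I: "\<And>x. x \<in> carrier L \<Longrightarrow> \<pi> x \<in> I" and \<pi>_id: "\<And>m. m \<in> I \<Longrightarrow> \<pi> m = m"
    and \<pi>_add: "\<And>x y. x \<in> carrier L \<Longrightarrow> y \<in> carrier L \<Longrightarrow> \<pi> (x \<oplus>\<^bsub>L\<^esub> y) = \<pi> x \<oplus>\<^bsub>L\<^esub> \<pi> y"
    and \<pi>_scale: "\<And>c x. x \<in> carrier L \<Longrightarrow> \<pi> (c \<odot>\<^bsub>L\<^esub> x) = c \<odot>\<^bsub>L\<^esub> \<pi> x"
    and \<pi>_mult: "\<And>x y. x \<in> carrier L \<Longrightarrow> y \<in> carrier L \<Longrightarrow> \<pi> (x \<otimes>\<^bsub>L\<^esub> y) = \<pi> x \<otimes>\<^bsub>L\<^esub> y"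
    using equivariant_projection_exists[OF assms(1,2)] unfolding I_def by blast
  define K where "K = hemisemidirect_sum G M act"
  define h where "h x = (q x, \<pi> x)" for x
  have \<pi>_minus: "\<pi> (x \<ominus>\<^bsub>L\<^esub> y) = \<pi> x \<ominus>\<^bsub>L\<^esub> \<pi> y" if "x \<in> carrier L" "y \<in> carrier L" for x y
  proof -
    have "\<pi> (\<ominus>\<^bsub>L\<^esub> y) = \<ominus>\<^bsub>L\<^esub> \<pi> y"
      using \<pi>_scale[OF that(2), of "- 1"] that(2) \<pi>I I_carrier by (simp add: scale_uminus_one)
    then show ?thesis using that by (simp add: a_minus_def \<pi>_add)
  qed
  have K_simps: "carrier K = carrier G \<times> I"
    "(u, m) \<oplus>\<^bsub>K\<^esub> (v, n) = (u \<oplus>\<^bsub>G\<^esub> v, m \<oplus>\<^bsub>L\<^esub> n)" "c \<odot>\<^bsub>K\<^esub> (u, m) = (c \<odot>\<^bsub>G\<^esub> u, c \<odot>\<^bsub>L\<^esub> m)"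
    "(u, m) \<otimes>\<^bsub>K\<^esub> (v, n) = (u \<otimes>\<^bsub>G\<^esub> v, act m v)" "\<zero>\<^bsub>K\<^esub> = (\<zero>\<^bsub>G\<^esub>, \<zero>\<^bsub>L\<^esub>)" for u m v n c
    by (simp_all add: K_def hemisemidirect_sum_def M_simps)
  have h_add: "h (x \<oplus>\<^bsub>L\<^esub> y) = h x \<oplus>\<^bsub>K\<^esub> h y" if "x \<in> carrier L" "y \<in> carrier L" for x y
    using that by (simp add: h_def K_simps Gq(2) \<pi>_add)
  have h_scale: "h (c \<odot>\<^bsub>L\<^esub> x) = c \<odot>\<^bsub>K\<^esub> h x" if "x \<in> carrier L" for c x
    using that by (simp add: h_def K_simps Gq(3) \<pi>_scale)
  have h_mult: "h (x \<otimes>\<^bsub>L\<^esub> y) = h x \<otimes>\<^bsub>K\<^esub> h y" if "x \<in> carrier L" "y \<in> carrier L" for x y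
    using that by (simp add: h_def K_simps Gq(4) \<pi>_mult act_q \<pi>I)
  have h_zero: "h \<zero>\<^bsub>L\<^esub> = \<zero>\<^bsub>K\<^esub>"
    using \<pi>_id[OF II(2)] by (simp add: h_def K_simps Gq(5))
  \<comment> \<open>Equal cosets put \<open>x - y\<close> into \<open>I\<close>, where
    \<open>\<pi>\<close> is the identity, while equal second components make \<open>\<pi>\<close>
    vanish on it.\<close>
  have "inj_on h (carrier L)"
  proof (rule inj_onI)
    fix x y assume xy: "x \<in> carrier L" "y \<in> carrier L" "h x = h y"
    then have "x \<ominus>\<^bsub>L\<^esub> y \<in> I" using q_eq by (simp add: h_def)
    then have "x \<ominus>\<^bsub>L\<^esub> y = \<pi> x \<ominus>\<^bsub>L\<^esub> \<pi> y" using \<pi>_id \<pi>_minus[OF xy(1,2)] by simp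
    also have "\<dots> = \<zero>\<^bsub>L\<^esub>"
      using xy \<pi>I I_carrier by (simp add: h_def a_minus_def r_neg)
    finally have "(x \<ominus>\<^bsub>L\<^esub> y) \<oplus>\<^bsub>L\<^esub> y = y" using xy by simp
    then show "x = y" using xy by (simp add: a_minus_def a_assoc l_neg)
  qed
  moreover have surj: "h ` carrier L = carrier K"
  proof
    show "h ` carrier L \<subseteq> carrier K" using \<pi>I qG by (auto simp: h_def K_simps)
    show "carrier K \<subseteq> h ` carrier L"
    proof
      fix k assume "k \<in> carrier K"
      then obtain u m where k: "k = (u, m)" "u \<in> carrier G" "m \<in> I" by (auto simp: K_simps)
      obtain x where x: "x \<in> carrier L" "u = q x" using rep[OF k(2)] by blast
      \<comment> \<open>Removing \<open>\<pi> x\<close> stays in the coset of \<open>x\<close> and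
        leaves a vector killed by \<open>\<pi>\<close>; adding \<open>m\<close> then sets the second
        component.\<close>
      define z where "z = (x \<ominus>\<^bsub>L\<^esub> \<pi> x) \<oplus>\<^bsub>L\<^esub> m"
      have \<pi>x: "\<pi> x \<in> I" "\<pi> x \<in> carrier L" using \<pi>I[OF x(1)] I_carrier by auto
      have m: "m \<in> carrier L" using k(3) I_carrier by blast
      have z: "z \<in> carrier L" using x \<pi>x m by (simp add: z_def)
      have "z \<ominus>\<^bsub>L\<^esub> x = m \<ominus>\<^bsub>L\<^esub> \<pi> x"
        using x(1) \<pi>x(2) m by (simp add: z_def a_minus_def a_ac r_neg1 r_neg2)
      then have "q z = q x" using q_eq[OF z x(1)] subspace_of_diff[OF sI k(3) \<pi>x(1)] by simp
      moreover have "\<pi> z = (\<pi> x \<ominus>\<^bsub>L\<^esub> \<pi> x) \<oplus>\<^bsub>L\<^esub> m"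
        using x(1) \<pi>x m k(3) by (simp add: z_def \<pi>_add \<pi>_minus \<pi>_id)
      then have "\<pi> z = m" using \<pi>x m by (simp add: a_minus_def r_neg)
      ultimately show "k \<in> h ` carrier L" using z x k(1) by (intro image_eqI[of _ _ z]) (simp_all add: h_def)
    qed
  qed
  ultimately have bij: "bij_betw h (carrier L) (carrier K)" by (simp add: bij_betw_def)
  have "leibniz_algebra K"
    by (rule leibniz_surjective_image[OF surj h_add h_scale h_mult h_zero])
  then have iso: "leibniz_isomorphic L K"
    unfolding leibniz_isomorphic_def using leibniz_algebra_axioms bij h_add h_scale h_mult by blast
  show ?thesis
    using simpleG act_q rlm irr iso by (simp add: q_def K_def)
qed

end
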